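(* Let $K$ be a field, let $B\subseteq\mathbb Z^n$ be a simplicial affine semigroup with chosen linearly independent elements $e_1,\ldots,e_d\in B$ satisfying $C(\{e_1,\ldots,e_d\})=C(B)$, and let $\tilde B=\langle e_1,\ldots,e_d,h_1,\ldots,h_f\rangle$ be the affine semigroup constructed in the context. Then $B\subseteq\tilde B\subseteq C(B)$ and the ring $K[\tilde B]$ is Cohen-Macaulay. Moreover, if $\hat B\subseteq \mathbb Z^n$ is an affine semigroup with $B\subseteq\hat B\subseteq C(B)$ such that the ring $K[\hat B]$ is Cohen-Macaulay, then $\tilde B\subseteq\hat B$.
   Context: An affine semigroup is a finitely generated submonoid of $(\mathbb Z^n,+)$ for some $n\in\mathbb N^+$ (here $0\in\mathbb N$). For a field $K$ and an affine semigroup $S\subseteq\mathbb Z^n$, $K[S]$ is the affine semigroup ring: the $K$-vector space with basis $\{t^s\mid s\in S\}$ and multiplication given by the $K$-bilinear extension of $t^a\cdot t^b=t^{a+b}$. For $X\subseteq\mathbb Q^n$, $C(X):=\{\sum\lambda_ix_i \text{ (finite sums)}\mid \lambda_i\in\mathbb Q_{\ge0},\ x_i\in X\}$ is the cone spanned by $X$; for $X\subseteq\mathbb Z^n$, $G(X)$ is the subgroup of $\mathbb Z^n$ generated by $X$, and $\langle X\rangle$ is the submonoid generated by $X$. An affine semigroup $B\subseteq\mathbb Z^n$ is simplicial if there are linearly independent $e_1,\ldots,e_d\in B$ with $C(\{e_1,\ldots,e_d\})=C(B)$. Fix such $e_1,\ldots,e_d$ and put $A:=\langle e_1,\ldots,e_d\rangle\subseteq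 B$. For $x\in G(B)$ let $\lambda_1^x,\ldots,\lambda_d^x\in\mathbb Q$ be the unique rationals with $x=\sum_{i=1}^d\lambda_i^xe_i$. For $x,y\in G(B)$ write $x\sim y$ if $x-y\in G(A)$; this is an equivalence relation on $G(B)$. Define $$B_A:=\{x\in B\mid x-a\notin B\ \text{for all } a\in A\setminus\{0\}\},$$ which is a finite set. Let $\Gamma_1,\ldots,\Gamma_f$ be the equivalence classes of $\sim$ on $B_A$ (their number $f$ is finite), and for $j=1,\ldots,f$ define $$h_j:=\sum_{i=1}^d\min\{\lambda_i^x\mid x\in\Gamma_j\}\,e_i .$$ One has $h_j\in C(B)\cap G(B)$, in particular $h_j\in\mathbb Z^n$. Finally set $\tilde B:=\langle e_1,\ldots,e_d,h_1,\ldots,h_f\rangle$. *)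

theory Defs
  imports
    "HOL-Analysis.Cartesian_Space"
    "HOL-Library.Poly_Mapping"
    "HOL-Library.Extended_Nat"
    "HOL-Computational_Algebra.Group_Closure"
    "HOL-Algebra.Ring_Divisibility"
begin

definition krull_dim :: "('a, 'b) ring_scheme \<Rightarrow> enat" where
  "krull_dim R = Sup {enat n | n. \<exists>P. (\<forall>i\<le>n. primeideal (P i) R) \<and> (\<forall>i<n. P i \<subset> P (Suc i))}"

definition regular_sequence :: "('a, 'b) ring_scheme \<Rightarrow> 'a list \<Rightarrow> bool" where
  "regular_sequence R xs \<longleftrightarrow>
     set xs \<subseteq> carrier R \<and>
     (\<forall>i<length xs. \<forall>r\<in>carrier R.
        xs ! i \<otimes>\<^bsub>R\<^esub> r \<in> Idl\<^bsub>R\<^esub> (set (take i xs)) \<longrightarrow> r \<in> Idl\<^bsub>R\<^esub> (set (take i xs))) \<and>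
     Idl\<^bsub>R\<^esub> (set xs) \<noteq> carrier R"

definition local_ring :: "('a, 'b) ring_scheme \<Rightarrow> bool" where
  "local_ring R \<longleftrightarrow> cring R \<and> (\<exists>!m. maximalideal m R)"

definition local_depth :: "('a, 'b) ring_scheme \<Rightarrow> enat" where
  "local_depth R =
     Sup {enat (length xs) | xs. regular_sequence R xs \<and> set xs \<subseteq> (THE m. maximalideal m R)}"

definition cohen_macaulay_local :: "('a, 'b) ring_scheme \<Rightarrow> bool" where
  "cohen_macaulay_local R \<longleftrightarrow>
     local_ring R \<and> noetherian_ring R \<and> local_depth R = krull_dim R"

definition localization_rel ::
    "('a, 'b) ring_scheme \<Rightarrow> 'a set \<Rightarrow> (('a \<times> 'a) \<times> ('a \<times> 'a)) set" where
  "localization_rel R p =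
     {((a, s), (b, t)). a \<in> carrier R \<and> s \<in> carrier R - p \<and> b \<in> carrier R \<and> t \<in> carrier R - p \<and>
        (\<exists>u\<in>carrier R - p. u \<otimes>\<^bsub>R\<^esub> (a \<otimes>\<^bsub>R\<^esub> t \<ominus>\<^bsub>R\<^esub> b \<otimes>\<^bsub>R\<^esub> s) = \<zero>\<^bsub>R\<^esub>)}"

definition fraction :: "('a, 'b) ring_scheme \<Rightarrow> 'a set \<Rightarrow> 'a \<Rightarrow> 'a \<Rightarrow> ('a \<times> 'a) set" where
  "fraction R p a s = localization_rel R p `` {(a, s)}"

text \<open>The unions range over equal sets, since the operations do not depend on the representatives
  (see \<open>localization_mult\<close> and \<open>localization_add\<close> below).\<close>

definition localization :: "('a, 'b) ring_scheme \<Rightarrow> 'a set \<Rightarrow> ('a \<times> 'a) set ring" where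
  "localization R p =
     \<lparr>carrier = (carrier R \<times> (carrier R - p)) // localization_rel R p,
      mult = (\<lambda>X Y. \<Union>(a, s)\<in>X. \<Union>(b, t)\<in>Y. fraction R p (a \<otimes>\<^bsub>R\<^esub> b) (s \<otimes>\<^bsub>R\<^esub> t)),
      one = fraction R p \<one>\<^bsub>R\<^esub> \<one>\<^bsub>R\<^esub>,
      zero = fraction R p \<zero>\<^bsub>R\<^esub> \<one>\<^bsub>R\<^esub>,
      add = (\<lambda>X Y. \<Union>(a, s)\<in>X. \<Union>(b, t)\<in>Y.
               fraction R p (a \<otimes>\<^bsub>R\<^esub> t \<oplus>\<^bsub>R\<^esub> b \<otimes>\<^bsub>R\<^esub> s) (s \<otimes>\<^bsub>R\<^esub> t))\<rparr>"

definition cohen_macaulay :: "('a, 'b) ring_scheme \<Rightarrow> bool" where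
  "cohen_macaulay R \<longleftrightarrow>
     cring R \<and> noetherian_ring R \<and>
     (\<forall>p. primeideal p R \<longrightarrow> cohen_macaulay_local (localization R p))"

inductive_set monoid_closure :: "'a::comm_monoid_add set \<Rightarrow> 'a set" for X where
  zero: "0 \<in> monoid_closure X"
| base: "x \<in> X \<Longrightarrow> x \<in> monoid_closure X"
| add: "x \<in> monoid_closure X \<Longrightarrow> y \<in> monoid_closure X \<Longrightarrow> x + y \<in> monoid_closure X"

definition affine_semigroup :: "(int ^ 'n) set \<Rightarrow> bool" where
  "affine_semigroup S \<longleftrightarrow> (\<exists>X. finite X \<and> S = monoid_closure X)"

text \<open>The subring of the group ring \<open>K[\<int>\<^sup>n]\<close> (finitely supported functions with convolution)
  formed by the elements with support in \<open>S\<close>.\<close>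

definition semigroup_ring :: "'k::field itself \<Rightarrow> (int ^ 'n) set \<Rightarrow> ((int ^ 'n) \<Rightarrow>\<^sub>0 'k) ring" where
  "semigroup_ring _ S =
     \<lparr>carrier = {f. Poly_Mapping.keys f \<subseteq> S}, mult = (*), one = 1, zero = 0, add = (+)\<rparr>"

definition rat_vec :: "int ^ 'n \<Rightarrow> rat ^ 'n" where
  "rat_vec x = (\<chi> i. of_int (x $ i))"

definition rat_cone :: "(rat ^ 'n) set \<Rightarrow> (rat ^ 'n) set" where
  "rat_cone X = {\<Sum>x\<in>F. c x *s x | F c. finite F \<and> F \<subseteq> X \<and> (\<forall>x\<in>F. 0 \<le> c x)}"

definition simplicial_gens :: "(int ^ 'n) set \<Rightarrow> nat \<Rightarrow> (nat \<Rightarrow> int ^ 'n) \<Rightarrow> bool" where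
  "simplicial_gens B d e \<longleftrightarrow>
     e ` {1..d} \<subseteq> B \<and>
     inj_on e {1..d} \<and> vec.independent (rat_vec ` e ` {1..d}) \<and>
     rat_cone (rat_vec ` e ` {1..d}) = rat_cone (rat_vec ` B)"

definition coord :: "nat \<Rightarrow> (nat \<Rightarrow> int ^ 'n) \<Rightarrow> nat \<Rightarrow> int ^ 'n \<Rightarrow> rat" where
  "coord d e i x = vec.representation (rat_vec ` e ` {1..d}) (rat_vec x) (rat_vec (e i))"

definition minimal_elems :: "(int ^ 'n) set \<Rightarrow> nat \<Rightarrow> (nat \<Rightarrow> int ^ 'n) \<Rightarrow> (int ^ 'n) set" where
  "minimal_elems B d e = {x \<in> B. \<forall>a \<in> monoid_closure (e ` {1..d}) - {0}. x - a \<notin> B}"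

definition minimal_classes :: "(int ^ 'n) set \<Rightarrow> nat \<Rightarrow> (nat \<Rightarrow> int ^ 'n) \<Rightarrow> (int ^ 'n) set set" where
  "minimal_classes B d e =
     minimal_elems B d e //
       {(x, y). x \<in> minimal_elems B d e \<and> y \<in> minimal_elems B d e \<and>
                x - y \<in> group_closure (monoid_closure (e ` {1..d}))}"

text \<open>The integral vector whose image in \<open>\<rat>\<^sup>n\<close> is \<open>\<Sum>\<^sub>i min {\<lambda>\<^sub>i\<^sup>x | x \<in> \<Gamma>} e\<^sub>i\<close>; it exists for every
  class \<open>\<Gamma>\<close> by \<open>rat_vec_class_min\<close> below.\<close>

definition class_min :: "nat \<Rightarrow> (nat \<Rightarrow> int ^ 'n) \<Rightarrow> (int ^ 'n) set \<Rightarrow> int ^ 'n" where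
  "class_min d e \<Gamma> = (THE h. rat_vec h = (\<Sum>i = 1..d. Min (coord d e i ` \<Gamma>) *s rat_vec (e i)))"

definition tilde :: "(int ^ 'n) set \<Rightarrow> nat \<Rightarrow> (nat \<Rightarrow> int ^ 'n) \<Rightarrow> (int ^ 'n) set" where
  "tilde B d e = monoid_closure (e ` {1..d} \<union> class_min d e ` minimal_classes B d e)"

lemma semigroup_ring_cring:
  assumes "affine_semigroup S"
  shows "cring (semigroup_ring TYPE('k::field) S)"
proof -
  from assms have 0: "0 \<in> S" and add: "\<And>x y. x \<in> S \<Longrightarrow> y \<in> S \<Longrightarrow> x + y \<in> S"
    by (auto simp: affine_semigroup_def intro: monoid_closure.intros)
  show ?thesis
  proof (intro cringI abelian_groupI comm_monoidI)
    fix f assume "f \<in> carrier (semigroup_ring TYPE('k) S)"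
    then show "\<exists>g\<in>carrier (semigroup_ring TYPE('k) S).
        g \<oplus>\<^bsub>semigroup_ring TYPE('k) S\<^esub> f = \<zero>\<^bsub>semigroup_ring TYPE('k) S\<^esub>"
      by (intro bexI[of _ "- f"]) (auto simp: semigroup_ring_def)
  next
    fix f g assume "f \<in> carrier (semigroup_ring TYPE('k) S)" "g \<in> carrier (semigroup_ring TYPE('k) S)"
    then show "f \<otimes>\<^bsub>semigroup_ring TYPE('k) S\<^esub> g \<in> carrier (semigroup_ring TYPE('k) S)"
      using keys_mult[of f g] add by (fastforce simp: semigroup_ring_def)
  next
    fix f g assume "f \<in> carrier (semigroup_ring TYPE('k) S)" "g \<in> carrier (semigroup_ring TYPE('k) S)"
    then show "f \<oplus>\<^bsub>semigroup_ring TYPE('k) S\<^esub> g \<in> carrier (semigroup_ring TYPE('k) S)"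
      using Poly_Mapping.keys_add[of f g] by (auto simp: semigroup_ring_def)
  qed (auto simp: semigroup_ring_def 0 algebra_simps)
qed

context primeideal
begin

lemma localization_rel_iff:
  "((a, s), (b, t)) \<in> localization_rel R I \<longleftrightarrow>
     a \<in> carrier R \<and> s \<in> carrier R - I \<and> b \<in> carrier R \<and> t \<in> carrier R - I \<and>
     (\<exists>u\<in>carrier R - I. u \<otimes> (a \<otimes> t) = u \<otimes> (b \<otimes> s))"
proof -
  have "u \<otimes> (a \<otimes> t \<ominus> b \<otimes> s) = \<zero> \<longleftrightarrow> u \<otimes> (a \<otimes> t) = u \<otimes> (b \<otimes> s)"
    if "a \<in> carrier R" "s \<in> carrier R" "b \<in> carrier R" "t \<in> carrier R" "u \<in> carrier R" for u
  proof -
    have "u \<otimes> (a \<otimes> t \<ominus> b \<otimes> s) = u \<otimes> (a \<otimes> t) \<ominus> u \<otimes> (b \<otimes> s)"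
      using that by (simp add: a_minus_def r_distr r_minus)
    then show ?thesis using that by (simp add: r_right_minus_eq)
  qed
  then show ?thesis by (auto simp: localization_rel_def)
qed

lemma compl_mult: "s \<in> carrier R - I \<Longrightarrow> t \<in> carrier R - I \<Longrightarrow> s \<otimes> t \<in> carrier R - I"
  using I_prime by auto

lemma compl_one: "\<one> \<in> carrier R - I"
  using I_notcarr one_imp_carrier by auto

lemma localization_relI:
  assumes "a \<in> carrier R" "s \<in> carrier R - I" "b \<in> carrier R" "t \<in> carrier R - I"
    "u \<in> carrier R - I" "u \<otimes> (a \<otimes> t) = u \<otimes> (b \<otimes> s)"
  shows "((a, s), (b, t)) \<in> localization_rel R I"
  using assms by (auto simp: localization_rel_iff)

lemma localization_rel_equiv: "equiv (carrier R \<times> (carrier R - I)) (localization_rel R I)"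
proof (rule equivI)
  show "localization_rel R I \<subseteq> (carrier R \<times> (carrier R - I)) \<times> (carrier R \<times> (carrier R - I))"
    by (auto simp: localization_rel_def)
  show "refl_on (carrier R \<times> (carrier R - I)) (localization_rel R I)"
    by (rule refl_onI) (use compl_one in \<open>auto simp: localization_rel_iff\<close>)
  show "sym (localization_rel R I)"
  proof (rule symI)
    fix x y assume "(x, y) \<in> localization_rel R I"
    then obtain a s b t u where "x = (a, s)" "y = (b, t)" "a \<in> carrier R" "b \<in> carrier R"
      "s \<in> carrier R - I" "t \<in> carrier R - I" "u \<in> carrier R - I"
      "u \<otimes> (b \<otimes> s) = u \<otimes> (a \<otimes> t)"
      by (cases x, cases y) (auto simp: localization_rel_iff)
    then show "(y, x) \<in> localization_rel R I" by (blast intro: localization_relI)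
  qed
  show "trans (localization_rel R I)"
  proof (rule transI)
    fix x y z assume "(x, y) \<in> localization_rel R I" "(y, z) \<in> localization_rel R I"
    then obtain a s b t c r u v where *: "x = (a, s)" "y = (b, t)" "z = (c, r)"
      "a \<in> carrier R" "b \<in> carrier R" "c \<in> carrier R"
      "s \<in> carrier R - I" "t \<in> carrier R - I" "r \<in> carrier R - I"
      "u \<in> carrier R - I" "v \<in> carrier R - I"
      and eq: "u \<otimes> (a \<otimes> t) = u \<otimes> (b \<otimes> s)" "v \<otimes> (b \<otimes> r) = v \<otimes> (c \<otimes> t)"
      by (cases x, cases y, cases z) (auto simp: localization_rel_iff)
    then have c: "s \<in> carrier R" "t \<in> carrier R" "r \<in> carrier R" "u \<in> carrier R" "v \<in> carrier R"
      by auto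
    have "(u \<otimes> v \<otimes> t) \<otimes> (a \<otimes> r) = (u \<otimes> (a \<otimes> t)) \<otimes> (v \<otimes> r)"
      using c * by (simp add: m_ac)
    also have "\<dots> = (v \<otimes> (b \<otimes> r)) \<otimes> (u \<otimes> s)" unfolding eq(1) using c * by (simp add: m_ac)
    also have "\<dots> = (u \<otimes> v \<otimes> t) \<otimes> (c \<otimes> s)" unfolding eq(2) using c * by (simp add: m_ac)
    finally show "(x, z) \<in> localization_rel R I"
      using * unfolding *(1,3) by (intro localization_relI) (auto intro!: compl_mult simp del: Diff_iff)
  qed
qed

lemma fraction_eq_iff:
  assumes "a \<in> carrier R" "s \<in> carrier R - I" "b \<in> carrier R" "t \<in> carrier R - I"
  shows "fraction R I a s = fraction R I b t \<longleftrightarrow>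
    (\<exists>u\<in>carrier R - I. u \<otimes> (a \<otimes> t) = u \<otimes> (b \<otimes> s))"
  using eq_equiv_class_iff[OF localization_rel_equiv, of "(a, s)" "(b, t)"] assms
  by (auto simp: fraction_def localization_rel_iff)

lemma fraction_eqI:
  assumes "a \<in> carrier R" "s \<in> carrier R - I" "b \<in> carrier R" "t \<in> carrier R - I"
    "u \<in> carrier R - I" "u \<otimes> (a \<otimes> t) = u \<otimes> (b \<otimes> s)"
  shows "fraction R I a s = fraction R I b t"
  using assms fraction_eq_iff by blast

lemma localization_mult:
  assumes "a \<in> carrier R" "s \<in> carrier R - I" "b \<in> carrier R" "t \<in> carrier R - I"
  shows "fraction R I a s \<otimes>\<^bsub>localization R I\<^esub> fraction R I b t = fraction R I (a \<otimes> b) (s \<otimes> t)"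
proof -
  have "(\<lambda>(a, s) (b, t). fraction R I (a \<otimes> b) (s \<otimes> t)) respects2 localization_rel R I"
  proof (rule congruent2I', clarify)
    fix a s a' s' b t b' t'
    assume "((a, s), (a', s')) \<in> localization_rel R I" "((b, t), (b', t')) \<in> localization_rel R I"
    then obtain u v where *: "a \<in> carrier R" "b \<in> carrier R" "a' \<in> carrier R" "b' \<in> carrier R"
      "s \<in> carrier R - I" "t \<in> carrier R - I" "s' \<in> carrier R - I" "t' \<in> carrier R - I"
      "u \<in> carrier R - I" "v \<in> carrier R - I"
      and eq: "u \<otimes> (a \<otimes> s') = u \<otimes> (a' \<otimes> s)" "v \<otimes> (b \<otimes> t') = v \<otimes> (b' \<otimes> t)"
      by (auto simp: localization_rel_iff)
    then have c: "s \<in> carrier R" "t \<in> carrier R" "s' \<in> carrier R" "t' \<in> carrier R"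
      "u \<in> carrier R" "v \<in> carrier R" by auto
    have "(u \<otimes> v) \<otimes> (a \<otimes> b \<otimes> (s' \<otimes> t')) = (u \<otimes> (a \<otimes> s')) \<otimes> (v \<otimes> (b \<otimes> t'))"
      using c * by (simp add: m_ac)
    also have "\<dots> = (u \<otimes> v) \<otimes> (a' \<otimes> b' \<otimes> (s \<otimes> t))" unfolding eq using c * by (simp add: m_ac)
    finally show "fraction R I (a \<otimes> b) (s \<otimes> t) = fraction R I (a' \<otimes> b') (s' \<otimes> t')"
      using * by (intro fraction_eqI) (auto intro!: compl_mult simp del: Diff_iff)
  qed
  from UN_equiv_class2[OF localization_rel_equiv localization_rel_equiv this, of "(a, s)" "(b, t)"]
  show ?thesis using assms by (simp add: localization_def fraction_def case_prod_unfold)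
qed

lemma localization_add:
  assumes "a \<in> carrier R" "s \<in> carrier R - I" "b \<in> carrier R" "t \<in> carrier R - I"
  shows "fraction R I a s \<oplus>\<^bsub>localization R I\<^esub> fraction R I b t =
    fraction R I (a \<otimes> t \<oplus> b \<otimes> s) (s \<otimes> t)"
proof -
  have "(\<lambda>(a, s) (b, t). fraction R I (a \<otimes> t \<oplus> b \<otimes> s) (s \<otimes> t)) respects2 localization_rel R I"
  proof (rule congruent2I', clarify)
    fix a s a' s' b t b' t'
    assume "((a, s), (a', s')) \<in> localization_rel R I" "((b, t), (b', t')) \<in> localization_rel R I"
    then obtain u v where *: "a \<in> carrier R" "b \<in> carrier R" "a' \<in> carrier R" "b' \<in> carrier R"
      "s \<in> carrier R - I" "t \<in> carrier R - I" "s' \<in> carrier R - I" "t' \<in> carrier R - I"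
      "u \<in> carrier R - I" "v \<in> carrier R - I"
      and eq: "u \<otimes> (a \<otimes> s') = u \<otimes> (a' \<otimes> s)" "v \<otimes> (b \<otimes> t') = v \<otimes> (b' \<otimes> t)"
      by (auto simp: localization_rel_iff)
    then have c: "s \<in> carrier R" "t \<in> carrier R" "s' \<in> carrier R" "t' \<in> carrier R"
      "u \<in> carrier R" "v \<in> carrier R" by auto
    have "(u \<otimes> v) \<otimes> ((a \<otimes> t \<oplus> b \<otimes> s) \<otimes> (s' \<otimes> t')) =
        (u \<otimes> (a \<otimes> s')) \<otimes> (v \<otimes> t \<otimes> t') \<oplus> (v \<otimes> (b \<otimes> t')) \<otimes> (u \<otimes> s \<otimes> s')"
      using c * by (simp add: m_ac l_distr r_distr)
    also have "\<dots> = (u \<otimes> v) \<otimes> ((a' \<otimes> t' \<oplus> b' \<otimes> s') \<otimes> (s \<otimes> t))"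
      unfolding eq using c * by (simp add: m_ac l_distr r_distr)
    finally show "fraction R I (a \<otimes> t \<oplus> b \<otimes> s) (s \<otimes> t) =
        fraction R I (a' \<otimes> t' \<oplus> b' \<otimes> s') (s' \<otimes> t')"
      using * c by (intro fraction_eqI) (auto intro!: compl_mult simp del: Diff_iff)
  qed
  from UN_equiv_class2[OF localization_rel_equiv localization_rel_equiv this, of "(a, s)" "(b, t)"]
  show ?thesis using assms by (simp add: localization_def fraction_def case_prod_unfold)
qed

lemma localization_carrierE:
  assumes "X \<in> carrier (localization R I)"
  obtains a s where "a \<in> carrier R" "s \<in> carrier R - I" "X = fraction R I a s"
  using assms by (auto simp: localization_def fraction_def elim!: quotientE)

lemma fraction_carrier:
  "a \<in> carrier R \<Longrightarrow> s \<in> carrier R - I \<Longrightarrow> fraction R I a s \<in> carrier (localization R I)"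
  by (auto simp: localization_def fraction_def intro!: quotientI)

lemma localization_zero: "\<zero>\<^bsub>localization R I\<^esub> = fraction R I \<zero> \<one>"
  and localization_one: "\<one>\<^bsub>localization R I\<^esub> = fraction R I \<one> \<one>"
  by (simp_all add: localization_def)

lemma localization_cring: "cring (localization R I)"
proof -
  note [simp del] = Diff_iff
  have [simp]: "x \<in> carrier R" if "x \<in> carrier R - I" for x using that by (simp add: Diff_iff)
  note [simp] = localization_zero localization_one localization_add localization_mult
    fraction_carrier compl_mult compl_one
  let ?L = "localization R I"
  show ?thesis
  proof (intro cringI abelian_groupI comm_monoidI)
    fix X Y Z assume "X \<in> carrier ?L" "Y \<in> carrier ?L" "Z \<in> carrier ?L"
    then obtain a s b t c r where [simp]: "a \<in> carrier R" "b \<in> carrier R" "c \<in> carrier R"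
      "s \<in> carrier R - I" "t \<in> carrier R - I" "r \<in> carrier R - I"
      and X: "X = fraction R I a s" "Y = fraction R I b t" "Z = fraction R I c r"
      by (metis localization_carrierE)
    show "X \<oplus>\<^bsub>?L\<^esub> Y \<oplus>\<^bsub>?L\<^esub> Z = X \<oplus>\<^bsub>?L\<^esub> (Y \<oplus>\<^bsub>?L\<^esub> Z)"
      unfolding X by (simp, rule fraction_eqI[of _ _ _ _ \<one>]) (simp_all add: m_ac a_ac l_distr r_distr)
    show "X \<otimes>\<^bsub>?L\<^esub> Y \<otimes>\<^bsub>?L\<^esub> Z = X \<otimes>\<^bsub>?L\<^esub> (Y \<otimes>\<^bsub>?L\<^esub> Z)"
      unfolding X by (simp add: m_assoc)
    show "(X \<oplus>\<^bsub>?L\<^esub> Y) \<otimes>\<^bsub>?L\<^esub> Z = X \<otimes>\<^bsub>?L\<^esub> Z \<oplus>\<^bsub>?L\<^esub> Y \<otimes>\<^bsub>?L\<^esub> Z"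
      unfolding X by (simp, rule fraction_eqI[of _ _ _ _ \<one>]) (simp_all add: m_ac a_ac l_distr r_distr)
  next
    fix X Y assume "X \<in> carrier ?L" "Y \<in> carrier ?L"
    then obtain a s b t where [simp]: "a \<in> carrier R" "b \<in> carrier R"
      "s \<in> carrier R - I" "t \<in> carrier R - I"
      and X: "X = fraction R I a s" "Y = fraction R I b t"
      by (metis localization_carrierE)
    show "X \<oplus>\<^bsub>?L\<^esub> Y \<in> carrier ?L" "X \<otimes>\<^bsub>?L\<^esub> Y \<in> carrier ?L"
      unfolding X by simp_all
    show "X \<oplus>\<^bsub>?L\<^esub> Y = Y \<oplus>\<^bsub>?L\<^esub> X" "X \<otimes>\<^bsub>?L\<^esub> Y = Y \<otimes>\<^bsub>?L\<^esub> X"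
      unfolding X by (simp_all add: a_comm m_comm)
  next
    fix X assume "X \<in> carrier ?L"
    then obtain a s where [simp]: "a \<in> carrier R" "s \<in> carrier R - I" and X: "X = fraction R I a s"
      by (metis localization_carrierE)
    show "\<zero>\<^bsub>?L\<^esub> \<oplus>\<^bsub>?L\<^esub> X = X" "\<one>\<^bsub>?L\<^esub> \<otimes>\<^bsub>?L\<^esub> X = X"
      unfolding X by simp_all
    have "fraction R I (\<ominus> a) s \<oplus>\<^bsub>?L\<^esub> X = \<zero>\<^bsub>?L\<^esub>"
      unfolding X by (simp, rule fraction_eqI[of _ _ _ _ \<one>]) (simp_all add: l_minus l_neg)
    then show "\<exists>Y\<in>carrier ?L. Y \<oplus>\<^bsub>?L\<^esub> X = \<zero>\<^bsub>?L\<^esub>"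
      by (rule bexI) simp
  qed simp_all
qed

end

lemma rat_vec_simps [simp]:
  "rat_vec 0 = 0" "rat_vec (x + y) = rat_vec x + rat_vec y" "rat_vec (x - y) = rat_vec x - rat_vec y"
  "rat_vec (m *s x) = of_int m *s rat_vec x"
  by (simp_all add: rat_vec_def vec_eq_iff)

lemma rat_vec_sum: "rat_vec (sum f I) = (\<Sum>i\<in>I. rat_vec (f i))"
  by (induction I rule: infinite_finite_induct) auto

lemma rat_vec_eq_iff [simp]: "rat_vec x = rat_vec y \<longleftrightarrow> x = y"
  by (simp add: rat_vec_def vec_eq_iff)

lemma monoid_closure_scale:
  "x \<in> monoid_closure X \<Longrightarrow> int k *s x \<in> monoid_closure X"
proof (induction k)
  case 0
  then show ?case by (simp add: monoid_closure.zero)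
next
  case (Suc k)
  have "int (Suc k) *s x = x + int k *s x" by (simp add: vec_eq_iff distrib_right)
  with Suc show ?case by (simp add: monoid_closure.add)
qed

lemma monoid_closure_sum:
  "(\<And>i. i \<in> I \<Longrightarrow> f i \<in> monoid_closure X) \<Longrightarrow> sum f I \<in> monoid_closure X"
  by (induction I rule: infinite_finite_induct) (auto simp: monoid_closure.intros)

lemma monoid_closure_subset:
  "X \<subseteq> monoid_closure Y \<Longrightarrow> monoid_closure X \<subseteq> monoid_closure Y"
proof
  fix x assume "X \<subseteq> monoid_closure Y" "x \<in> monoid_closure X"
  from this(2,1) show "x \<in> monoid_closure Y"
    by (induction rule: monoid_closure.induct) (auto simp: monoid_closure.intros)
qed

lemma monoid_closure_finite_repr:
  fixes X :: "(int ^ 'n) set"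
  assumes "finite X" "x \<in> monoid_closure X"
  shows "\<exists>n. (\<forall>b. b = 0 \<longrightarrow> n b = 0) \<and> x = (\<Sum>b\<in>X. int (n b) *s b)"
  using assms(2)
proof (induction rule: monoid_closure.induct)
  case zero
  show ?case by (rule exI[of _ "\<lambda>_. 0"]) simp
next
  case (base x)
  show ?case
  proof (cases "x = 0")
    case True
    then show ?thesis by (intro exI[of _ "\<lambda>_. 0"]) simp
  next
    case False
    have "(\<Sum>b\<in>X. int (if b = x then 1 else 0) *s b) = (\<Sum>b\<in>X. if b = x then b else 0)"
      by (intro sum.cong) auto
    also have "\<dots> = x" using base assms(1) by simp
    finally show ?thesis using False by (intro exI[of _ "\<lambda>b. if b = x then 1 else 0"]) auto
  qed
next
  case (add x y)
  then obtain n m where "\<forall>b. b = 0 \<longrightarrow> n b = 0" "x = (\<Sum>b\<in>X. int (n b) *s b)"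
    "\<forall>b. b = 0 \<longrightarrow> m b = 0" "y = (\<Sum>b\<in>X. int (m b) *s b)" by blast
  then show ?case
    by (intro exI[of _ "\<lambda>b. n b + m b"]) (simp add: vector_sadd_rdistrib sum.distrib)
qed

lemma common_denominator:
  fixes c :: "'i \<Rightarrow> rat"
  assumes "finite I"
  shows "\<exists>k::nat. 0 < k \<and> (\<forall>i\<in>I. of_nat k * c i \<in> \<int>)"
  using assms
proof (induction I rule: finite_induct)
  case empty
  show ?case by auto
next
  case (insert j I)
  then obtain k :: nat where k: "0 < k" "\<forall>i\<in>I. of_nat k * c i \<in> \<int>" by blast
  obtain a b where ab: "quotient_of (c j) = (a, b)" by force
  have b: "0 < b" using quotient_of_denom_pos[OF ab] .
  have cj: "of_int b * c j = of_int a" using quotient_of_div[OF ab] b by simp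
  have bn: "of_nat (nat b) = (of_int b :: rat)" using b by simp
  have "of_nat (k * nat b) * c i \<in> \<int>" if i: "i \<in> insert j I" for i
  proof (cases "i = j")
    case True
    have "of_nat (k * nat b) * c j = of_nat k * of_int a" by (simp only: of_nat_mult mult.assoc bn cj)
    then show ?thesis using True by (metis Ints_mult Ints_of_nat Ints_of_int)
  next
    case False
    then have "of_nat k * c i \<in> \<int>" using k i by blast
    moreover have "of_nat (k * nat b) * c i = of_int b * (of_nat k * c i)" using bn by simp
    ultimately show ?thesis using Ints_mult[OF Ints_of_int] by metis
  qed
  then show ?case using k b by (intro exI[of _ "k * nat b"]) auto
qed

lemma coord_eqI:
  assumes "simplicial_gens B d e" "rat_vec x = (\<Sum>i = 1..d. c i *s rat_vec (e i))" "i \<in> {1..d}"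
  shows "coord d e i x = c i"
proof -
  define E where "E = rat_vec ` e ` {1..d}"
  have inj: "inj_on (\<lambda>i. rat_vec (e i)) {1..d}"
    using assms(1) unfolding simplicial_gens_def inj_on_def rat_vec_eq_iff by blast
  define g where "g = (\<lambda>y. if y \<in> E then c (inv_into {1..d} (\<lambda>i. rat_vec (e i)) y) else 0)"
  have g: "g (rat_vec (e j)) = c j" if "j \<in> {1..d}" for j
    using that inv_into_f_f[OF inj that] by (simp add: g_def E_def)
  have E: "E = (\<lambda>i. rat_vec (e i)) ` {1..d}" by (auto simp: E_def)
  have "vec.representation E (rat_vec x) = g"
  proof (rule vec.representation_eqI)
    show "vec.independent E" using assms(1) unfolding simplicial_gens_def E_def by blast
    show "rat_vec x \<in> vec.span E"
      unfolding assms(2) by (intro vec.span_sum vec.span_scale vec.span_base) (auto simp: E_def)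
    show "\<And>b. g b \<noteq> 0 \<Longrightarrow> b \<in> E" by (auto simp: g_def split: if_splits)
    show "finite {b. g b \<noteq> 0}"
      by (rule finite_subset[of _ E]) (auto simp: g_def E_def split: if_splits)
    have "(\<Sum>b | g b \<noteq> 0. g b *s b) = (\<Sum>b\<in>E. g b *s b)"
      by (rule sum.mono_neutral_left) (auto simp: g_def E_def split: if_splits)
    also have "\<dots> = (\<Sum>i = 1..d. c i *s rat_vec (e i))"
      unfolding E using inj by (subst sum.reindex) (auto simp: g intro!: sum.cong)
    finally show "(\<Sum>b | g b \<noteq> 0. g b *s b) = rat_vec x" using assms(2) by simp
  qed
  then show ?thesis using g assms(3) by (simp add: coord_def E_def)
qed

lemma simplicial_repr:
  assumes "simplicial_gens B d e" "x \<in> B"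
  shows "rat_vec x = (\<Sum>i = 1..d. coord d e i x *s rat_vec (e i))"
    and "\<And>i. i \<in> {1..d} \<Longrightarrow> 0 \<le> coord d e i x"
proof -
  have inj: "inj_on (\<lambda>i. rat_vec (e i)) {1..d}"
    using assms(1) unfolding simplicial_gens_def inj_on_def rat_vec_eq_iff by blast
  have "rat_vec x \<in> rat_cone (rat_vec ` B)"
    unfolding rat_cone_def using assms(2)
    by (intro CollectI exI[of _ "{rat_vec x}"] exI[of _ "\<lambda>_. 1"]) auto
  then have "rat_vec x \<in> rat_cone (rat_vec ` e ` {1..d})"
    using assms(1) by (simp add: simplicial_gens_def)
  then obtain F c where F: "finite F" "F \<subseteq> rat_vec ` e ` {1..d}" "\<forall>y\<in>F. 0 \<le> c y"
    and x: "rat_vec x = (\<Sum>y\<in>F. c y *s y)" unfolding rat_cone_def by blast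
  define c' where "c' = (\<lambda>i. if rat_vec (e i) \<in> F then c (rat_vec (e i)) else 0)"
  have "rat_vec x = (\<Sum>y\<in>(\<lambda>i. rat_vec (e i)) ` {1..d}. (if y \<in> F then c y else 0) *s y)"
    unfolding x using F by (intro sum.mono_neutral_cong_left) auto
  also have "\<dots> = (\<Sum>i = 1..d. c' i *s rat_vec (e i))"
    using inj by (subst sum.reindex) (auto simp: c'_def intro!: sum.cong)
  finally have eq: "rat_vec x = (\<Sum>i = 1..d. c' i *s rat_vec (e i))" .
  note ci = coord_eqI[OF assms(1) eq]
  show "rat_vec x = (\<Sum>i = 1..d. coord d e i x *s rat_vec (e i))"
    unfolding eq by (intro sum.cong) (auto simp: ci)
  show "0 \<le> coord d e i x" if "i \<in> {1..d}" for i
    using F ci[OF that] by (auto simp: c'_def)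
qed

lemma multiple_in_gens:
  assumes "simplicial_gens B d e" "x \<in> B"
  shows "\<exists>k. 0 < k \<and> int k *s x \<in> monoid_closure (e ` {1..d})"
proof -
  obtain k :: nat where k: "0 < k" "\<forall>i\<in>{1..d}. of_nat k * coord d e i x \<in> \<int>"
    using common_denominator[of "{1..d}" "\<lambda>i. coord d e i x"] by blast
  have "\<exists>m::nat. of_nat k * coord d e i x = of_nat m" if i: "i \<in> {1..d}" for i
  proof -
    obtain z :: int where z: "of_nat k * coord d e i x = of_int z" using k i Ints_cases by metis
    have "0 \<le> of_nat k * coord d e i x" using simplicial_repr(2)[OF assms i] by simp
    then have "0 \<le> z" using z by simp
    then have "of_nat k * coord d e i x = of_nat (nat z)" using z by simp
    then show ?thesis by blast
  qed
  then obtain m where m: "\<And>i. i \<in> {1..d} \<Longrightarrow> of_nat k * coord d e i x = of_nat (m i)" by metis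
  have "rat_vec (int k *s x) = of_nat k *s (\<Sum>i = 1..d. coord d e i x *s rat_vec (e i))"
    using simplicial_repr(1)[OF assms] by simp
  also have "\<dots> = (\<Sum>i = 1..d. (of_nat k * coord d e i x) *s rat_vec (e i))"
    by (simp add: vec.scale_sum_right vector_smult_assoc)
  also have "\<dots> = rat_vec (\<Sum>i = 1..d. int (m i) *s e i)"
    by (auto simp: rat_vec_sum m intro!: sum.cong)
  finally have "int k *s x = (\<Sum>i = 1..d. int (m i) *s e i)" by (simp only: rat_vec_eq_iff)
  also have "\<dots> \<in> monoid_closure (e ` {1..d})"
    by (intro monoid_closure_sum monoid_closure_scale monoid_closure.base) auto
  finally show ?thesis using k(1) by blast
qed

lemma finite_minimal_elems:
  assumes "affine_semigroup B" "simplicial_gens B d e"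
  shows "finite (minimal_elems B d e)"
proof -
  obtain X where X: "finite X" "B = monoid_closure X"
    using assms(1) by (auto simp: affine_semigroup_def)
  have "\<forall>b\<in>X. \<exists>k. 0 < k \<and> int k *s b \<in> monoid_closure (e ` {1..d})"
    using multiple_in_gens[OF assms(2)] X monoid_closure.base by blast
  then obtain k where k: "\<And>b. b \<in> X \<Longrightarrow> 0 < k b \<and> int (k b) *s b \<in> monoid_closure (e ` {1..d})"
    by metis
  have "minimal_elems B d e \<subseteq> (\<lambda>n. \<Sum>b\<in>X. int (n b) *s b) ` (\<Pi>\<^sub>E b\<in>X. {..<k b})"
  proof
    fix x assume x: "x \<in> minimal_elems B d e"
    then obtain n where n: "\<And>b. b = 0 \<Longrightarrow> n b = 0" "x = (\<Sum>b\<in>X. int (n b) *s b)"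
      using monoid_closure_finite_repr[OF X(1), of x] X(2) by (auto simp: minimal_elems_def)
    have "n b < k b" if b: "b \<in> X" for b
    proof (rule ccontr)
      assume nk: "\<not> n b < k b"
      with k[OF b] n(1) have b0: "b \<noteq> 0" by force
      have "x - int (k b) *s b = (\<Sum>y\<in>X - {b}. int (n y) *s y) + int (n b - k b) *s b"
        using n(2) X(1) b nk by (simp add: sum.remove[of X b] vec_eq_iff of_nat_diff algebra_simps)
      also have "\<dots> \<in> B" unfolding X(2) using b
        by (intro monoid_closure.add monoid_closure_sum monoid_closure_scale monoid_closure.base) auto
      finally have "x - int (k b) *s b \<in> B" .
      moreover have "int (k b) *s b \<noteq> 0"
        using k[OF b] b0 by (auto simp: vec_eq_iff)
      ultimately show False using x k[OF b] by (auto simp: minimal_elems_def)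
    qed
    then have "restrict n X \<in> (\<Pi>\<^sub>E b\<in>X. {..<k b})" by auto
    moreover have "x = (\<Sum>b\<in>X. int (restrict n X b) *s b)" unfolding n(2) by (intro sum.cong) auto
    ultimately show "x \<in> (\<lambda>n. \<Sum>b\<in>X. int (n b) *s b) ` (\<Pi>\<^sub>E b\<in>X. {..<k b})" by blast
  qed
  then show ?thesis by (rule finite_subset) (use X(1) in \<open>auto intro!: finite_PiE\<close>)
qed

lemma group_closure_gens_repr:
  fixes d :: nat
  assumes "z \<in> group_closure (monoid_closure (e ` {1..d}))"
  shows "\<exists>m. z = (\<Sum>i = 1..d. m i *s (e i :: int ^ 'n))"
  using assms
proof (induction rule: group_closure.induct)
  case (base s)
  have "\<exists>m. s = (\<Sum>i = 1..d. m i *s e i)" if "s \<in> monoid_closure (e ` {1..d})" for s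
    using that
  proof (induction rule: monoid_closure.induct)
    case zero
    show ?case by (rule exI[of _ "\<lambda>_. 0"]) simp
  next
    case (base x)
    then obtain j where j: "j \<in> {1..d}" "x = e j" by blast
    have "(\<Sum>i = 1..d. (if i = j then 1 else 0) *s e i) = (\<Sum>i = 1..d. if i = j then e i else 0)"
      by (intro sum.cong) auto
    also have "\<dots> = x" using j by simp
    finally show ?case by (intro exI[of _ "\<lambda>i. if i = j then 1 else 0"]) simp
  next
    case (add x y)
    then obtain m n where "x = (\<Sum>i = 1..d. m i *s e i)" "y = (\<Sum>i = 1..d. n i *s e i)" by blast
    then show ?case by (intro exI[of _ "\<lambda>i. m i + n i"]) (simp add: vector_sadd_rdistrib sum.distrib)
  qed
  with base show ?case using monoid_closure.zero by blast
next
  case (diff x y)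
  then obtain m n where "x = (\<Sum>i = 1..d. m i *s e i)" "y = (\<Sum>i = 1..d. n i *s e i)" by blast
  then show ?case
    by (intro exI[of _ "\<lambda>i. m i - n i"]) (simp add: vector_sub_rdistrib sum_subtractf)
qed

lemma rat_vec_class_min:
  assumes "affine_semigroup B" "simplicial_gens B d e" "\<Gamma> \<in> minimal_classes B d e"
  shows "rat_vec (class_min d e \<Gamma>) = (\<Sum>i = 1..d. Min (coord d e i ` \<Gamma>) *s rat_vec (e i))"
proof -
  define G where "G = group_closure (monoid_closure (e ` {1..d}))"
  obtain y where y: "y \<in> minimal_elems B d e"
    and \<Gamma>: "\<Gamma> = {x \<in> minimal_elems B d e. y - x \<in> G}"
    using assms(3) unfolding minimal_classes_def G_def by (auto elim!: quotientE)
  have fin: "finite \<Gamma>" using finite_minimal_elems[OF assms(1,2)] by (simp add: \<Gamma>)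
  have "y \<in> \<Gamma>" using y by (simp add: \<Gamma> G_def)
  have "\<exists>m. Min (coord d e i ` \<Gamma>) = coord d e i y - of_int m" if i: "i \<in> {1..d}" for i
  proof -
    have "Min (coord d e i ` \<Gamma>) \<in> coord d e i ` \<Gamma>" using fin \<open>y \<in> \<Gamma>\<close> by (intro Min_in) auto
    then obtain x where x: "x \<in> \<Gamma>" "Min (coord d e i ` \<Gamma>) = coord d e i x" by blast
    then obtain m where m: "y - x = (\<Sum>i = 1..d. m i *s e i)"
      using group_closure_gens_repr[of "y - x" e d] by (auto simp: \<Gamma> G_def)
    have "rat_vec x = rat_vec y - rat_vec (y - x)" by simp
    also have "\<dots> = (\<Sum>i = 1..d. coord d e i y *s rat_vec (e i)) - (\<Sum>i = 1..d. of_int (m i) *s rat_vec (e i))"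
      unfolding m using simplicial_repr(1)[OF assms(2), of y] y
      by (simp add: minimal_elems_def rat_vec_sum)
    also have "\<dots> = (\<Sum>i = 1..d. (coord d e i y - of_int (m i)) *s rat_vec (e i))"
      by (simp add: vector_sub_rdistrib sum_subtractf)
    finally have "rat_vec x = \<dots>" .
    from coord_eqI[OF assms(2) this i] x show ?thesis by auto
  qed
  then obtain m where m: "\<And>i. i \<in> {1..d} \<Longrightarrow> Min (coord d e i ` \<Gamma>) = coord d e i y - of_int (m i)"
    by metis
  have "rat_vec (y - (\<Sum>i = 1..d. m i *s e i)) =
      (\<Sum>i = 1..d. coord d e i y *s rat_vec (e i)) - (\<Sum>i = 1..d. of_int (m i) *s rat_vec (e i))"
    using simplicial_repr(1)[OF assms(2), of y] y by (simp add: minimal_elems_def rat_vec_sum)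
  also have "\<dots> = (\<Sum>i = 1..d. Min (coord d e i ` \<Gamma>) *s rat_vec (e i))"
    by (simp add: m vector_sub_rdistrib sum_subtractf)
  finally have h: "rat_vec (y - (\<Sum>i = 1..d. m i *s e i)) = \<dots>" .
  show ?thesis
    unfolding class_min_def
  proof (rule theI[where P = "\<lambda>h. rat_vec h = (\<Sum>i = 1..d. Min (coord d e i ` \<Gamma>) *s rat_vec (e i))"])
    fix z assume "rat_vec z = (\<Sum>i = 1..d. Min (coord d e i ` \<Gamma>) *s rat_vec (e i))"
    with h show "z = y - (\<Sum>i = 1..d. m i *s e i)" by (metis rat_vec_eq_iff)
  qed (rule h)
qed

lemma tilde_affine_semigroup:
  assumes "affine_semigroup B" "simplicial_gens B d e"
  shows "affine_semigroup (tilde B d e)"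
proof -
  have "finite (minimal_classes B d e)"
    unfolding minimal_classes_def using finite_minimal_elems[OF assms]
    by (rule finite_quotient) auto
  then show ?thesis unfolding affine_semigroup_def tilde_def
    by (intro exI[of _ "e ` {1..d} \<union> class_min d e ` minimal_classes B d e"]) simp
qed

end

theory Submission
  imports Defs
begin

text \<open>
  The semigroup \<open>tilde B\<close> is the disjoint union of the translates \<open>h + A\<close> of the free monoid \<open>A\<close>, so
  \<open>R = K[tilde B]\<close> is a free module over the polynomial ring \<open>K[A]\<close>. For a prime \<open>p\<close> of \<open>R\<close> choose a
  maximal set \<open>I\<close> of variables that are algebraically independent modulo \<open>p\<close>. Each of the remaining
  variables satisfies a polynomial relation \<open>g\<^sub>j \<in> p\<close> over \<open>K[x\<^sub>i | i \<in> I]\<close> whose leading coefficient is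
  not in \<open>p\<close>; these \<open>d - |I|\<close> relations involve separate variables and form a regular sequence in
  \<open>R\<^sub>p\<close>. Conversely, if \<open>f \<in> p' - p\<close> then the growth of \<open>R / p\<close> exceeds that of \<open>R / p'\<close> by one degree,
  since multiples of \<open>f\<close> can be added to any set independent modulo \<open>p'\<close>; hence chains of primes
  below \<open>p\<close> have length at most \<open>d - |I|\<close>. In every commutative ring a regular sequence in \<open>p\<close> yields
  a chain of primes of the same length below \<open>p\<close>, so depth and dimension of \<open>R\<^sub>p\<close> agree.

  For minimality let \<open>K[B']\<close> be Cohen--Macaulay and let \<open>u, v \<in> A\<close> have disjoint supports. If \<open>z + u\<close>
  and \<open>z + v\<close> lie in \<open>B'\<close> but \<open>z\<close> does not, then \<open>t\<^sup>u\<close> and \<open>t\<^sup>v\<close> both lie in an associated prime of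
  \<open>t\<^sup>u\<close>, where the depth is one and the dimension at least two. So \<open>B'\<close> is closed under coordinatewise
  minima within a class, and therefore contains every \<open>h\<^sub>j\<close>.
\<close>

section \<open>Ideals, primes and regular sequences\<close>

text \<open>The definition demands equality of depth and dimension at every prime, not only at one
  distinguished maximal ideal, so a single system of parameters does not settle it. The number
  \<open>d - card I\<close> is met from both sides: by an explicit sequence and by a bound on
  chains. The elementary inequality between depth and dimension then closes the argument without any
  theorem on heights. The leading coefficients of the relations are not units, so dividing by a
  relation leaves a nonzero polynomial in the variables of \<open>I\<close> as a multiplier. Such
  polynomials avoid \<open>p\<close> by the choice of \<open>I\<close>; for this reason regularity
  is stated up to multipliers throughout. Growth is only a lower bound for independent sets in a
  degree window of linear size, so no Hilbert polynomial has to be computed. The delicate point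
  about \<open>tilde B\<close> is that the minima in the definition of a class minimum are attained
  at different elements for different coordinates. Hence a class minimum need not lie in
  \<open>B\<close>, and the closure of the union of translates under addition has to be checked one
  coordinate at a time.\<close>

context cring
begin

lemma genideal_empty: "Idl {} = {\<zero>}"
  using genideal_minimal[OF zeroideal, of "{}"] additive_subgroup.zero_closed[OF ideal.axioms(1)[OF genideal_ideal[of "{}"]]]
  by auto

lemma genideal_insert:
  assumes a: "a \<in> carrier R" and X: "X \<subseteq> carrier R"
  shows "Idl (insert a X) = {r \<otimes> a \<oplus> y | r y. r \<in> carrier R \<and> y \<in> Idl X}"
proof -
  have eq: "{r \<otimes> a \<oplus> y | r y. r \<in> carrier R \<and> y \<in> Idl X} = PIdl a <+> Idl X"
    unfolding cgenideal_def set_add_def' by blast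
  interpret X: ideal "Idl X" R using genideal_ideal[OF X] .
  interpret aX: ideal "Idl (insert a X)" R using genideal_ideal[of "insert a X"] a X by simp
  have id: "ideal (PIdl a <+> Idl X) R"
    by (rule add_ideals[OF cgenideal_ideal[OF a] X.is_ideal])
  have "insert a X \<subseteq> PIdl a <+> Idl X"
  proof -
    have "a = \<one> \<otimes> a \<oplus> \<zero>" using a by simp
    moreover have "x = \<zero> \<otimes> a \<oplus> x" if "x \<in> X" for x using that a X by auto
    ultimately show ?thesis
      unfolding eq[symmetric] using genideal_self[OF X] X.zero_closed by blast
  qed
  then have "Idl (insert a X) \<subseteq> PIdl a <+> Idl X" by (rule genideal_minimal[OF id])
  moreover have "PIdl a <+> Idl X \<subseteq> Idl (insert a X)"
  proof -
    have "Idl X \<subseteq> Idl (insert a X)" using a X by (intro subset_Idl_subset) auto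
    moreover have "a \<in> Idl (insert a X)" using genideal_self[of "insert a X"] a X by simp
    ultimately show ?thesis unfolding eq[symmetric] using aX.I_l_closed aX.a_closed by blast
  qed
  ultimately show ?thesis unfolding eq by blast
qed

lemma mem_genideal_singleton:
  assumes "a \<in> carrier R"
  shows "x \<in> Idl {a} \<longleftrightarrow> (\<exists>r\<in>carrier R. x = r \<otimes> a)"
  using cgenideal_eq_genideal[OF assms] by (auto simp: cgenideal_def)

lemma ideal_colon:
  assumes "ideal I R" "y \<in> carrier R"
  shows "ideal {r \<in> carrier R. r \<otimes> y \<in> I} R"
proof -
  have "{r \<in> carrier R. r \<otimes> y \<in> I} = {r \<in> carrier R. y \<otimes> r \<in> I}"
    using assms(2) by (auto simp: m_comm)
  then show ?thesis using ideal.helper_max_prime[OF assms(1) is_cring assms(2)] by simp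
qed

text \<open>An ideal \<open>q\<close> that is maximal among those containing \<open>I\<close> and
  missing \<open>M\<close> is prime. If \<open>a\<close> and \<open>b\<close> lie outside
  \<open>q\<close>, adjoining either one produces an element of \<open>M\<close>; the product of
  these two elements is a multiple of \<open>a \<otimes> b\<close> plus an element of
  \<open>q\<close>, so \<open>a \<otimes> b\<close> in \<open>q\<close> would put an element of
  \<open>M\<close> into \<open>q\<close>.\<close>

lemma exists_prime_avoiding:
  assumes I: "ideal I R" and M: "M \<subseteq> carrier R" "\<one> \<in> M"
    and M_mult: "\<And>a b. a \<in> M \<Longrightarrow> b \<in> M \<Longrightarrow> a \<otimes> b \<in> M" and disj: "I \<inter> M = {}"
  shows "\<exists>q. primeideal q R \<and> I \<subseteq> q \<and> q \<inter> M = {}"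
proof -
  define A where "A = {J. ideal J R \<and> I \<subseteq> J \<and> J \<inter> M = {}}"
  have "\<exists>q\<in>A. \<forall>J\<in>A. q \<subseteq> J \<longrightarrow> J = q"
  proof (rule subset_Zorn_nonempty)
    show "A \<noteq> {}" using I disj by (auto simp: A_def)
    fix C assume C: "C \<noteq> {}" "subset.chain A C"
    then have "subset.chain {J. ideal J R} C" unfolding pred_on.chain_def A_def by blast
    from chain_Union_is_ideal[OF this] have "ideal (\<Union>C) R" using C(1) by simp
    with C show "\<Union>C \<in> A" unfolding pred_on.chain_def A_def by blast
  qed
  then obtain q where q: "q \<in> A" and max': "\<And>J. J \<in> A \<Longrightarrow> q \<subseteq> J \<Longrightarrow> J = q" by blast
  then have q: "ideal q R" "I \<subseteq> q" "q \<inter> M = {}" by (auto simp: A_def)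
  have max: "J = q" if "ideal J R" "q \<subseteq> J" "J \<inter> M = {}" for J
    using max'[of J] that q(2) by (auto simp: A_def)
  interpret q: ideal q R by fact
  have meets: "\<exists>r y. r \<in> carrier R \<and> y \<in> q \<and> r \<otimes> a \<oplus> y \<in> M" if a: "a \<in> carrier R" "a \<notin> q" for a
  proof -
    have qc: "q \<subseteq> carrier R" using q.Icarr by blast
    have "ideal (Idl (insert a q)) R" "insert a q \<subseteq> Idl (insert a q)"
      using a qc genideal_ideal[of "insert a q"] genideal_self[of "insert a q"] by auto
    with max[of "Idl (insert a q)"] a have "Idl (insert a q) \<inter> M \<noteq> {}" by blast
    moreover have "Idl q \<subseteq> q" by (rule genideal_minimal[OF q(1)]) simp
    ultimately show ?thesis unfolding genideal_insert[OF a(1) qc] by blast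
  qed
  have "primeideal q R"
  proof (rule primeidealI[OF q(1) is_cring])
    show "carrier R \<noteq> q" using q(3) M by blast
    fix a b assume a: "a \<in> carrier R" and b: "b \<in> carrier R" and ab: "a \<otimes> b \<in> q"
    show "a \<in> q \<or> b \<in> q"
    proof (rule ccontr)
      assume "\<not> (a \<in> q \<or> b \<in> q)"
      then obtain r y r' y' where r: "r \<in> carrier R" "y \<in> q" "r \<otimes> a \<oplus> y \<in> M"
        and r': "r' \<in> carrier R" "y' \<in> q" "r' \<otimes> b \<oplus> y' \<in> M"
        using meets a b by metis
      have "(r \<otimes> a \<oplus> y) \<otimes> (r' \<otimes> b \<oplus> y') = (r \<otimes> r') \<otimes> (a \<otimes> b) \<oplus> ((r \<otimes> a) \<otimes> y' \<oplus> (r' \<otimes> b \<oplus> y') \<otimes> y)"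
        using a b r(1) r'(1) q.Icarr[OF r(2)] q.Icarr[OF r'(2)]
        by (simp add: l_distr r_distr m_ac a_ac)
      also have "\<dots> \<in> q"
        using a b ab r r' q.Icarr[OF r'(2)]
        by (intro q.a_closed q.I_l_closed[of "a \<otimes> b"] q.I_l_closed[of y] q.I_l_closed[of y']) auto
      finally show False using M_mult[OF r(3) r'(3)] q(3) by blast
    qed
  qed
  with q show ?thesis by blast
qed

text \<open>The next smaller prime of the chain avoids the multiplicative set generated by the last
  element \<open>x\<close> of the sequence and the complement of \<open>p\<close>; regularity says exactly that the ideal
  generated by the other elements does not meet this set.\<close>

lemma regular_sequence_prime_chain:
  assumes "\<And>i r. i < length xs \<Longrightarrow> r \<in> carrier R \<Longrightarrow>
      xs ! i \<otimes> r \<in> Idl (set (take i xs)) \<Longrightarrow> r \<in> Idl (set (take i xs))"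
    and "set xs \<subseteq> p" "primeideal p R"
  shows "\<exists>P. (\<forall>i\<le>length xs. primeideal (P i) R) \<and> (\<forall>i<length xs. P i \<subset> P (Suc i)) \<and> P (length xs) = p"
  using assms
proof (induction xs arbitrary: p rule: rev_induct)
  case Nil
  then show ?case by (intro exI[of _ "\<lambda>_. p"]) auto
next
  case (snoc x xs)
  interpret p: primeideal p R by fact
  have pc: "p \<subseteq> carrier R" using p.Icarr by blast
  have xs: "set xs \<subseteq> p" "set xs \<subseteq> carrier R" and x: "x \<in> p" "x \<in> carrier R"
    using snoc.prems(2) pc by auto
  define J where "J = Idl (set xs)"
  define M where "M = {s \<otimes> x [^] (k::nat) | s k. s \<in> carrier R - p}"
  interpret J: ideal J R unfolding J_def by (rule genideal_ideal[OF xs(2)])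
  have J_subset: "J \<subseteq> p" unfolding J_def using genideal_minimal[OF p.is_ideal xs(1)] .
  have J_reg: "r \<in> J" if "r \<in> carrier R" "x \<otimes> r \<in> J" for r
    using snoc.prems(1)[of "length xs" r] that by (simp add: J_def)
  have J_pow: "s \<in> J" if "s \<in> carrier R" "s \<otimes> x [^] (k::nat) \<in> J" for s k
    using that(2)
  proof (induction k)
    case 0
    then show ?case using that(1) by simp
  next
    case (Suc k)
    have "s \<otimes> x [^] Suc k = x \<otimes> (s \<otimes> x [^] k)" using that(1) x(2) by (simp add: m_ac)
    with Suc J_reg[of "s \<otimes> x [^] k"] that(1) x(2) show ?case by simp
  qed
  have "\<exists>q. primeideal q R \<and> J \<subseteq> q \<and> q \<inter> M = {}"
  proof (rule exists_prime_avoiding[OF J.is_ideal])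
    show "M \<subseteq> carrier R" using x by (auto simp: M_def)
    show "\<one> \<in> M" unfolding M_def using p.compl_one
      by (intro CollectI exI[of _ \<one>] exI[of _ "0::nat"]) simp
    show "a \<otimes> b \<in> M" if ab: "a \<in> M" "b \<in> M" for a b
    proof -
      obtain s k t l where *: "s \<in> carrier R - p" "t \<in> carrier R - p"
        "a = s \<otimes> x [^] (k::nat)" "b = t \<otimes> x [^] (l::nat)" using ab unfolding M_def by blast
      then have "a \<otimes> b = (s \<otimes> t) \<otimes> x [^] (k + l)"
        using x(2) by (simp add: m_ac flip: nat_pow_mult)
      with p.compl_mult[OF *(1,2)] show ?thesis unfolding M_def by blast
    qed
    show "J \<inter> M = {}" using J_pow J_subset by (auto simp: M_def)
  qed
  then obtain q where q: "primeideal q R" "J \<subseteq> q" "q \<inter> M = {}" by blast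
  \<comment> \<open>Exponent \<open>0\<close> puts the complement of \<open>p\<close> into
    \<open>M\<close>, so \<open>q\<close> lies in \<open>p\<close>; exponent \<open>1\<close> puts
    \<open>x\<close> into \<open>M\<close>, so the inclusion is strict.\<close>
  have "s \<in> M" if "s \<in> carrier R - p" for s
    unfolding M_def using that by (intro CollectI exI[of _ s] exI[of _ "0::nat"]) simp
  then have "q \<subseteq> p" using q(3) ideal.Icarr[OF primeideal.axioms(1)[OF q(1)]] by blast
  moreover have "x \<in> M"
    unfolding M_def using x p.compl_one by (intro CollectI exI[of _ \<one>] exI[of _ "1::nat"]) simp
  ultimately have qp: "q \<subset> p" using x(1) q(3) by blast
  have "\<exists>P. (\<forall>i\<le>length xs. primeideal (P i) R) \<and> (\<forall>i<length xs. P i \<subset> P (Suc i)) \<and> P (length xs) = q"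
  proof (rule snoc.IH)
    show "set xs \<subseteq> q" using genideal_self[OF xs(2)] q(2) by (simp add: J_def)
    fix i r assume "i < length xs" "r \<in> carrier R" "xs ! i \<otimes> r \<in> Idl (set (take i xs))"
    then show "r \<in> Idl (set (take i xs))"
      using snoc.prems(1)[of i r] by (simp add: nth_append)
  qed fact
  then obtain P where P: "\<forall>i\<le>length xs. primeideal (P i) R" "\<forall>i<length xs. P i \<subset> P (Suc i)"
    "P (length xs) = q" by blast
  show ?case
    using P qp snoc.prems(3)
    by (intro exI[of _ "P(Suc (length xs) := p)"]) (auto simp: le_Suc_eq less_Suc_eq)
qed

lemma regular_sequence_le_krull_dim:
  assumes "regular_sequence R xs" "set xs \<subseteq> p" "primeideal p R"
  shows "enat (length xs) \<le> krull_dim R"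
proof -
  have "\<exists>P. (\<forall>i\<le>length xs. primeideal (P i) R) \<and> (\<forall>i<length xs. P i \<subset> P (Suc i)) \<and> P (length xs) = p"
    using assms by (intro regular_sequence_prime_chain) (auto simp: regular_sequence_def)
  then show ?thesis unfolding krull_dim_def by (intro Sup_upper) blast
qed

text \<open>If \<open>m \<subseteq> (x : y)\<close> and \<open>u, v \<in> m\<close> is regular, then \<open>u y = x s\<close> and \<open>v y = x s'\<close> give \<open>v s = u s'\<close>,
  so \<open>u\<close> divides \<open>s\<close> and hence \<open>x\<close> divides \<open>y\<close>.\<close>

lemma regular_sequence_length_le_1:
  assumes x: "x \<in> carrier R" "\<And>r. r \<in> carrier R \<Longrightarrow> x \<otimes> r = \<zero> \<Longrightarrow> r = \<zero>"
    and y: "y \<in> carrier R" "y \<notin> Idl {x}" and m: "\<And>a. a \<in> m \<Longrightarrow> a \<otimes> y \<in> Idl {x}"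
    and xs: "regular_sequence R xs" "set xs \<subseteq> m"
  shows "length xs \<le> 1"
proof (rule ccontr)
  assume "\<not> length xs \<le> 1"
  then obtain u v ys where uv: "xs = u # v # ys" by (cases xs; cases "tl xs") auto
  have c: "u \<in> carrier R" "v \<in> carrier R" "u \<in> m" "v \<in> m"
    using xs by (auto simp: uv regular_sequence_def)
  have reg: "r \<in> Idl (set (take i xs))"
    if "i < length xs" "r \<in> carrier R" "xs ! i \<otimes> r \<in> Idl (set (take i xs))" for i r
    using xs(1) that by (auto simp: regular_sequence_def)
  have reg_u: "r = \<zero>" if "r \<in> carrier R" "u \<otimes> r = \<zero>" for r
    using reg[of 0 r] that by (simp add: uv genideal_empty)
  have reg_v: "r \<in> Idl {u}" if "r \<in> carrier R" "v \<otimes> r \<in> Idl {u}" for r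
    using reg[of 1 r] that by (simp add: uv)
  obtain s s' where s: "s \<in> carrier R" "u \<otimes> y = s \<otimes> x" "s' \<in> carrier R" "v \<otimes> y = s' \<otimes> x"
    using m[OF c(3)] m[OF c(4)] by (auto simp: mem_genideal_singleton[OF x(1)])
  have "x \<otimes> (v \<otimes> s) = v \<otimes> (u \<otimes> y)" using s c x by (simp add: m_ac)
  also have "\<dots> = u \<otimes> (v \<otimes> y)" using c y by (simp add: m_ac)
  also have "\<dots> = x \<otimes> (s' \<otimes> u)" using s c x by (simp add: m_ac)
  finally have "x \<otimes> (v \<otimes> s) = x \<otimes> (s' \<otimes> u)" .
  then have "x \<otimes> (v \<otimes> s \<ominus> s' \<otimes> u) = \<zero>"
    using s c x by (simp add: a_minus_def r_distr r_minus r_neg)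
  then have "v \<otimes> s \<ominus> s' \<otimes> u = \<zero>" using s c x by auto
  then have "v \<otimes> s = s' \<otimes> u" using s c by (simp add: r_right_minus_eq)
  then have "s \<in> Idl {u}" using reg_v s c by (auto simp: mem_genideal_singleton)
  then obtain t where t: "t \<in> carrier R" "s = t \<otimes> u" using c by (auto simp: mem_genideal_singleton)
  have "u \<otimes> y = u \<otimes> (t \<otimes> x)" using s t c x by (simp add: m_ac)
  then have "u \<otimes> (y \<ominus> t \<otimes> x) = \<zero>"
    using t c x y by (simp add: a_minus_def r_distr r_minus r_neg)
  then have "y \<ominus> t \<otimes> x = \<zero>" using reg_u t y x by auto
  then have "y = t \<otimes> x" using t y x by (simp add: r_right_minus_eq)
  then show False using y t x by (auto simp: mem_genideal_singleton)
qed

text \<open>An associated prime above a given colon ideal. A maximal proper colon ideal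
  \<open>(I : z)\<close> is prime: if \<open>b \<otimes> z\<close> is outside \<open>I\<close>, then
  \<open>(I : b z)\<close> contains \<open>(I : z)\<close> and so equals it, and every
  \<open>a\<close> with \<open>a \<otimes> b\<close> in \<open>(I : z)\<close> belongs to
  it.\<close>

lemma exists_prime_colon:
  assumes N: "noetherian_ring R" and I: "ideal I R" and y: "y \<in> carrier R" "y \<notin> I"
  shows "\<exists>z. z \<in> carrier R \<and> z \<notin> I \<and> primeideal {r \<in> carrier R. r \<otimes> z \<in> I} R \<and>
    {r \<in> carrier R. r \<otimes> y \<in> I} \<subseteq> {r \<in> carrier R. r \<otimes> z \<in> I}"
proof -
  interpret I: ideal I R by fact
  define Q where "Q z = {r \<in> carrier R. r \<otimes> z \<in> I}" for z
  define A where "A = {Q z | z. z \<in> carrier R \<and> z \<notin> I \<and> Q y \<subseteq> Q z}"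
  have "\<exists>q\<in>A. \<forall>J\<in>A. q \<subseteq> J \<longrightarrow> J = q"
  proof (rule subset_Zorn_nonempty)
    show "A \<noteq> {}" using y by (auto simp: A_def)
    fix C assume C: "C \<noteq> {}" "subset.chain A C"
    have "ideal J R" if "J \<in> A" for J
      using that ideal_colon[OF I] by (auto simp: A_def Q_def)
    then have "subset.chain {J. ideal J R} C"
      using C(2) unfolding pred_on.chain_def by blast
    \<comment> \<open>The union of a chain of colon ideals is again a colon ideal here, because in a
      noetherian ring the union belongs to the chain.\<close>
    from noetherian_ring.ideal_chain_is_trivial[OF N C(1) this] C(2)
    show "\<Union>C \<in> A" unfolding pred_on.chain_def by blast
  qed
  then obtain q where q: "q \<in> A" "\<And>J. J \<in> A \<Longrightarrow> q \<subseteq> J \<Longrightarrow> J = q" by blast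
  then obtain z where z: "q = Q z" "z \<in> carrier R" "z \<notin> I" "Q y \<subseteq> Q z"
    by (auto simp: A_def)
  have max: "Q w = Q z" if w: "w \<in> carrier R" "w \<notin> I" "Q z \<subseteq> Q w" for w
  proof -
    have "Q w \<in> A" using w z unfolding A_def by blast
    then show ?thesis using q(2) w z by simp
  qed
  have "primeideal (Q z) R"
  proof (rule primeidealI[OF _ is_cring])
    show "ideal (Q z) R" unfolding Q_def by (rule ideal_colon[OF I z(2)])
    have "\<one> \<notin> Q z" using z by (simp add: Q_def)
    then show "carrier R \<noteq> Q z" by blast
    fix a b assume ab: "a \<in> carrier R" "b \<in> carrier R" "a \<otimes> b \<in> Q z"
    show "a \<in> Q z \<or> b \<in> Q z"
    proof (rule disjCI)
      assume "b \<notin> Q z"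
      then have bz: "b \<otimes> z \<in> carrier R" "b \<otimes> z \<notin> I" using ab z by (auto simp: Q_def)
      have "Q z \<subseteq> Q (b \<otimes> z)"
        using ab(2) z(2) I.I_l_closed by (auto simp: Q_def m_lcomm[of _ b z])
      moreover have "a \<in> Q (b \<otimes> z)" using ab z(2) by (simp add: Q_def m_assoc)
      ultimately show "a \<in> Q z" using max[OF bz] by simp
    qed
  qed
  then show ?thesis using z unfolding Q_def by blast
qed

end

section \<open>Localization\<close>

context primeideal
begin

abbreviation (input) L where "L \<equiv> localization R I"

text \<open>No closure under sums is taken: with common denominators these fractions already form an
  ideal when \<open>J\<close> is one.\<close>

definition extension :: "'a set \<Rightarrow> ('a \<times> 'a) set set" where
  "extension J = {fraction R I a s | a s. a \<in> J \<and> s \<in> carrier R - I}"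

definition contraction :: "('a \<times> 'a) set set \<Rightarrow> 'a set" where
  "contraction J = {a \<in> carrier R. fraction R I a \<one> \<in> J}"

lemma extensionI: "a \<in> J \<Longrightarrow> s \<in> carrier R - I \<Longrightarrow> fraction R I a s \<in> extension J"
  unfolding extension_def by blast

text \<open>The numerator of one representative may lie in \<open>J\<close> while that of another
  does not, so membership shows only after multiplication by some \<open>u\<close> outside the
  prime.\<close>

lemma fraction_mem_extension_iff:
  assumes "ideal J R" "a \<in> carrier R" "s \<in> carrier R - I"
  shows "fraction R I a s \<in> extension J \<longleftrightarrow> (\<exists>u\<in>carrier R - I. u \<otimes> a \<in> J)"
proof
  interpret J: ideal J R by fact
  assume "fraction R I a s \<in> extension J"
  then obtain b t where bt: "b \<in> J" "t \<in> carrier R - I" "fraction R I a s = fraction R I b t"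
    by (auto simp: extension_def)
  then obtain u where u: "u \<in> carrier R - I" "u \<otimes> (a \<otimes> t) = u \<otimes> (b \<otimes> s)"
    using assms J.Icarr by (auto simp: fraction_eq_iff simp del: Diff_iff)
  have "(u \<otimes> t) \<otimes> a = (u \<otimes> s) \<otimes> b"
    using u bt assms J.Icarr[OF bt(1)] by (simp add: m_ac)
  also have "\<dots> \<in> J" using u bt assms by (intro J.I_l_closed) auto
  finally show "\<exists>u\<in>carrier R - I. u \<otimes> a \<in> J" using compl_mult[OF u(1) bt(2)] by blast
next
  assume "\<exists>u\<in>carrier R - I. u \<otimes> a \<in> J"
  then obtain u where u: "u \<in> carrier R - I" "u \<otimes> a \<in> J" by blast
  have "fraction R I a s = fraction R I (u \<otimes> a) (u \<otimes> s)"
    using u assms compl_mult compl_one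
    by (intro fraction_eqI[of _ _ _ _ \<one>]) (auto simp: m_ac simp del: Diff_iff)
  then show "fraction R I a s \<in> extension J"
    using u compl_mult[OF u(1) assms(3)] unfolding extension_def by blast
qed

lemma extension_ideal:
  assumes "ideal J R"
  shows "ideal (extension J) L"
proof -
  interpret J: ideal J R by fact
  interpret L: cring L by (rule localization_cring)
  have carr: "extension J \<subseteq> carrier L"
    using J.Icarr fraction_carrier unfolding extension_def by blast
  have zero: "\<zero>\<^bsub>L\<^esub> \<in> extension J"
    unfolding localization_zero using J.zero_closed compl_one by (rule extensionI)
  have mult: "X \<otimes>\<^bsub>L\<^esub> Y \<in> extension J" if XY: "X \<in> carrier L" "Y \<in> extension J" for X Y
  proof -
    obtain a s where a: "a \<in> carrier R" "s \<in> carrier R - I" "X = fraction R I a s"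
      by (rule localization_carrierE[OF XY(1)])
    obtain b t where b: "Y = fraction R I b t" "b \<in> J" "t \<in> carrier R - I"
      using XY(2) unfolding extension_def by blast
    have "X \<otimes>\<^bsub>L\<^esub> Y = fraction R I (a \<otimes> b) (s \<otimes> t)"
      using a b J.Icarr by (simp add: localization_mult del: Diff_iff)
    then show ?thesis
      using extensionI[OF J.I_l_closed[OF b(2) a(1)] compl_mult[OF a(2) b(3)]] by simp
  qed
  have add: "X \<oplus>\<^bsub>L\<^esub> Y \<in> extension J" if XY: "X \<in> extension J" "Y \<in> extension J" for X Y
  proof -
    obtain a s where a: "X = fraction R I a s" "a \<in> J" "s \<in> carrier R - I"
      using XY(1) unfolding extension_def by blast
    obtain b t where b: "Y = fraction R I b t" "b \<in> J" "t \<in> carrier R - I"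
      using XY(2) unfolding extension_def by blast
    have "a \<otimes> t \<oplus> b \<otimes> s \<in> J" using a b by (intro J.a_closed J.I_r_closed) auto
    from extensionI[OF this compl_mult[OF a(3) b(3)]] show ?thesis
      using a b J.Icarr by (simp add: localization_add del: Diff_iff)
  qed
  show ?thesis
  proof (rule idealI[OF L.ring_axioms])
    show "subgroup (extension J) (add_monoid L)"
    proof (rule L.add.subgroupI)
      show "extension J \<noteq> {}" using zero by blast
      fix X assume X: "X \<in> extension J"
      have "\<ominus>\<^bsub>L\<^esub> X = (\<ominus>\<^bsub>L\<^esub> \<one>\<^bsub>L\<^esub>) \<otimes>\<^bsub>L\<^esub> X" using X carr by (auto simp: L.l_minus)
      then show "\<ominus>\<^bsub>L\<^esub> X \<in> extension J" using mult X by simp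
    qed (use carr add in auto)
    fix X Y assume "X \<in> extension J" "Y \<in> carrier L"
    then show "Y \<otimes>\<^bsub>L\<^esub> X \<in> extension J" "X \<otimes>\<^bsub>L\<^esub> Y \<in> extension J"
      using mult[of Y X] L.m_comm[of X Y] carr by auto
  qed
qed

text \<open>For a prime inside \<open>I\<close> the multiplier can be cancelled: it is outside
  \<open>I\<close>, hence outside \<open>q\<close>.\<close>

lemma extension_prime_iff:
  assumes "primeideal q R" "q \<subseteq> I" "a \<in> carrier R" "s \<in> carrier R - I"
  shows "fraction R I a s \<in> extension q \<longleftrightarrow> a \<in> q"
proof -
  interpret q: primeideal q R by fact
  show ?thesis
    unfolding fraction_mem_extension_iff[OF q.is_ideal assms(3,4)]
    using q.I_prime assms compl_one by (auto intro: bexI[of _ \<one>])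
qed

lemma extension_primeideal:
  assumes "primeideal q R" "q \<subseteq> I"
  shows "primeideal (extension q) L"
proof -
  interpret q: primeideal q R by fact
  note iff = extension_prime_iff[OF assms]
  show ?thesis
  proof (rule primeidealI[OF extension_ideal[OF q.is_ideal] localization_cring])
    have "fraction R I \<one> \<one> \<notin> extension q"
      using iff[OF one_closed compl_one] q.compl_one by simp
    then show "carrier L \<noteq> extension q" using fraction_carrier[OF one_closed compl_one] by blast
    fix X Y assume XY: "X \<in> carrier L" "Y \<in> carrier L" "X \<otimes>\<^bsub>L\<^esub> Y \<in> extension q"
    obtain a s where a: "X = fraction R I a s" "a \<in> carrier R" "s \<in> carrier R - I"
      by (rule localization_carrierE[OF XY(1)])
    obtain b t where b: "Y = fraction R I b t" "b \<in> carrier R" "t \<in> carrier R - I"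
      by (rule localization_carrierE[OF XY(2)])
    have "a \<otimes> b \<in> q"
      using XY(3) a b iff[of "a \<otimes> b" "s \<otimes> t"] compl_mult[OF a(3) b(3)]
      by (simp add: localization_mult del: Diff_iff)
    then show "X \<in> extension q \<or> Y \<in> extension q"
      using a b iff q.I_prime by (auto simp del: Diff_iff)
  qed
qed

lemma extension_strict_mono:
  assumes "primeideal q R" "q \<subset> q'" "primeideal q' R" "q' \<subseteq> I"
  shows "extension q \<subset> extension q'"
proof -
  obtain a where a: "a \<in> q'" "a \<notin> q" using assms by blast
  then have ac: "a \<in> carrier R" using ideal.Icarr[OF primeideal.axioms(1)[OF assms(3)]] by simp
  have "fraction R I a \<one> \<in> extension q'" "fraction R I a \<one> \<notin> extension q"
    using extension_prime_iff[OF assms(3,4) ac compl_one]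
      extension_prime_iff[OF assms(1) _ ac compl_one] assms(2,4) a by auto
  moreover have "extension q \<subseteq> extension q'" using assms(2) by (auto simp: extension_def)
  ultimately show ?thesis by blast
qed

text \<open>Denominators are units of the localization, so an ideal is determined by the numerators
  occurring in it.\<close>

lemma fraction_mem_ideal_iff:
  assumes "ideal J L" "a \<in> carrier R" "s \<in> carrier R - I"
  shows "fraction R I a s \<in> J \<longleftrightarrow> a \<in> contraction J"
proof -
  interpret J: ideal J L by fact
  have s: "s \<in> carrier R" using assms by simp
  have "fraction R I s \<one> \<otimes>\<^bsub>L\<^esub> fraction R I a s = fraction R I (s \<otimes> a) s"
    using assms s compl_one by (simp add: localization_mult del: Diff_iff)
  also have "\<dots> = fraction R I a \<one>"
    using assms s compl_one by (intro fraction_eqI[of _ _ _ _ \<one>]) (simp_all add: m_ac)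
  finally have 1: "fraction R I s \<one> \<otimes>\<^bsub>L\<^esub> fraction R I a s = fraction R I a \<one>" .
  have 2: "fraction R I \<one> s \<otimes>\<^bsub>L\<^esub> fraction R I a \<one> = fraction R I a s"
    using assms s compl_one by (simp add: localization_mult del: Diff_iff)
  have "fraction R I s \<one> \<in> carrier L" "fraction R I \<one> s \<in> carrier L"
    using assms s compl_one by (auto intro!: fraction_carrier simp del: Diff_iff)
  then show ?thesis
    using J.I_l_closed[of "fraction R I a s" "fraction R I s \<one>"]
      J.I_l_closed[of "fraction R I a \<one>" "fraction R I \<one> s"] 1 2 assms(2)
    by (auto simp: contraction_def)
qed

lemma contraction_ideal:
  assumes "ideal J L"
  shows "ideal (contraction J) R"
proof -
  interpret J: ideal J L by fact
  have carr: "contraction J \<subseteq> carrier R" by (auto simp: contraction_def)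
  have mult: "a \<otimes> b \<in> contraction J" if "a \<in> carrier R" "b \<in> contraction J" for a b
  proof -
    have b: "b \<in> carrier R" "fraction R I b \<one> \<in> J" using that by (auto simp: contraction_def)
    have "fraction R I a \<one> \<otimes>\<^bsub>L\<^esub> fraction R I b \<one> \<in> J"
      using that(1) b compl_one by (intro J.I_l_closed fraction_carrier) auto
    then show ?thesis
      using that(1) b compl_one by (simp add: localization_mult contraction_def del: Diff_iff)
  qed
  have add: "a \<oplus> b \<in> contraction J" if "a \<in> contraction J" "b \<in> contraction J" for a b
  proof -
    have *: "a \<in> carrier R" "fraction R I a \<one> \<in> J" "b \<in> carrier R" "fraction R I b \<one> \<in> J"
      using that by (auto simp: contraction_def)
    have "fraction R I a \<one> \<oplus>\<^bsub>L\<^esub> fraction R I b \<one> \<in> J"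
      using * by (intro additive_subgroup.a_closed[OF J.is_additive_subgroup])
    then show ?thesis
      using * compl_one by (simp add: localization_add contraction_def del: Diff_iff)
  qed
  show ?thesis
  proof (rule idealI[OF ring_axioms])
    show "subgroup (contraction J) (add_monoid R)"
    proof (rule add.subgroupI)
      have "\<zero> \<in> contraction J"
        using additive_subgroup.zero_closed[OF J.is_additive_subgroup]
        by (simp add: contraction_def localization_zero)
      then show "contraction J \<noteq> {}" by blast
      fix a assume a: "a \<in> contraction J"
      have "\<ominus> a = (\<ominus> \<one>) \<otimes> a" using a carr by (auto simp: l_minus)
      then show "\<ominus> a \<in> contraction J" using mult a by simp
    qed (use carr add in auto)
    fix a b assume "a \<in> contraction J" "b \<in> carrier R"
    then show "b \<otimes> a \<in> contraction J" "a \<otimes> b \<in> contraction J"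
      using mult[of b a] m_comm[of a b] carr by auto
  qed
qed

lemma extension_contraction:
  assumes "ideal J L"
  shows "extension (contraction J) = J"
proof -
  interpret J: ideal J L by fact
  have "X \<in> extension (contraction J)" if "X \<in> J" for X
  proof -
    obtain a s where "X = fraction R I a s" "a \<in> carrier R" "s \<in> carrier R - I"
      using localization_carrierE[OF J.Icarr[OF \<open>X \<in> J\<close>]] by metis
    then show ?thesis using that fraction_mem_ideal_iff[OF assms] unfolding extension_def by blast
  qed
  moreover have "extension (contraction J) \<subseteq> J"
    using fraction_mem_ideal_iff[OF assms] by (auto simp: extension_def contraction_def)
  ultimately show ?thesis by blast
qed

lemma contraction_subset:
  assumes "ideal J L" "J \<noteq> carrier L"
  shows "contraction J \<subseteq> I"
proof (rule ccontr)
  interpret J: ideal J L by fact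
  assume "\<not> contraction J \<subseteq> I"
  then obtain a where a: "a \<in> contraction J" "a \<in> carrier R - I" by (auto simp: contraction_def)
  then have "fraction R I a a \<in> J" using fraction_mem_ideal_iff[OF assms(1)] by auto
  moreover have "fraction R I a a = \<one>\<^bsub>L\<^esub>"
    unfolding localization_one using a compl_one by (intro fraction_eqI[of _ _ _ _ \<one>]) auto
  ultimately show False using J.one_imp_carrier assms(2) by simp
qed

lemma contraction_primeideal:
  assumes "primeideal J L"
  shows "primeideal (contraction J) R" "contraction J \<subseteq> I"
proof -
  interpret J: primeideal J L by fact
  show sub: "contraction J \<subseteq> I" using contraction_subset[OF J.is_ideal] J.I_notcarr by blast
  show "primeideal (contraction J) R"
  proof (rule primeidealI[OF contraction_ideal[OF J.is_ideal] is_cring])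
    show "carrier R \<noteq> contraction J" using sub compl_one by blast
    fix a b assume ab: "a \<in> carrier R" "b \<in> carrier R" "a \<otimes> b \<in> contraction J"
    then have "fraction R I a \<one> \<otimes>\<^bsub>L\<^esub> fraction R I b \<one> \<in> J"
      using compl_one by (simp add: localization_mult contraction_def del: Diff_iff)
    then show "a \<in> contraction J \<or> b \<in> contraction J"
      using J.I_prime fraction_carrier compl_one ab by (auto simp: contraction_def simp del: Diff_iff)
  qed
qed

lemma contraction_strict_mono:
  assumes "ideal J L" "ideal J' L" "J \<subset> J'"
  shows "contraction J \<subset> contraction J'"
proof -
  have "contraction J \<subseteq> contraction J'" using assms(3) by (auto simp: contraction_def)
  moreover have "contraction J \<noteq> contraction J'"
  proof
    assume "contraction J = contraction J'"
    then have "J = J'" by (metis extension_contraction assms(1,2))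
    then show False using assms(3) by simp
  qed
  ultimately show ?thesis by blast
qed

section \<open>The maximal ideal, depth and dimension of the localization\<close>

lemma extension_maximalideal: "maximalideal (extension I) L"
proof (rule maximalidealI)
  show "ideal (extension I) L" using extension_ideal is_ideal .
  show "carrier L \<noteq> extension I"
    using primeideal.I_notcarr[OF extension_primeideal[OF primeideal]] by simp
  fix J assume J: "ideal J L" "extension I \<subseteq> J" "J \<subseteq> carrier L"
  show "J = extension I \<or> J = carrier L"
  proof (rule disjCI)
    assume "J \<noteq> carrier L"
    then have "contraction J \<subseteq> I" using contraction_subset[OF J(1)] by simp
    then have "extension (contraction J) \<subseteq> extension I" by (auto simp: extension_def)
    then show "J = extension I" using extension_contraction[OF J(1)] J(2) by simp
  qed
qed

lemma maximalideal_localization_iff: "maximalideal J L \<longleftrightarrow> J = extension I"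
proof
  assume J: "maximalideal J L"
  interpret J: maximalideal J L by fact
  have "contraction J \<subseteq> I" using contraction_subset[OF J.is_ideal] J.I_notcarr by blast
  then have "extension (contraction J) \<subseteq> extension I" by (auto simp: extension_def)
  then have "J \<subseteq> extension I" using extension_contraction[OF J.is_ideal] by simp
  moreover interpret E: maximalideal "extension I" L by (rule extension_maximalideal)
  have "extension I \<subseteq> carrier L" using E.Icarr by blast
  ultimately show "J = extension I" using J.I_maximal[OF E.is_ideal] E.I_notcarr by blast
qed (use extension_maximalideal in simp)

lemma localization_local_ring: "local_ring L"
  unfolding local_ring_def using localization_cring by (simp add: maximalideal_localization_iff)

lemma the_maximalideal_localization: "(THE m. maximalideal m L) = extension I"
  by (simp add: maximalideal_localization_iff)

text \<open>Translates membership in a generated ideal of the localization into membership in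
  \<open>R\<close> up to a multiplier, the form in which regularity can be checked in
  \<open>R\<close> itself.\<close>

lemma fraction_mem_genideal_iff:
  assumes X: "X \<subseteq> carrier R" and as: "a \<in> carrier R" "s \<in> carrier R - I"
  shows "fraction R I a s \<in> Idl\<^bsub>L\<^esub> ((\<lambda>x. fraction R I x \<one>) ` X) \<longleftrightarrow>
    (\<exists>u\<in>carrier R - I. u \<otimes> a \<in> Idl X)"
proof -
  interpret L: cring L by (rule localization_cring)
  let ?Y = "(\<lambda>x. fraction R I x \<one>) ` X"
  have Y: "?Y \<subseteq> carrier L" using X fraction_carrier compl_one by (auto simp del: Diff_iff)
  note idX = genideal_ideal[OF X] and idY = L.genideal_ideal[OF Y]
  have "Idl\<^bsub>L\<^esub> ?Y \<subseteq> extension (Idl X)"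
    using genideal_self[OF X] compl_one
    by (intro L.genideal_minimal[OF extension_ideal[OF idX]]) (auto simp: extension_def)
  moreover have "Idl X \<subseteq> contraction (Idl\<^bsub>L\<^esub> ?Y)"
    using L.genideal_self[OF Y] X
    by (intro genideal_minimal[OF contraction_ideal[OF idY]]) (auto simp: contraction_def)
  then have "extension (Idl X) \<subseteq> Idl\<^bsub>L\<^esub> ?Y"
    using extension_contraction[OF idY] by (auto simp: extension_def)
  ultimately have "Idl\<^bsub>L\<^esub> ?Y = extension (Idl X)" by blast
  then show ?thesis using fraction_mem_extension_iff[OF idX as] by simp
qed

lemma localization_noetherian:
  assumes "noetherian_ring R"
  shows "noetherian_ring L"
proof -
  interpret L: cring L by (rule localization_cring)
  show ?thesis
  proof (rule L.noetherian_ringI)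
    fix J assume J: "ideal J L"
    interpret J: ideal J L by fact
    obtain A where A: "A \<subseteq> carrier R" "finite A" "contraction J = Idl A"
      using noetherian_ring.finetely_gen[OF assms contraction_ideal[OF J]] by blast
    let ?B = "(\<lambda>x. fraction R I x \<one>) ` A"
    have B: "?B \<subseteq> carrier L" using A(1) fraction_carrier compl_one by (auto simp del: Diff_iff)
    have "X \<in> J \<longleftrightarrow> X \<in> Idl\<^bsub>L\<^esub> ?B" if X: "X \<in> carrier L" for X
    proof -
      obtain a s where as: "a \<in> carrier R" "s \<in> carrier R - I" "X = fraction R I a s"
        using localization_carrierE[OF X] .
      have "X \<in> J \<longleftrightarrow> X \<in> extension (Idl A)"
        using extension_contraction[OF J] A(3) by simp
      also have "\<dots> \<longleftrightarrow> X \<in> Idl\<^bsub>L\<^esub> ?B"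
        unfolding as(3) fraction_mem_genideal_iff[OF A(1) as(1,2)]
          fraction_mem_extension_iff[OF genideal_ideal[OF A(1)] as(1,2)] ..
      finally show ?thesis .
    qed
    then have "J = Idl\<^bsub>L\<^esub> ?B"
      using J.Icarr ideal.Icarr[OF L.genideal_ideal[OF B]] by blast
    with B A(2) show "\<exists>B\<subseteq>carrier L. finite B \<and> J = Idl\<^bsub>L\<^esub> B" by blast
  qed
qed

text \<open>Multipliers outside the prime become units, so regularity in \<open>R\<close> is
  required only up to such multipliers. Clearing leading coefficients later produces exactly this
  kind of multiplier.\<close>

lemma regular_sequence_localization:
  assumes xs: "set xs \<subseteq> I"
    and reg: "\<And>i r. i < length xs \<Longrightarrow> r \<in> carrier R \<Longrightarrow> xs ! i \<otimes> r \<in> Idl (set (take i xs)) \<Longrightarrow>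
      \<exists>u\<in>carrier R - I. u \<otimes> r \<in> Idl (set (take i xs))"
  shows "regular_sequence L (map (\<lambda>x. fraction R I x \<one>) xs)"
    and "set (map (\<lambda>x. fraction R I x \<one>) xs) \<subseteq> extension I"
proof -
  interpret L: cring L by (rule localization_cring)
  let ?f = "\<lambda>x. fraction R I x \<one>"
  interpret E: maximalideal "extension I" L by (rule extension_maximalideal)
  have xs_carr: "set xs \<subseteq> carrier R" using xs Icarr by blast
  show sub: "set (map ?f xs) \<subseteq> extension I" using xs compl_one by (auto simp: extension_def)
  then have carr: "set (map ?f xs) \<subseteq> carrier L" using E.Icarr by blast
  have "Idl\<^bsub>L\<^esub> (set (map ?f xs)) \<subseteq> extension I" using L.genideal_minimal[OF E.is_ideal sub] .
  then have "Idl\<^bsub>L\<^esub> (set (map ?f xs)) \<noteq> carrier L"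
    using E.I_notcarr E.Icarr by blast
  moreover have "X \<in> Idl\<^bsub>L\<^esub> (set (take i (map ?f xs)))"
    if i: "i < length xs" and X: "X \<in> carrier L"
      and mem: "map ?f xs ! i \<otimes>\<^bsub>L\<^esub> X \<in> Idl\<^bsub>L\<^esub> (set (take i (map ?f xs)))" for i X
  proof -
    obtain r s where rs: "r \<in> carrier R" "s \<in> carrier R - I" "X = fraction R I r s"
      using localization_carrierE[OF X] .
    have s: "s \<in> carrier R" using rs by simp
    have xi: "xs ! i \<in> carrier R" using i xs_carr by auto
    have T: "set (take i xs) \<subseteq> carrier R" using set_take_subset[of i xs] xs_carr by blast
    have eq: "set (take i (map ?f xs)) = ?f ` set (take i xs)" by (simp add: take_map)
    have "fraction R I (xs ! i \<otimes> r) s \<in> Idl\<^bsub>L\<^esub> (?f ` set (take i xs))"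
      using mem i rs s xi compl_one unfolding eq by (simp add: localization_mult del: Diff_iff)
    then obtain u where u: "u \<in> carrier R - I" "u \<otimes> (xs ! i \<otimes> r) \<in> Idl (set (take i xs))"
      using fraction_mem_genideal_iff[OF T _ rs(2), of "xs ! i \<otimes> r"] rs xi by auto
    have "u \<otimes> (xs ! i \<otimes> r) = xs ! i \<otimes> (u \<otimes> r)" using u rs xi by (simp add: m_ac)
    with u obtain v where v: "v \<in> carrier R - I" "v \<otimes> (u \<otimes> r) \<in> Idl (set (take i xs))"
      using reg[OF i, of "u \<otimes> r"] rs by auto
    have "(v \<otimes> u) \<otimes> r \<in> Idl (set (take i xs))" using u v rs by (simp add: m_assoc)
    with compl_mult[OF v(1) u(1)] show ?thesis
      unfolding eq rs(3) fraction_mem_genideal_iff[OF T rs(1,2)] by blast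
  qed
  ultimately show "regular_sequence L (map ?f xs)"
    unfolding regular_sequence_def using carr by simp
qed

lemma depth_le_krull_dim_localization: "local_depth L \<le> krull_dim L"
proof -
  interpret L: cring L by (rule localization_cring)
  show ?thesis
    unfolding local_depth_def the_maximalideal_localization
    using L.regular_sequence_le_krull_dim[OF _ _ extension_primeideal[OF primeideal subset_refl]]
    by (intro Sup_least) auto
qed

text \<open>Squeezes depth and dimension at \<open>length xs\<close>: the sequence bounds the depth
  from below, the hypothesis on chains bounds the dimension from above, and depth never exceeds
  dimension.\<close>

lemma cohen_macaulay_localizationI:
  assumes "noetherian_ring R" "set xs \<subseteq> I"
    and "\<And>i r. i < length xs \<Longrightarrow> r \<in> carrier R \<Longrightarrow> xs ! i \<otimes> r \<in> Idl (set (take i xs)) \<Longrightarrow>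
      \<exists>u\<in>carrier R - I. u \<otimes> r \<in> Idl (set (take i xs))"
    and chain: "\<And>P n. \<forall>i\<le>n. primeideal (P i) R \<Longrightarrow> \<forall>i<n. P i \<subset> P (Suc i) \<Longrightarrow> P n \<subseteq> I \<Longrightarrow> n \<le> length xs"
  shows "cohen_macaulay_local L"
proof -
  have "enat (length (map (\<lambda>x. fraction R I x \<one>) xs)) \<le> local_depth L"
    unfolding local_depth_def the_maximalideal_localization
    using regular_sequence_localization[OF assms(2,3)] by (intro Sup_upper) blast
  moreover have "n \<le> length xs" if P: "\<forall>i\<le>n. primeideal (P i) L" "\<forall>i<n. P i \<subset> P (Suc i)" for n P
  proof (rule chain[where P = "\<lambda>i. contraction (P i)"])
    have id: "ideal (P i) L" if "i \<le> n" for i using P(1) that primeideal.axioms(1) by blast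
    show "\<forall>i\<le>n. primeideal (contraction (P i)) R" "contraction (P n) \<subseteq> I"
      using P(1) contraction_primeideal by auto
    show "\<forall>i<n. contraction (P i) \<subset> contraction (P (Suc i))"
      using P(2) contraction_strict_mono id by auto
  qed
  then have "krull_dim L \<le> enat (length xs)"
    unfolding krull_dim_def by (intro Sup_least) auto
  ultimately have "local_depth L = krull_dim L"
    using depth_le_krull_dim_localization by simp
  then show ?thesis
    unfolding cohen_macaulay_local_def
    using localization_local_ring localization_noetherian[OF assms(1)] by simp
qed

text \<open>Modulo the nonzerodivisor \<open>x\<close> the element \<open>y\<close> is nonzero but
  killed by the whole maximal ideal of the localization, which limits regular sequences to length
  one; the chain from \<open>q\<close> over \<open>q'\<close> to \<open>I\<close> gives dimension at
  least two.\<close>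

lemma not_cohen_macaulay_localizationI:
  assumes x: "x \<in> carrier R" "\<And>r. r \<in> carrier R \<Longrightarrow> x \<otimes> r = \<zero> \<Longrightarrow> r = \<zero>"
    and y: "y \<in> carrier R" and I: "I = {r \<in> carrier R. r \<otimes> y \<in> Idl {x}}"
    and chain: "primeideal q R" "primeideal q' R" "q \<subset> q'" "q' \<subset> I"
  shows "\<not> cohen_macaulay_local L"
proof
  interpret L: cring L by (rule localization_cring)
  assume "cohen_macaulay_local L"
  then have eq: "local_depth L = krull_dim L" by (simp add: cohen_macaulay_local_def)
  let ?f = "\<lambda>x. fraction R I x \<one>"
  have iff: "fraction R I a s \<in> Idl\<^bsub>L\<^esub> {?f x} \<longleftrightarrow> (\<exists>u\<in>carrier R - I. u \<otimes> a \<in> Idl {x})"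
    if "a \<in> carrier R" "s \<in> carrier R - I" for a s
    using fraction_mem_genideal_iff[of "{x}" a s] that x by simp
  have mem_I: "r \<in> I \<longleftrightarrow> r \<in> carrier R \<and> r \<otimes> y \<in> Idl {x}" for r by (subst I) simp
  have "length xs \<le> 1" if "regular_sequence L xs" "set xs \<subseteq> extension I" for xs
  proof (rule L.regular_sequence_length_le_1[OF _ _ _ _ _ that])
    show "?f x \<in> carrier L" "?f y \<in> carrier L"
      using fraction_carrier compl_one x y by blast+
    show "?f y \<notin> Idl\<^bsub>L\<^esub> {?f x}"
      unfolding iff[OF y compl_one] using mem_I by simp
    fix X
    show "X = \<zero>\<^bsub>L\<^esub>" if X: "X \<in> carrier L" "?f x \<otimes>\<^bsub>L\<^esub> X = \<zero>\<^bsub>L\<^esub>"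
    proof -
      obtain r s where rs: "r \<in> carrier R" "s \<in> carrier R - I" "X = fraction R I r s"
        using localization_carrierE[OF X(1)] .
      have s: "s \<in> carrier R" using rs by simp
      have "fraction R I (x \<otimes> r) s = fraction R I \<zero> \<one>"
        using X rs s x(1) compl_one by (simp add: localization_mult localization_zero del: Diff_iff)
      then obtain u where u: "u \<in> carrier R - I" "u \<otimes> (x \<otimes> r \<otimes> \<one>) = u \<otimes> (\<zero> \<otimes> s)"
        using fraction_eq_iff[OF m_closed[OF x(1) rs(1)] rs(2) zero_closed compl_one] by blast
      have "x \<otimes> (u \<otimes> r) = \<zero>" using u rs(1) s x(1) by (simp add: m_ac)
      then have "u \<otimes> r = \<zero>" using x(2)[of "u \<otimes> r"] u rs(1) by simp
      then show ?thesis
        unfolding rs(3) localization_zero using u rs compl_one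
        by (intro fraction_eqI[of _ _ _ _ u]) auto
    qed
    show "X \<otimes>\<^bsub>L\<^esub> ?f y \<in> Idl\<^bsub>L\<^esub> {?f x}" if "X \<in> extension I"
    proof -
      obtain a s where as: "X = fraction R I a s" "a \<in> I" "s \<in> carrier R - I"
        using \<open>X \<in> extension I\<close> by (auto simp: extension_def)
      have c: "a \<in> carrier R" "s \<in> carrier R" using as Icarr by auto
      have "X \<otimes>\<^bsub>L\<^esub> ?f y = fraction R I (a \<otimes> y) s"
        using as c y compl_one by (simp add: localization_mult del: Diff_iff)
      moreover have "\<one> \<otimes> (a \<otimes> y) \<in> Idl {x}" using as(2) y c by (simp add: mem_I)
      ultimately show ?thesis
        using iff[OF m_closed[OF c(1) y] as(3)] compl_one by (simp only:) blast
    qed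
  qed
  then have "local_depth L \<le> enat 1"
    unfolding local_depth_def the_maximalideal_localization by (intro Sup_least) auto
  moreover have "enat 2 \<le> krull_dim L"
  proof -
    define P where "P = (\<lambda>i::nat. extension (if i = 0 then q else if i = 1 then q' else I))"
    have "\<forall>i\<le>2. primeideal (P i) L"
      unfolding P_def using chain primeideal by (auto intro!: extension_primeideal)
    moreover have "\<forall>i<2. P i \<subset> P (Suc i)"
      unfolding P_def using chain extension_strict_mono[of q q'] extension_strict_mono[of q' I] primeideal
      by (auto simp: less_2_cases_iff)
    ultimately show ?thesis unfolding krull_dim_def by (intro Sup_upper) blast
  qed
  ultimately have "enat 2 \<le> enat 1" unfolding eq by (rule order_trans[rotated])
  then show False by simp
qed

end

section \<open>Group algebras of ordered groups\<close>

lemma sum_single_lookup: "(\<Sum>a\<in>Poly_Mapping.keys f. Poly_Mapping.single a (Poly_Mapping.lookup f a)) = f"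
  by (rule poly_mapping_eqI)
    (auto simp: lookup_sum lookup_single when_def sum.delta not_in_keys_iff_lookup_eq_zero)

lemma lookup_single_mult:
  fixes g :: "'a::ab_group_add \<Rightarrow>\<^sub>0 'k::comm_ring_1"
  shows "Poly_Mapping.lookup (Poly_Mapping.single a c * g) k = c * Poly_Mapping.lookup g (k - a)"
proof -
  have "Poly_Mapping.lookup (Poly_Mapping.single a c * g) k =
      (\<Sum>l. c * Poly_Mapping.lookup g (k - l) when a = l)"
    unfolding lookup_mult lookup_single
  proof (rule Sum_any.cong)
    fix l
    have "(\<Sum>q. Poly_Mapping.lookup g q when k = l + q) = (\<Sum>q. Poly_Mapping.lookup g q when k - l = q)"
      by (rule Sum_any.cong) (auto simp: when_def algebra_simps)
    then show "(c when a = l) * (\<Sum>q. Poly_Mapping.lookup g q when k = l + q) =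
        (c * Poly_Mapping.lookup g (k - l) when a = l)"
      by (simp add: when_def)
  qed
  then show ?thesis by simp
qed

lemma lookup_mult_sum:
  fixes f g :: "'a::ab_group_add \<Rightarrow>\<^sub>0 'k::comm_ring_1"
  shows "Poly_Mapping.lookup (f * g) k =
    (\<Sum>a\<in>Poly_Mapping.keys f. Poly_Mapping.lookup f a * Poly_Mapping.lookup g (k - a))"
proof -
  have "f * g = (\<Sum>a\<in>Poly_Mapping.keys f. Poly_Mapping.single a (Poly_Mapping.lookup f a)) * g"
    by (simp only: sum_single_lookup)
  also have "\<dots> = (\<Sum>a\<in>Poly_Mapping.keys f. Poly_Mapping.single a (Poly_Mapping.lookup f a) * g)"
    by (rule sum_distrib_right)
  finally show ?thesis by (simp only: lookup_sum lookup_single_mult)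
qed

text \<open>A translation-invariant total order, encoded as an additive injection into an ordered
  group. Leading terms can then be multiplied, which makes the group algebra a domain.\<close>

locale additive_order =
  fixes \<phi> :: "'a::ab_group_add \<Rightarrow> 'b::linordered_ab_group_add"
  assumes order_add: "\<phi> (x + y) = \<phi> x + \<phi> y" and order_inj: "inj \<phi>"
begin

definition lead :: "('a \<Rightarrow>\<^sub>0 'k::zero) \<Rightarrow> 'a" where
  "lead f = inv_into UNIV \<phi> (Max (\<phi> ` Poly_Mapping.keys f))"

lemma
  assumes "f \<noteq> 0"
  shows lead_in_keys: "lead f \<in> Poly_Mapping.keys f"
    and le_lead: "\<And>a. a \<in> Poly_Mapping.keys f \<Longrightarrow> \<phi> a \<le> \<phi> (lead f)"
proof -
  have "Poly_Mapping.keys f \<noteq> {}"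
    using assms by (metis lookup_zero not_in_keys_iff_lookup_eq_zero poly_mapping_eqI empty_iff)
  then have "Max (\<phi> ` Poly_Mapping.keys f) \<in> \<phi> ` Poly_Mapping.keys f" by (intro Max_in) auto
  then obtain b where b: "b \<in> Poly_Mapping.keys f" "Max (\<phi> ` Poly_Mapping.keys f) = \<phi> b" by blast
  then have "lead f = b" unfolding lead_def by (simp add: inv_f_f[OF order_inj])
  then show "lead f \<in> Poly_Mapping.keys f"
    "\<And>a. a \<in> Poly_Mapping.keys f \<Longrightarrow> \<phi> a \<le> \<phi> (lead f)"
    using b Max_ge[of "\<phi> ` Poly_Mapping.keys f"] by (auto simp flip: b(2))
qed

text \<open>If two exponents have the same sum as the two leads and the first is below its lead,
  then the second is above its own; so only one product contributes to this coefficient.\<close>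

lemma lookup_lead_mult:
  fixes f g :: "'a \<Rightarrow>\<^sub>0 'k::idom"
  assumes "f \<noteq> 0" "g \<noteq> 0"
  shows "Poly_Mapping.lookup (f * g) (lead f + lead g) =
    Poly_Mapping.lookup f (lead f) * Poly_Mapping.lookup g (lead g)"
proof -
  have "Poly_Mapping.lookup g (lead f + lead g - a) = 0"
    if "a \<in> Poly_Mapping.keys f" "a \<noteq> lead f" for a
  proof (rule ccontr)
    assume "Poly_Mapping.lookup g (lead f + lead g - a) \<noteq> 0"
    then have "\<phi> (lead f + lead g - a) \<le> \<phi> (lead g)" using le_lead[OF assms(2)] by (simp add: in_keys_iff)
    moreover have "\<phi> (lead f) + \<phi> (lead g) = \<phi> (lead f + lead g - a) + \<phi> a" by (simp flip: order_add)
    moreover have "\<phi> a < \<phi> (lead f)" using le_lead[OF assms(1) that(1)] that(2) order_inj by (simp add: less_le inj_eq)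
    ultimately show False by (metis add_strict_mono add.commute add_le_less_mono less_irrefl)
  qed
  then have "Poly_Mapping.lookup (f * g) (lead f + lead g) =
      (\<Sum>a\<in>Poly_Mapping.keys f. if a = lead f then Poly_Mapping.lookup f a * Poly_Mapping.lookup g (lead g) else 0)"
    unfolding lookup_mult_sum by (intro sum.cong) auto
  then show ?thesis using lead_in_keys[OF assms(1)] by simp
qed

lemma mult_eq_0_iff:
  fixes f g :: "'a \<Rightarrow>\<^sub>0 'k::idom"
  shows "f * g = 0 \<longleftrightarrow> f = 0 \<or> g = 0"
proof -
  have "f * g \<noteq> 0" if "f \<noteq> 0" "g \<noteq> 0"
    using lookup_lead_mult[OF that] lead_in_keys[OF that(1)] lead_in_keys[OF that(2)]
    by (auto simp: in_keys_iff)
  then show ?thesis by auto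
qed

end

text \<open>The order on \<open>nat \<Rightarrow>\<^sub>0 rat\<close> is lexicographic. Position
  \<open>0\<close> is reserved for the weight \<open>w\<close>, so the order refines
  \<open>w\<close>; the coordinates, shifted by one, follow and make the map injective.\<close>

lemma exists_additive_order:
  fixes w :: "int ^ 'n \<Rightarrow> rat"
  assumes w: "\<And>x y. w (x + y) = w x + w y"
  obtains \<phi> :: "int ^ 'n \<Rightarrow> (nat \<Rightarrow>\<^sub>0 rat)"
  where "additive_order \<phi>" "\<And>x y. \<phi> x \<le> \<phi> y \<Longrightarrow> w x \<le> w y"
proof -
  obtain f where f: "bij_betw f (UNIV :: 'n set) {0..<CARD('n)}"
    using ex_bij_betw_finite_nat[of "UNIV :: 'n set"] by auto
  define g where "g = inv_into (UNIV :: 'n set) f"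
  have g: "g (f i) = i" "f i < CARD('n)" for i
    using f unfolding g_def by (auto simp: bij_betw_def inv_into_f_f dest: image_eqI[of _ f])
  define c where "c x k = (if k = 0 then w x else if k \<le> CARD('n) then of_int (x $ g (k - 1)) else 0)" for x k
  define \<phi> where "\<phi> x = Abs_poly_mapping (c x)" for x
  have fin: "finite {k. c x k \<noteq> 0}" for x
    by (rule finite_subset[of _ "{..CARD('n)}"]) (auto simp: c_def split: if_splits)
  have lookup: "Poly_Mapping.lookup (\<phi> x) = c x" for x
    unfolding \<phi>_def using fin by simp
  have "additive_order \<phi>"
  proof
    show "\<phi> (x + y) = \<phi> x + \<phi> y" for x y
      by (rule poly_mapping_eqI) (simp add: lookup lookup_add c_def w)
    show "inj \<phi>"
    proof (rule injI)
      fix x y assume "\<phi> x = \<phi> y"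
      then have "c x = c y" using lookup by metis
      then have "c x (Suc (f i)) = c y (Suc (f i))" for i by simp
      then show "x = y" using g by (auto simp: c_def vec_eq_iff Suc_le_eq)
    qed
  qed
  moreover have "w x \<le> w y" if "\<phi> x \<le> \<phi> y" for x y
  proof (cases "\<phi> x = \<phi> y")
    case True
    then have "c x 0 = c y 0" using lookup by metis
    then show ?thesis by (simp add: c_def)
  next
    case False
    then have "less_fun (c x) (c y)"
      using that lookup by (metis less_poly_mapping.rep_eq order_le_less)
    then obtain k where k: "c x k < c y k" "\<And>k'. k' < k \<Longrightarrow> c x k' = c y k'"
      by (auto simp: less_fun_def)
    then have "c x 0 \<le> c y 0" by (cases "k = 0") (auto simp: less_imp_le)
    then show ?thesis by (simp add: c_def)
  qed
  ultimately show ?thesis using that by blast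
qed

lemma group_algebra_mult_eq_0_iff:
  fixes f g :: "int ^ 'n \<Rightarrow>\<^sub>0 'k::idom"
  shows "f * g = 0 \<longleftrightarrow> f = 0 \<or> g = 0"
proof -
  obtain \<phi> :: "int ^ 'n \<Rightarrow> (nat \<Rightarrow>\<^sub>0 rat)" where "additive_order \<phi>"
    using exists_additive_order[of "\<lambda>_. 0"] by auto
  then show ?thesis by (rule additive_order.mult_eq_0_iff)
qed

lemma keys_mult_subset:
  assumes "Poly_Mapping.keys f \<subseteq> A" "Poly_Mapping.keys g \<subseteq> B"
    and "\<And>a b. a \<in> A \<Longrightarrow> b \<in> B \<Longrightarrow> a + b \<in> C"
  shows "Poly_Mapping.keys (f * g) \<subseteq> C"
  using keys_mult[of f g] assms by blast

lemma keys_add_subset: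
  "Poly_Mapping.keys f \<subseteq> A \<Longrightarrow> Poly_Mapping.keys g \<subseteq> A \<Longrightarrow> Poly_Mapping.keys (f + g) \<subseteq> A"
  using Poly_Mapping.keys_add[of f g] by blast

lemma keys_diff_subset:
  fixes f g :: "'a \<Rightarrow>\<^sub>0 'b::ab_group_add"
  shows "Poly_Mapping.keys f \<subseteq> A \<Longrightarrow> Poly_Mapping.keys g \<subseteq> A \<Longrightarrow> Poly_Mapping.keys (f - g) \<subseteq> A"
  using keys_add_subset[of f A "- g"] by (simp add: in_keys_iff subset_iff)

lemma keys_sum_subset:
  "(\<And>i. i \<in> I \<Longrightarrow> Poly_Mapping.keys (f i) \<subseteq> A) \<Longrightarrow> Poly_Mapping.keys (sum f I) \<subseteq> A"
proof (induction I rule: infinite_finite_induct)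
  case (insert i I)
  then show ?case using keys_add_subset[of "f i" A "sum f I"] by simp
qed simp_all

section \<open>Semigroup rings\<close>

lemma semigroup_ring_simps [simp]:
  "carrier (semigroup_ring T S) = {f. Poly_Mapping.keys f \<subseteq> S}"
  "f \<otimes>\<^bsub>semigroup_ring T S\<^esub> g = f * g"
  "f \<oplus>\<^bsub>semigroup_ring T S\<^esub> g = f + g"
  "\<one>\<^bsub>semigroup_ring T S\<^esub> = 1"
  "\<zero>\<^bsub>semigroup_ring T S\<^esub> = 0"
  by (simp_all add: semigroup_ring_def)

lemma affine_semigroup_zero: "affine_semigroup S \<Longrightarrow> 0 \<in> S"
  and affine_semigroup_add: "affine_semigroup S \<Longrightarrow> x \<in> S \<Longrightarrow> y \<in> S \<Longrightarrow> x + y \<in> S"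
  by (auto simp: affine_semigroup_def intro: monoid_closure.intros)

context
  fixes S :: "(int ^ 'n) set" and J :: "((int ^ 'n) \<Rightarrow>\<^sub>0 'k::field) set"
  assumes S: "affine_semigroup S" and J: "ideal J (semigroup_ring TYPE('k) S)"
begin

interpretation J: ideal J "semigroup_ring TYPE('k) S" by (rule J)

lemma semigroup_ideal_keys: "f \<in> J \<Longrightarrow> Poly_Mapping.keys f \<subseteq> S"
  using J.Icarr by simp

lemma semigroup_ideal_zero: "0 \<in> J"
  using additive_subgroup.zero_closed[OF J.is_additive_subgroup] by simp

lemma semigroup_ideal_add: "f \<in> J \<Longrightarrow> g \<in> J \<Longrightarrow> f + g \<in> J"
  using additive_subgroup.a_closed[OF J.is_additive_subgroup] by simp

lemma semigroup_ideal_mult: "Poly_Mapping.keys r \<subseteq> S \<Longrightarrow> f \<in> J \<Longrightarrow> r * f \<in> J"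
  using J.I_l_closed[of f r] by simp

lemma semigroup_ideal_diff:
  assumes "f \<in> J" "g \<in> J"
  shows "f - g \<in> J"
proof -
  have "Poly_Mapping.keys (- 1 :: (int ^ 'n) \<Rightarrow>\<^sub>0 'k) \<subseteq> S"
    using affine_semigroup_zero[OF S] by (auto simp: in_keys_iff lookup_one when_def split: if_splits)
  from semigroup_ideal_mult[OF this assms(2)] show ?thesis
    using semigroup_ideal_add[OF assms(1), of "- 1 * g"] by simp
qed

end

lemma semigroup_ideal_one_notin:
  assumes "primeideal p (semigroup_ring TYPE('k::field) S)"
  shows "1 \<notin> p"
proof -
  interpret p: primeideal p "semigroup_ring TYPE('k) S" by fact
  show ?thesis using p.one_imp_carrier p.I_notcarr by auto
qed

lemma semigroup_prime:
  assumes "primeideal p (semigroup_ring TYPE('k::field) S)"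
    "Poly_Mapping.keys f \<subseteq> S" "Poly_Mapping.keys g \<subseteq> S" "f * g \<in> p"
  shows "f \<in> p \<or> g \<in> p"
proof -
  interpret p: primeideal p "semigroup_ring TYPE('k) S" by fact
  show ?thesis using p.I_prime[of f g] assms by simp
qed

lemma semigroup_idealI:
  fixes J :: "((int ^ 'n) \<Rightarrow>\<^sub>0 'k::field) set"
  assumes S: "affine_semigroup S"
    and "\<And>f. f \<in> J \<Longrightarrow> Poly_Mapping.keys f \<subseteq> S" "0 \<in> J"
    and add: "\<And>f g. f \<in> J \<Longrightarrow> g \<in> J \<Longrightarrow> f + g \<in> J"
    and mult: "\<And>r f. Poly_Mapping.keys r \<subseteq> S \<Longrightarrow> f \<in> J \<Longrightarrow> r * f \<in> J"
  shows "ideal J (semigroup_ring TYPE('k) S)"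
proof -
  interpret R: cring "semigroup_ring TYPE('k) S" by (rule semigroup_ring_cring[OF S])
  show ?thesis
  proof (rule idealI[OF R.ring_axioms])
    show "subgroup J (add_monoid (semigroup_ring TYPE('k) S))"
    proof (rule R.add.subgroupI)
      fix f assume f: "f \<in> J"
      have c: "f \<in> carrier (semigroup_ring TYPE('k) S)" using assms(2) f by simp
      have "\<ominus>\<^bsub>semigroup_ring TYPE('k) S\<^esub> f =
          (\<ominus>\<^bsub>semigroup_ring TYPE('k) S\<^esub> \<one>\<^bsub>semigroup_ring TYPE('k) S\<^esub>) \<otimes>\<^bsub>semigroup_ring TYPE('k) S\<^esub> f"
        using R.l_minus[OF R.one_closed c] R.l_one[OF c] by (simp only:)
      also have "\<dots> \<in> J"
        using mult[of "\<ominus>\<^bsub>semigroup_ring TYPE('k) S\<^esub> \<one>\<^bsub>semigroup_ring TYPE('k) S\<^esub>" f] f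
          R.a_inv_closed[OF R.one_closed] by simp
      finally show "\<ominus>\<^bsub>semigroup_ring TYPE('k) S\<^esub> f \<in> J" .
    next
      show "J \<subseteq> carrier (semigroup_ring TYPE('k) S)" using assms(2) by auto
      show "J \<noteq> {}" using assms(3) by blast
    qed (simp add: add)
    fix f r assume "f \<in> J" "r \<in> carrier (semigroup_ring TYPE('k) S)"
    then show "r \<otimes>\<^bsub>semigroup_ring TYPE('k) S\<^esub> f \<in> J" "f \<otimes>\<^bsub>semigroup_ring TYPE('k) S\<^esub> r \<in> J"
      using mult[of r f] by (simp_all add: mult.commute[of f])
  qed
qed

section \<open>Dickson's lemma\<close>

text \<open>Induction on the set of coordinates. Let \<open>T0\<close> dominate on \<open>D\<close>
  and let \<open>m\<close> bound its entries at \<open>j\<close>. Elements with \<open>t j\<close>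
  at least \<open>m\<close> are dominated by \<open>T0\<close> at \<open>j\<close> as well, and the
  finitely many slices with \<open>t j = k < m\<close> have finite dominating sets of their
  own.\<close>

lemma Dickson:
  fixes T :: "('i \<Rightarrow> nat) set"
  assumes "finite D"
  shows "\<exists>T0\<subseteq>T. finite T0 \<and> (\<forall>t\<in>T. \<exists>t0\<in>T0. \<forall>i\<in>D. t0 i \<le> t i)"
  using assms
proof (induction D arbitrary: T rule: finite_induct)
  case empty
  show ?case
  proof (cases "T = {}")
    case False
    then obtain t where "t \<in> T" by blast
    then show ?thesis by (intro exI[of _ "{t}"]) auto
  qed auto
next
  case (insert j D)
  obtain T0 where T0: "T0 \<subseteq> T" "finite T0" "\<And>t. t \<in> T \<Longrightarrow> \<exists>t0\<in>T0. \<forall>i\<in>D. t0 i \<le> t i"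
    using insert.IH[of T] by blast
  define m where "m = Max (insert 0 ((\<lambda>t. t j) ` T0))"
  have m: "t j \<le> m" if "t \<in> T0" for t using that T0(2) by (auto simp: m_def intro!: Max_ge)
  have "\<forall>k. \<exists>U\<subseteq>{t \<in> T. t j = k}. finite U \<and> (\<forall>t\<in>{t \<in> T. t j = k}. \<exists>t0\<in>U. \<forall>i\<in>D. t0 i \<le> t i)"
    using insert.IH by blast
  from choice[OF this] obtain U where U': "\<forall>k. U k \<subseteq> {t \<in> T. t j = k} \<and> finite (U k) \<and>
    (\<forall>t\<in>{t \<in> T. t j = k}. \<exists>t0\<in>U k. \<forall>i\<in>D. t0 i \<le> t i)" by blast
  have U: "U k \<subseteq> {t \<in> T. t j = k}" "finite (U k)"
    "t \<in> T \<Longrightarrow> t j = k \<Longrightarrow> \<exists>t0\<in>U k. \<forall>i\<in>D. t0 i \<le> t i" for k t using U' by simp_all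
  show ?case
  proof (intro exI[of _ "T0 \<union> (\<Union>k<m. U k)"] conjI ballI)
    fix t assume t: "t \<in> T"
    show "\<exists>t0\<in>T0 \<union> (\<Union>k<m. U k). \<forall>i\<in>insert j D. t0 i \<le> t i"
    proof (cases "t j < m")
      case True
      obtain t0 where t0: "t0 \<in> U (t j)" "\<forall>i\<in>D. t0 i \<le> t i" using U(3)[OF t refl] by blast
      then have "t0 j = t j" using U(1) by blast
      then show ?thesis using t0 True by (intro bexI[of _ t0]) auto
    next
      case False
      obtain t0 where t0: "t0 \<in> T0" "\<forall>i\<in>D. t0 i \<le> t i" using T0(3)[OF t] by blast
      have "t0 j \<le> t j" using m[OF t0(1)] False by simp
      then show ?thesis using t0 by (intro bexI[of _ t0]) auto
    qed
  next
    show "T0 \<union> (\<Union>k<m. U k) \<subseteq> T" using T0(1) U(1) by blast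
    show "finite (T0 \<union> (\<Union>k<m. U k))" using T0(2) U(2) by simp
  qed
qed

section \<open>Semigroups that are free over a free submonoid\<close>

text \<open>Isolates what Cohen-Macaulayness of \<open>K[tilde B]\<close> depends on. The functions
  \<open>lam i\<close> are additive on the whole of Z^n, so coordinates of differences and of
  elements outside \<open>S\<close> can be computed without side conditions. They are rational
  because the elements of \<open>H\<close> may have fractional coordinates.\<close>

locale free_semigroup =
  fixes d :: nat and e :: "nat \<Rightarrow> int ^ 'n" and lam :: "nat \<Rightarrow> int ^ 'n \<Rightarrow> rat"
    and H S :: "(int ^ 'n) set"
  assumes lam_add: "lam i (x + y) = lam i x + lam i y"
    and lam_e: "i \<in> {1..d} \<Longrightarrow> j \<in> {1..d} \<Longrightarrow> lam i (e j) = (if i = j then 1 else 0)"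
    and finite_H: "finite H"
    and lam_H: "h \<in> H \<Longrightarrow> i \<in> {1..d} \<Longrightarrow> 0 \<le> lam i h"
    and S_eq: "S = {h + (\<Sum>i = 1..d. int (m i) *s e i) | h m. h \<in> H}"
    and H_unique: "h \<in> H \<Longrightarrow> h' \<in> H \<Longrightarrow>
      h + (\<Sum>i = 1..d. int (m i) *s e i) = h' + (\<Sum>i = 1..d. int (m' i) *s e i) \<Longrightarrow> h = h'"
    and affine: "affine_semigroup S"
begin

definition mon :: "(nat \<Rightarrow> nat) \<Rightarrow> int ^ 'n" where
  "mon m = (\<Sum>i = 1..d. int (m i) *s e i)"

lemma mon_add: "mon (\<lambda>i. m i + m' i) = mon m + mon m'"
  by (simp add: mon_def vector_sadd_rdistrib sum.distrib)

lemma mon_zero: "mon (\<lambda>_. 0) = 0"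
  by (simp add: mon_def)

lemma mon_cong: "(\<And>i. i \<in> {1..d} \<Longrightarrow> m i = m' i) \<Longrightarrow> mon m = mon m'"
  unfolding mon_def by (intro sum.cong) auto

lemma lam_zero: "lam i 0 = 0"
  using lam_add[of i 0 0] by simp

lemma lam_sum: "lam i (sum f I) = (\<Sum>j\<in>I. lam i (f j))"
  by (induction I rule: infinite_finite_induct) (auto simp: lam_zero lam_add)

lemma lam_scale: "lam i (int k *s x) = of_nat k * lam i x"
proof (induction k)
  case (Suc k)
  have "int (Suc k) *s x = x + int k *s x" by (simp add: vec_eq_iff distrib_right)
  then show ?case using Suc by (simp only: lam_add) (simp add: algebra_simps)
qed (simp add: lam_zero)

lemma lam_mon: "i \<in> {1..d} \<Longrightarrow> lam i (mon m) = of_nat (m i)"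
  by (simp add: mon_def lam_sum lam_scale lam_e sum.delta if_distrib[of "\<lambda>x. _ * x"] cong: if_cong)

lemma S_zero: "0 \<in> S"
  by (rule affine_semigroup_zero[OF affine])

lemma S_add: "x \<in> S \<Longrightarrow> y \<in> S \<Longrightarrow> x + y \<in> S"
  by (rule affine_semigroup_add[OF affine])

lemma S_memI: "h \<in> H \<Longrightarrow> h + mon m \<in> S"
  unfolding S_eq mon_def by blast

definition base :: "int ^ 'n \<Rightarrow> int ^ 'n" where
  "base s = (SOME h. h \<in> H \<and> (\<exists>m. s = h + mon m))"

text \<open>Together with \<open>base s\<close> these are the exponents of t^s in the free module
  over \<open>K[A]\<close>. They are determined only at indices in \<open>{1..d}\<close>, since
  \<open>mon\<close> ignores all others.\<close>

definition ex :: "int ^ 'n \<Rightarrow> nat \<Rightarrow> nat" where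
  "ex s = (SOME m. s = base s + mon m)"

lemma
  assumes "s \<in> S"
  shows base_in_H: "base s \<in> H" and base_ex: "base s + mon (ex s) = s"
proof -
  have "\<exists>h. h \<in> H \<and> (\<exists>m. s = h + mon m)" using assms by (auto simp: S_eq mon_def)
  from someI_ex[OF this] have 1: "base s \<in> H" "\<exists>m. s = base s + mon m"
    unfolding base_def by blast+
  from someI_ex[OF 1(2)] have "s = base s + mon (ex s)" unfolding ex_def .
  with 1(1) show "base s \<in> H" "base s + mon (ex s) = s" by simp_all
qed

lemma of_nat_ex: "s \<in> S \<Longrightarrow> i \<in> {1..d} \<Longrightarrow> of_nat (ex s i) = lam i s - lam i (base s)"
  using lam_add[of i "base s" "mon (ex s)"] by (simp add: base_ex lam_mon)

lemma base_eqI: "h \<in> H \<Longrightarrow> base (h + mon m) = h"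
  using H_unique[of "base (h + mon m)" h "ex (h + mon m)" m] base_in_H[OF S_memI[of h m]]
    base_ex[OF S_memI[of h m]] by (simp add: mon_def)

lemma ex_eqI: "h \<in> H \<Longrightarrow> i \<in> {1..d} \<Longrightarrow> ex (h + mon m) i = m i"
  using of_nat_ex[OF S_memI[of h m], of i] by (simp add: base_eqI lam_add lam_mon)

lemma S_add_mon: "s \<in> S \<Longrightarrow> s + mon m \<in> S"
  using S_memI[OF base_in_H, of s "\<lambda>i. ex s i + m i"] base_ex[of s]
  by (simp add: mon_add flip: add.assoc)

lemma ex_add_mon:
  assumes "s \<in> S" "i \<in> {1..d}"
  shows "ex (s + mon m) i = ex s i + m i"
proof -
  have "s + mon m = base s + mon (\<lambda>i. ex s i + m i)"
    using base_ex[OF assms(1)] by (simp add: mon_add flip: add.assoc)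
  then show ?thesis using ex_eqI[OF base_in_H[OF assms(1)] assms(2)] by simp
qed

text \<open>A decomposition of \<open>0\<close> with a positive exponent would need a base point
  with a negative coordinate, which \<open>lam_H\<close> excludes.\<close>

lemma ex_zero:
  assumes "i \<in> {1..d}"
  shows "ex 0 i = 0"
  using of_nat_ex[OF S_zero assms] lam_H[OF base_in_H[OF S_zero] assms] by (simp add: lam_zero)

lemma mon_in_S: "mon m \<in> S"
  using S_add_mon[OF S_zero, of m] by simp

lemma ex_mon: "i \<in> {1..d} \<Longrightarrow> ex (mon m) i = m i"
  using ex_add_mon[OF S_zero, of i m] by (simp add: ex_zero)

lemma S_dominated:
  assumes "s \<in> S" "t \<in> S" "base s = base t" "\<And>i. i \<in> {1..d} \<Longrightarrow> ex s i \<le> ex t i"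
  shows "t = s + mon (\<lambda>i. ex t i - ex s i)"
proof -
  have "mon (ex t) = mon (\<lambda>i. ex s i + (ex t i - ex s i))"
    using assms(4) by (intro mon_cong) auto
  then show ?thesis
    using base_ex[OF assms(1)] base_ex[OF assms(2)] assms(3) by (metis add.assoc mon_add)
qed

definition deg :: "int ^ 'n \<Rightarrow> rat" where
  "deg s = (\<Sum>i = 1..d. lam i s)"

lemma deg_add: "deg (x + y) = deg x + deg y"
  by (simp add: deg_def lam_add sum.distrib)

lemma deg_mon: "deg (mon m) = of_nat (\<Sum>i = 1..d. m i)"
  by (simp add: deg_def lam_mon)

lemma ex_le_deg:
  assumes "s \<in> S" "i \<in> {1..d}"
  shows "of_nat (ex s i) \<le> deg s"
proof -
  have "of_nat (ex s i) \<le> (\<Sum>i = 1..d. of_nat (ex s i) :: rat)"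
    using assms(2) member_le_sum[of i "{1..d}" "\<lambda>i. of_nat (ex s i) :: rat"] by simp
  also have "\<dots> \<le> (\<Sum>i = 1..d. lam i s)"
    using of_nat_ex[OF assms(1)] lam_H[OF base_in_H[OF assms(1)]] by (intro sum_mono) simp
  finally show ?thesis by (simp add: deg_def)
qed

text \<open>Every exponent is bounded by the degree, so an element of degree at most
  \<open>N\<close> is given by its translate and a point of a cube with \<open>(N + 1) ^ d\<close>
  points.\<close>

lemma
  fixes N :: nat
  shows finite_deg_le: "finite {s \<in> S. deg s \<le> of_nat N}"
    and card_deg_le: "card {s \<in> S. deg s \<le> of_nat N} \<le> card H * (N + 1) ^ d"
proof -
  let ?X = "H \<times> ({1..d} \<rightarrow>\<^sub>E {..N})"
  have fin: "finite ?X" using finite_H by (auto intro!: finite_PiE)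
  have sub: "{s \<in> S. deg s \<le> of_nat N} \<subseteq> (\<lambda>(h, m). h + mon m) ` ?X"
  proof
    fix s assume "s \<in> {s \<in> S. deg s \<le> of_nat N}"
    then have s: "s \<in> S" "deg s \<le> of_nat N" by auto
    then have "ex s i \<le> N" if "i \<in> {1..d}" for i using ex_le_deg[OF s(1) that] by linarith
    then have "(base s, restrict (ex s) {1..d}) \<in> ?X" using base_in_H[OF s(1)] by auto
    moreover have "s = base s + mon (restrict (ex s) {1..d})"
      using base_ex[OF s(1)] mon_cong[of "ex s" "restrict (ex s) {1..d}"] by simp
    ultimately show "s \<in> (\<lambda>(h, m). h + mon m) ` ?X" by force
  qed
  then show "finite {s \<in> S. deg s \<le> of_nat N}" using fin finite_surj by blast
  have "card {s \<in> S. deg s \<le> of_nat N} \<le> card ?X"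
    using sub fin by (rule surj_card_le[rotated])
  also have "\<dots> = card H * (N + 1) ^ d" by (simp add: card_cartesian_product card_PiE)
  finally show "card {s \<in> S. deg s \<le> of_nat N} \<le> card H * (N + 1) ^ d" .
qed

lemma semigroup_ring_is_cring: "cring (semigroup_ring TYPE('k::field) S)"
  by (rule semigroup_ring_cring[OF affine])

text \<open>Comparing exponents implies divisibility only inside one translate, so Dickson's lemma
  is applied to each of the finitely many translates separately.\<close>

lemma exists_finite_dominating:
  assumes "L \<subseteq> S"
  shows "\<exists>M\<subseteq>L. finite M \<and> (\<forall>s\<in>L. \<exists>t\<in>M. \<exists>m. s = t + mon m)"
proof -
  have "\<exists>M\<subseteq>{s \<in> L. base s = h}. finite M \<and>
      (\<forall>s\<in>{s \<in> L. base s = h}. \<exists>t\<in>M. \<forall>i\<in>{1..d}. ex t i \<le> ex s i)" for h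
  proof -
    obtain T where T: "T \<subseteq> ex ` {s \<in> L. base s = h}" "finite T"
      "\<And>m. m \<in> ex ` {s \<in> L. base s = h} \<Longrightarrow> \<exists>t\<in>T. \<forall>i\<in>{1..d}. t i \<le> m i"
      using Dickson[of "{1..d}" "ex ` {s \<in> L. base s = h}"] by auto
    obtain M where "M \<subseteq> {s \<in> L. base s = h}" "finite M" "T = ex ` M"
      using finite_subset_image[OF T(2,1)] by blast
    then show ?thesis using T(3) by (intro exI[of _ M]) auto
  qed
  then have "\<forall>h. \<exists>M. M \<subseteq> {s \<in> L. base s = h} \<and> finite M \<and>
      (\<forall>s\<in>{s \<in> L. base s = h}. \<exists>t\<in>M. \<forall>i\<in>{1..d}. ex t i \<le> ex s i)" by blast
  from choice[OF this] obtain M where M: "\<forall>h. M h \<subseteq> {s \<in> L. base s = h} \<and> finite (M h) \<and>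
      (\<forall>s\<in>{s \<in> L. base s = h}. \<exists>t\<in>M h. \<forall>i\<in>{1..d}. ex t i \<le> ex s i)" by blast
  show ?thesis
  proof (intro exI[of _ "\<Union>h\<in>H. M h"] conjI ballI)
    show "(\<Union>h\<in>H. M h) \<subseteq> L" using M by blast
    show "finite (\<Union>h\<in>H. M h)" using M finite_H by blast
    fix s assume s: "s \<in> L"
    then obtain t where t: "t \<in> M (base s)" "\<forall>i\<in>{1..d}. ex t i \<le> ex s i" using M by blast
    have bt: "t \<in> L" "base t = base s" using M t(1) by blast+
    have "s = t + mon (\<lambda>i. ex s i - ex t i)"
      using t bt s assms by (intro S_dominated) auto
    moreover have "base s \<in> H" using base_in_H s assms by blast
    ultimately show "\<exists>t\<in>\<Union>h\<in>H. M h. \<exists>m. s = t + mon m" using t(1) by blast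
  qed
qed

text \<open>Leading monomials with respect to a term order refining the degree; by Dickson's lemma those
  of an ideal are multiples of finitely many of them.\<close>

lemma semigroup_ring_noetherian: "noetherian_ring (semigroup_ring TYPE('k::field) S)"
proof -
  let ?R = "semigroup_ring TYPE('k) S"
  interpret R: cring ?R by (rule semigroup_ring_is_cring)
  obtain \<phi> :: "int ^ 'n \<Rightarrow> (nat \<Rightarrow>\<^sub>0 rat)" where "additive_order \<phi>"
    and \<phi>_deg: "\<And>x y. \<phi> x \<le> \<phi> y \<Longrightarrow> deg x \<le> deg y"
    using exists_additive_order[of deg] deg_add by blast
  interpret additive_order \<phi> by fact
  define r where "r = {(x, y). x \<in> S \<and> y \<in> S \<and> \<phi> x < \<phi> y}"
  \<comment> \<open>Elements outside \<open>S\<close> have no predecessors. For the others,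
    \<open>\<phi>\<close> refines the degree and only finitely many elements of \<open>S\<close>
    have bounded degree, so a minimum can be taken in a finite set.\<close>
  have "wf r"
    unfolding wf_eq_minimal
  proof (intro allI impI)
    fix Q and q :: "int ^ 'n" assume q: "q \<in> Q"
    show "\<exists>z\<in>Q. \<forall>y. (y, z) \<in> r \<longrightarrow> y \<notin> Q"
    proof (cases "q \<in> S")
      case False
      then show ?thesis using q by (intro bexI[of _ q]) (auto simp: r_def)
    next
      case True
      define N where "N = nat \<lceil>deg q\<rceil>"
      have N: "deg q \<le> of_nat N" unfolding N_def by (rule of_nat_ceiling)
      define F where "F = {s \<in> S \<inter> Q. deg s \<le> of_nat N}"
      have F: "finite F" "F \<noteq> {}"
        using finite_subset[OF _ finite_deg_le[of N], of F] q True N by (auto simp: F_def)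
      then have "Min (\<phi> ` F) \<in> \<phi> ` F" by (intro Min_in) auto
      then obtain z where z: "z \<in> F" "Min (\<phi> ` F) = \<phi> z" by blast
      have "y \<notin> Q" if "(y, z) \<in> r" for y
      proof
        assume "y \<in> Q"
        have yz: "y \<in> S" "\<phi> y < \<phi> z" using that by (auto simp: r_def)
        then have "deg y \<le> of_nat N" using \<phi>_deg[OF less_imp_le] z(1) by (fastforce simp: F_def intro: order_trans)
        then have "y \<in> F" using \<open>y \<in> Q\<close> yz by (simp add: F_def)
        then have "\<phi> z \<le> \<phi> y" using F(1) by (simp flip: z(2))
        then show False using yz by simp
      qed
      then show ?thesis using z(1) by (auto simp: F_def)
    qed
  qed
  show ?thesis
  proof (rule R.noetherian_ringI)
    fix J assume J: "ideal J ?R"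
    note J_keys = semigroup_ideal_keys[OF affine J] and J_mult = semigroup_ideal_mult[OF affine J]
      and J_diff = semigroup_ideal_diff[OF affine J]
    have L: "lead ` (J - {0}) \<subseteq> S" using lead_in_keys J_keys by blast
    obtain M where M: "M \<subseteq> lead ` (J - {0})" "finite M"
      "\<And>s. s \<in> lead ` (J - {0}) \<Longrightarrow> \<exists>t\<in>M. \<exists>m. s = t + mon m"
      using exists_finite_dominating[OF L] by blast
    obtain A where A: "A \<subseteq> J - {0}" "finite A" "M = lead ` A"
      using finite_subset_image[OF M(2,1)] by blast
    have A_carr: "A \<subseteq> carrier ?R" using A(1) J_keys by auto
    interpret G: ideal "Idl\<^bsub>?R\<^esub> A" ?R by (rule R.genideal_ideal[OF A_carr])
    note G_mult = semigroup_ideal_mult[OF affine G.is_ideal]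
      and G_add = semigroup_ideal_add[OF affine G.is_ideal]
    have lead_step: "\<forall>f\<in>J. f \<noteq> 0 \<longrightarrow> lead f = s \<longrightarrow> f \<in> Idl\<^bsub>?R\<^esub> A" for s
      using \<open>wf r\<close>
    proof (induction s rule: wf_induct_rule)
      case (less s)
      show ?case
      proof (intro ballI impI)
        fix f assume f: "f \<in> J" "f \<noteq> 0" "lead f = s"
        then obtain t m where "t \<in> M" "s = t + mon m" using M(3)[of s] by blast
        then obtain g where g: "g \<in> A" "s = lead g + mon m" using A(3) by blast
        then have gJ: "g \<in> J" "g \<noteq> 0" using A(1) by auto
        \<comment> \<open>One step of division: the monomial multiple \<open>q\<close> of
          \<open>g\<close> has the same leading term as \<open>f\<close>, so \<open>f - q\<close> is
          zero or has a smaller lead.\<close>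
        define c where "c = Poly_Mapping.lookup f s / Poly_Mapping.lookup g (lead g)"
        define q where "q = Poly_Mapping.single (mon m) c * g"
        have single: "Poly_Mapping.keys (Poly_Mapping.single (mon m) c) \<subseteq> S"
          using mon_in_S by auto
        have q_lookup: "Poly_Mapping.lookup q k = c * Poly_Mapping.lookup g (k - mon m)" for k
          unfolding q_def by (rule lookup_single_mult)
        have qJ: "q \<in> J" unfolding q_def by (rule J_mult[OF single gJ(1)])
        have qA: "q \<in> Idl\<^bsub>?R\<^esub> A"
          unfolding q_def using R.genideal_self[OF A_carr] g(1) by (intro G_mult[OF single]) auto
        have lg: "Poly_Mapping.lookup g (lead g) \<noteq> 0" using lead_in_keys[OF gJ(2)] by (simp add: in_keys_iff)
        have "Poly_Mapping.lookup (f - q) s = 0"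
          using lg g(2) by (simp add: lookup_minus q_lookup c_def)
        then have s_notin: "s \<notin> Poly_Mapping.keys (f - q)" by (simp add: in_keys_iff)
        have "f - q \<in> Idl\<^bsub>?R\<^esub> A"
        proof (cases "f - q = 0")
          case True
          then show ?thesis using semigroup_ideal_zero[OF affine G.is_ideal] by simp
        next
          case False
          let ?s = "lead (f - q)"
          have in_keys: "?s \<in> Poly_Mapping.keys (f - q)" by (rule lead_in_keys[OF False])
          then have "?s \<in> Poly_Mapping.keys f \<or> ?s - mon m \<in> Poly_Mapping.keys g"
            by (auto simp: in_keys_iff lookup_minus q_lookup)
          then have "\<phi> ?s \<le> \<phi> s"
          proof
            assume "?s \<in> Poly_Mapping.keys f"
            then show ?thesis using le_lead[OF f(2)] f(3) by simp
          next
            assume "?s - mon m \<in> Poly_Mapping.keys g"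
            from le_lead[OF gJ(2) this] have "\<phi> (?s - mon m) + \<phi> (mon m) \<le> \<phi> (lead g) + \<phi> (mon m)"
              by simp
            then show ?thesis using g(2) by (simp flip: order_add)
          qed
          moreover have "\<phi> ?s \<noteq> \<phi> s" using in_keys s_notin order_inj by (auto simp: inj_eq)
          moreover have "f - q \<in> J" by (rule J_diff[OF f(1) qJ])
          moreover have "?s \<in> S" "s \<in> S"
            using in_keys J_keys[OF \<open>f - q \<in> J\<close>] lead_in_keys[OF f(2)] J_keys[OF f(1)] f(3) by auto
          ultimately show ?thesis using less.IH[of ?s] False by (auto simp: r_def)
        qed
        then have "f - q + q \<in> Idl\<^bsub>?R\<^esub> A" by (rule G_add[OF _ qA])
        then show "f \<in> Idl\<^bsub>?R\<^esub> A" by simp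
      qed
    qed
    have "J \<subseteq> Idl\<^bsub>?R\<^esub> A"
    proof
      fix f assume "f \<in> J"
      then show "f \<in> Idl\<^bsub>?R\<^esub> A"
        using lead_step[of "lead f"] semigroup_ideal_zero[OF affine G.is_ideal] by (cases "f = 0") simp_all
    qed
    moreover have "Idl\<^bsub>?R\<^esub> A \<subseteq> J" using A(1) by (intro R.genideal_minimal[OF J]) auto
    ultimately show "\<exists>A\<subseteq>carrier ?R. finite A \<and> J = Idl\<^bsub>?R\<^esub> A" using A_carr A(2) by blast
  qed
qed

end

section \<open>Growth and chains of prime ideals\<close>

text \<open>At arguments of the form \<open>r * M\<close> the estimate
  \<open>(n / r) ^ r \<le> n choose r\<close> becomes one between integers; \<open>growth_le\<close>
  evaluates its bound there.\<close>

lemma power_le_binomial: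
  assumes "0 < r"
  shows "(M + 1) ^ r \<le> (r * M + r choose r)"
proof -
  have "(of_nat (r * M + r) / of_nat r) ^ r \<le> (of_nat (r * M + r choose r) :: rat)"
    by (rule binomial_ge_n_over_k_pow_k) simp
  moreover have "of_nat (r * M + r) / of_nat r = (of_nat (M + 1) :: rat)"
    using assms by (simp add: field_simps)
  ultimately have "of_nat ((M + 1) ^ r) \<le> (of_nat (r * M + r choose r) :: rat)" by simp
  then show ?thesis by (simp only: of_nat_le_iff)
qed

text \<open>Allows \<open>growth_face\<close> to count a cube of exponents instead of a
  simplex.\<close>

lemma binomial_le_power: "(N + r choose r) \<le> (N + 1) ^ r"
proof (induction r)
  case (Suc r)
  have "Suc r * (N + Suc r choose Suc r) = (N + Suc r) * (N + r choose r)"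
    using Suc_times_binomial[of r "N + r"] by simp
  also have "\<dots> \<le> (Suc r * (N + 1)) * (N + 1) ^ r" by (intro mult_mono Suc) auto
  finally have "Suc r * (N + Suc r choose Suc r) \<le> Suc r * (N + 1) ^ Suc r" by (simp add: algebra_simps)
  then show ?case using Suc_mult_le_cancel1 by blast
qed simp

context free_semigroup
begin

definition supported :: "nat \<Rightarrow> ((int ^ 'n) \<Rightarrow>\<^sub>0 'k::field) set" where
  "supported N = {f. Poly_Mapping.keys f \<subseteq> {s \<in> S. deg s \<le> of_nat N}}"

text \<open>Linear independence over \<open>K\<close> of the residue classes modulo
  \<open>p\<close>, where the scalar \<open>a\<close> acts as the constant
  \<open>Poly_Mapping.single 0 a\<close>.\<close>

definition indep_mod :: "((int ^ 'n) \<Rightarrow>\<^sub>0 'k::field) set \<Rightarrow> ((int ^ 'n) \<Rightarrow>\<^sub>0 'k) set \<Rightarrow> bool" where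
  "indep_mod p F \<longleftrightarrow> finite F \<and>
     (\<forall>c. (\<Sum>f\<in>F. Poly_Mapping.single 0 (c f) * f) \<in> p \<longrightarrow> (\<forall>f\<in>F. c f = 0))"

text \<open>The dimensions of the filtered pieces of \<open>K[S] / p\<close> grow at least like a polynomial of
  degree \<open>r\<close>; passing to a smaller prime raises \<open>r\<close> by one.\<close>

definition growth :: "((int ^ 'n) \<Rightarrow>\<^sub>0 'k::field) set \<Rightarrow> nat \<Rightarrow> bool" where
  "growth p r \<longleftrightarrow> (\<exists>a. \<forall>N. \<exists>F. indep_mod p F \<and> F \<subseteq> supported (a * N) \<and> (N + r choose r) \<le> card F)"

lemma indep_modD:
  assumes "indep_mod p F" "(\<Sum>f\<in>F. Poly_Mapping.single 0 (c f) * f) \<in> p" "v \<in> F"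
  shows "c v = 0"
  using assms unfolding indep_mod_def by blast

lemma supported_mono: "M \<le> N \<Longrightarrow> supported M \<subseteq> supported N"
  unfolding supported_def by (auto intro: order_trans)

lemma supported_mult:
  assumes "f \<in> supported M" "g \<in> supported N"
  shows "f * g \<in> supported (M + N)"
  unfolding supported_def
proof (rule CollectI, rule keys_mult_subset)
  show "Poly_Mapping.keys f \<subseteq> {s \<in> S. deg s \<le> of_nat M}"
    "Poly_Mapping.keys g \<subseteq> {s \<in> S. deg s \<le> of_nat N}"
    using assms by (simp_all add: supported_def)
  fix a b assume "a \<in> {s \<in> S. deg s \<le> of_nat M}" "b \<in> {s \<in> S. deg s \<le> of_nat N}"
  then show "a + b \<in> {s \<in> S. deg s \<le> of_nat (M + N)}"
    by (simp add: S_add deg_add add_mono)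
qed

lemma exists_supported:
  assumes "Poly_Mapping.keys f \<subseteq> S"
  shows "\<exists>N. f \<in> supported N"
proof -
  define N where "N = Max (insert 0 ((\<lambda>s. nat \<lceil>deg s\<rceil>) ` Poly_Mapping.keys f))"
  have "deg s \<le> of_nat N" if "s \<in> Poly_Mapping.keys f" for s
  proof -
    have "nat \<lceil>deg s\<rceil> \<le> N" unfolding N_def using that by (intro Max_ge) auto
    then show ?thesis using of_nat_ceiling[of "deg s"] by (meson of_nat_mono order_trans)
  qed
  then show ?thesis using assms by (auto simp: supported_def)
qed

text \<open>Write a relation as \<open>X + f * Y\<close> in \<open>p\<close>. Modulo
  \<open>p'\<close> only \<open>X\<close> remains, so the coefficients on \<open>F\<close> vanish.
  Then \<open>f * Y\<close> lies in \<open>p\<close> while \<open>f\<close> does not, so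
  \<open>Y\<close> lies in \<open>p\<close> and the coefficients on \<open>G\<close> vanish
  too.\<close>

lemma indep_mod_step:
  fixes p p' :: "((int ^ 'n) \<Rightarrow>\<^sub>0 'k::field) set"
  assumes p: "primeideal p (semigroup_ring TYPE('k) S)" and p': "ideal p' (semigroup_ring TYPE('k) S)"
    and sub: "p \<subseteq> p'" and f: "f \<in> p'" "f \<notin> p"
    and F: "indep_mod p' F"
    and G: "indep_mod p G" "\<And>g. g \<in> G \<Longrightarrow> Poly_Mapping.keys g \<subseteq> S"
  shows "indep_mod p (F \<union> (*) f ` G)" "card (F \<union> (*) f ` G) = card F + card G"
proof -
  have idp: "ideal p (semigroup_ring TYPE('k) S)" using p by (rule primeideal.axioms(1))
  have f0: "f \<noteq> 0" using f(2) semigroup_ideal_zero[OF affine idp] by auto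
  have fin: "finite F" "finite G" using F G by (auto simp: indep_mod_def)
  have f_keys: "Poly_Mapping.keys f \<subseteq> S" by (rule semigroup_ideal_keys[OF affine p' f(1)])
  have single: "Poly_Mapping.keys (Poly_Mapping.single 0 (c :: 'k)) \<subseteq> S" for c
    using S_zero by simp
  have inj: "inj_on ((*) f) G"
  proof (rule inj_onI)
    fix g g' assume "f * g = f * g'"
    then have "f * (g - g') = 0" by (simp add: right_diff_distrib)
    then show "g = g'" using f0 by (simp add: group_algebra_mult_eq_0_iff)
  qed
  have fg: "f * g \<in> p'" if "Poly_Mapping.keys g \<subseteq> S" for g
    using semigroup_ideal_mult[OF affine p' that f(1)] by (simp add: mult.commute)
  have disj: "F \<inter> (*) f ` G = {}"
  proof (rule ccontr)
    assume "F \<inter> (*) f ` G \<noteq> {}"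
    then obtain v where v: "v \<in> F" "v \<in> p'" using fg G(2) by blast
    have "(\<Sum>u\<in>F. Poly_Mapping.single 0 (if u = v then 1 else 0) * u) = (\<Sum>u\<in>F. if u = v then u else 0)"
      by (intro sum.cong) auto
    also have "\<dots> = v" using v(1) fin(1) by simp
    finally have "(if v = v then 1 else 0 :: 'k) = 0"
      using v(2) by (intro indep_modD[OF F _ v(1)]) simp
    then show False by simp
  qed
  show "card (F \<union> (*) f ` G) = card F + card G"
    using card_Un_disjoint[OF fin(1) finite_imageI[OF fin(2)] disj] card_image[OF inj] by simp
  have "\<forall>v\<in>F \<union> (*) f ` G. c v = 0" if c: "(\<Sum>v\<in>F \<union> (*) f ` G. Poly_Mapping.single 0 (c v) * v) \<in> p" for c
  proof -
    define X where "X = (\<Sum>v\<in>F. Poly_Mapping.single 0 (c v) * v)"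
    define Y where "Y = (\<Sum>g\<in>G. Poly_Mapping.single 0 (c (f * g)) * g)"
    have "(\<Sum>v\<in>F \<union> (*) f ` G. Poly_Mapping.single 0 (c v) * v) =
        X + (\<Sum>g\<in>G. Poly_Mapping.single 0 (c (f * g)) * (f * g))"
      unfolding X_def sum.union_disjoint[OF fin(1) finite_imageI[OF fin(2)] disj] sum.reindex[OF inj]
      by (simp add: o_def)
    also have "\<dots> = X + f * Y" unfolding Y_def by (simp add: sum_distrib_left mult.left_commute)
    finally have XY: "X + f * Y \<in> p" using c by simp
    have Y_keys: "Poly_Mapping.keys Y \<subseteq> S"
      unfolding Y_def by (intro keys_sum_subset keys_mult_subset[OF single G(2) S_add])
    have "X + f * Y - f * Y \<in> p'"
      by (rule semigroup_ideal_diff[OF affine p']) (use XY sub fg[OF Y_keys] in auto)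
    then have cF: "\<forall>v\<in>F. c v = 0" using indep_modD[OF F, of c] by (simp add: X_def)
    then have "X = 0" by (simp add: X_def)
    with XY have "f * Y \<in> p" by simp
    then have "Y \<in> p" using semigroup_prime[OF p f_keys Y_keys] f(2) by blast
    then have "\<forall>g\<in>G. c (f * g) = 0"
      using indep_modD[OF G(1), of "\<lambda>g. c (f * g)"] by (simp add: Y_def)
    then show ?thesis using cF by blast
  qed
  then show "indep_mod p (F \<union> (*) f ` G)" using fin by (auto simp: indep_mod_def)
qed

text \<open>Induction on \<open>N\<close> by Pascal's rule: the count for \<open>Suc N\<close> is
  the count of the set \<open>G\<close> found for \<open>N\<close> plus that of a set independent
  modulo \<open>p'\<close>. Each step multiplies \<open>G\<close> by \<open>f\<close> once, so the
  slope \<open>a\<close> of the degree window grows by a degree bound \<open>\<delta>\<close> of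
  \<open>f\<close>.\<close>

lemma growth_step:
  fixes p p' :: "((int ^ 'n) \<Rightarrow>\<^sub>0 'k::field) set"
  assumes p: "primeideal p (semigroup_ring TYPE('k) S)" and p': "ideal p' (semigroup_ring TYPE('k) S)"
    and sub: "p \<subset> p'" and growth: "growth p' r"
  shows "growth p (Suc r)"
proof -
  obtain f where f: "f \<in> p'" "f \<notin> p" using sub by blast
  obtain \<delta> where \<delta>: "f \<in> supported \<delta>"
    using exists_supported[OF semigroup_ideal_keys[OF affine p' f(1)]] by blast
  obtain a where a: "\<And>N. \<exists>F. indep_mod p' F \<and> F \<subseteq> supported (a * N) \<and> (N + r choose r) \<le> card F"
    using growth by (auto simp: growth_def)
  have "\<exists>F. indep_mod p F \<and> F \<subseteq> supported ((a + \<delta>) * N) \<and> (N + Suc r choose Suc r) \<le> card F" for N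
  proof (induction N)
    case 0
    obtain F where F: "indep_mod p' F" "F \<subseteq> supported (a * 0)" "(0 + r choose r) \<le> card F"
      using a[of 0] by blast
    then have "indep_mod p F" using sub by (auto simp: indep_mod_def)
    then show ?case using F by (intro exI[of _ F]) auto
  next
    case (Suc N)
    obtain G where G: "indep_mod p G" "G \<subseteq> supported ((a + \<delta>) * N)" "(N + Suc r choose Suc r) \<le> card G"
      using Suc by blast
    obtain F where F: "indep_mod p' F" "F \<subseteq> supported (a * Suc N)" "(Suc N + r choose r) \<le> card F"
      using a[of "Suc N"] by blast
    have G_keys: "Poly_Mapping.keys g \<subseteq> S" if "g \<in> G" for g
      using G(2) that by (auto simp: supported_def)
    have subset: "p \<subseteq> p'" using sub by blast
    have step: "indep_mod p (F \<union> (*) f ` G)" "card (F \<union> (*) f ` G) = card F + card G"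
      using indep_mod_step[OF p p' subset f F(1) G(1)] G_keys by blast+
    have "(*) f ` G \<subseteq> supported ((a + \<delta>) * Suc N)"
    proof
      fix v assume "v \<in> (*) f ` G"
      then have "v \<in> supported (\<delta> + (a + \<delta>) * N)" using supported_mult[OF \<delta>] G(2) by blast
      moreover have "\<delta> + (a + \<delta>) * N \<le> (a + \<delta>) * Suc N" by simp
      ultimately show "v \<in> supported ((a + \<delta>) * Suc N)" using supported_mono by blast
    qed
    moreover have "F \<subseteq> supported ((a + \<delta>) * Suc N)"
    proof -
      have "a * Suc N \<le> (a + \<delta>) * Suc N" by (rule mult_right_mono) simp_all
      then show ?thesis using F(2) supported_mono by blast
    qed
    moreover have "(Suc N + Suc r choose Suc r) \<le> card (F \<union> (*) f ` G)"
      using F(3) G(3) unfolding step(2) by simp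
    ultimately show ?case using step(1) by (intro exI[of _ "F \<union> (*) f ` G"]) blast
  qed
  then show ?thesis unfolding growth_def by blast
qed

text \<open>Independence modulo \<open>p\<close> implies linear independence in \<open>K[S]\<close>,
  where the elements of degree at most \<open>a * N\<close> span a space whose dimension is bounded
  by a polynomial in \<open>N\<close> of degree \<open>d\<close>.\<close>

lemma growth_le:
  fixes p :: "((int ^ 'n) \<Rightarrow>\<^sub>0 'k::field) set"
  assumes p: "ideal p (semigroup_ring TYPE('k) S)" and growth: "growth p r"
  shows "r \<le> d"
proof (rule ccontr)
  assume "\<not> r \<le> d"
  interpret pm: vector_space "\<lambda>(c :: 'k) (f :: int ^ 'n \<Rightarrow>\<^sub>0 'k). Poly_Mapping.single 0 c * f"
    by unfold_locales (simp_all add: algebra_simps single_add mult_single flip: mult.assoc)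
  obtain a where a: "\<And>N. \<exists>F. indep_mod p F \<and> F \<subseteq> supported (a * N) \<and> (N + r choose r) \<le> card F"
    using growth by (auto simp: growth_def)
  have bound: "(N + r choose r) \<le> card H * (a * N + 1) ^ d" for N
  proof -
    obtain F where F: "indep_mod p F" "F \<subseteq> supported (a * N)" "(N + r choose r) \<le> card F"
      using a by blast
    let ?S = "{s \<in> S. deg s \<le> of_nat (a * N)}"
    let ?T = "(\<lambda>s. Poly_Mapping.single s (1 :: 'k)) ` ?S"
    have "pm.independent F"
      using F(1) semigroup_ideal_zero[OF affine p] by (auto simp: indep_mod_def pm.dependent_finite)
    moreover have "F \<subseteq> pm.span ?T"
    proof
      fix f assume "f \<in> F"
      then have keys: "Poly_Mapping.keys f \<subseteq> ?S" using F(2) by (auto simp: supported_def)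
      have "f = (\<Sum>s\<in>Poly_Mapping.keys f. Poly_Mapping.single 0 (Poly_Mapping.lookup f s) * Poly_Mapping.single s 1)"
        by (simp add: mult_single sum_single_lookup)
      also have "\<dots> \<in> pm.span ?T"
        using keys by (intro pm.span_sum pm.span_scale pm.span_base) auto
      finally show "f \<in> pm.span ?T" .
    qed
    ultimately have "card F \<le> card ?T"
      using pm.independent_span_bound[of ?T F] finite_deg_le[of "a * N"] by simp
    also have "\<dots> \<le> card ?S" by (rule card_image_le[OF finite_deg_le])
    also have "\<dots> \<le> card H * (a * N + 1) ^ d" by (rule card_deg_le)
    finally show ?thesis using F(3) by simp
  qed
  \<comment> \<open>\<open>C\<close> absorbs all constants: at \<open>N = r * C\<close> the upper
    bound is at most \<open>C * (C + 1) ^ d\<close>, the lower bound at least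
    \<open>(C + 1) ^ Suc d\<close>.\<close>
  define C where "C = card H * (a * r + 1) ^ d"
  have r: "0 < r" "Suc d \<le> r" using \<open>\<not> r \<le> d\<close> by auto
  have "(C + 1) ^ Suc d \<le> (C + 1) ^ r" using r by (intro power_increasing) auto
  also have "\<dots> \<le> (r * C + r choose r)" by (rule power_le_binomial[OF r(1)])
  also have "\<dots> \<le> card H * (a * (r * C) + 1) ^ d" by (rule bound)
  also have "\<dots> \<le> card H * ((a * r + 1) * (C + 1)) ^ d"
    by (intro mult_left_mono power_mono) (auto simp: algebra_simps)
  also have "\<dots> = C * (C + 1) ^ d" by (simp only: C_def power_mult_distrib mult.assoc)
  finally have "(C + 1) * (C + 1) ^ d \<le> C * (C + 1) ^ d" by simp
  then show False by simp
qed

text \<open>Having \<open>keys\<close> in \<open>face I\<close> means being a polynomial in the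
  variables indexed by \<open>I\<close>; "no nonzero element of \<open>p\<close> has this form"
  expresses their algebraic independence modulo \<open>p\<close>.\<close>

definition face :: "nat set \<Rightarrow> (int ^ 'n) set" where
  "face I = {mon m | m. \<forall>i. i \<notin> I \<longrightarrow> m i = 0}"

text \<open>Monomials in variables that are independent modulo \<open>p\<close> remain linearly
  independent there; those with all exponents at most \<open>N\<close> have degree at most
  \<open>card I * N\<close>.\<close>

lemma growth_face:
  fixes p :: "((int ^ 'n) \<Rightarrow>\<^sub>0 'k::field) set"
  assumes I: "I \<subseteq> {1..d}" and p: "\<And>f. f \<in> p \<Longrightarrow> Poly_Mapping.keys f \<subseteq> face I \<Longrightarrow> f = 0"
  shows "growth p (card I)"
proof -
  have fin_I: "finite I" using I by (rule finite_subset) simp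
  have "\<exists>F. indep_mod p F \<and> F \<subseteq> supported (card I * N) \<and> (N + card I choose card I) \<le> card F" for N
  proof -
    define X where "X = I \<rightarrow>\<^sub>E {..N}"
    define \<mu> where "\<mu> m = mon (\<lambda>i. if i \<in> I then m i else 0)" for m
    define F where "F = (\<lambda>m. Poly_Mapping.single (\<mu> m) (1 :: 'k)) ` X"
    have fin_X: "finite X" unfolding X_def using fin_I by (auto intro: finite_PiE)
    have inj_\<mu>: "inj_on \<mu> X"
    proof (rule inj_onI)
      fix m m' assume m: "m \<in> X" "m' \<in> X" "\<mu> m = \<mu> m'"
      have "m i = m' i" if "i \<in> I" for i
        using m(3) lam_mon[of i "\<lambda>i. if i \<in> I then m i else 0"] lam_mon[of i "\<lambda>i. if i \<in> I then m' i else 0"] that I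
        by (auto simp: \<mu>_def)
      then show "m = m'" using m unfolding X_def by (intro PiE_ext) auto
    qed
    have inj: "inj_on (\<lambda>m. Poly_Mapping.single (\<mu> m) (1 :: 'k)) X"
    proof (rule inj_onI)
      fix m m' assume m: "m \<in> X" "m' \<in> X" "Poly_Mapping.single (\<mu> m) (1 :: 'k) = Poly_Mapping.single (\<mu> m') 1"
      then have "\<mu> m = \<mu> m'" by (metis keys_single one_neq_zero singleton_inject)
      then show "m = m'" using m(1,2) inj_\<mu> by (simp add: inj_on_def)
    qed
    have "card F = (N + 1) ^ card I"
      unfolding F_def card_image[OF inj] by (simp add: X_def card_PiE[OF fin_I])
    then have card: "(N + card I choose card I) \<le> card F" using binomial_le_power by simp
    have "deg (\<mu> m) \<le> of_nat (card I * N)" if "m \<in> X" for m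
    proof -
      have "(\<Sum>i = 1..d. if i \<in> I then m i else 0) = (\<Sum>i\<in>I. m i)"
        using I by (intro sum.mono_neutral_cong_right) auto
      also have "\<dots> \<le> card I * N" using that sum_bounded_above[of I m N] by (auto simp: X_def)
      finally show ?thesis unfolding \<mu>_def deg_mon by (simp only: of_nat_le_iff)
    qed
    then have supp: "F \<subseteq> supported (card I * N)"
      using mon_in_S by (auto simp: F_def supported_def \<mu>_def)
    have "indep_mod p F"
      unfolding indep_mod_def
    proof (intro conjI allI impI ballI)
      show "finite F" unfolding F_def using fin_X by simp
      fix c f assume c: "(\<Sum>f\<in>F. Poly_Mapping.single 0 (c f) * f) \<in> p" and "f \<in> F"
      then obtain m where m: "m \<in> X" "f = Poly_Mapping.single (\<mu> m) 1" by (auto simp: F_def)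
      have eq: "(\<Sum>f\<in>F. Poly_Mapping.single 0 (c f) * f) =
          (\<Sum>m\<in>X. Poly_Mapping.single (\<mu> m) (c (Poly_Mapping.single (\<mu> m) 1)))"
        unfolding F_def sum.reindex[OF inj] by (simp add: mult_single)
      have "\<mu> m \<in> face I" for m unfolding \<mu>_def face_def by auto
      then have "Poly_Mapping.keys (\<Sum>f\<in>F. Poly_Mapping.single 0 (c f) * f) \<subseteq> face I"
        unfolding eq by (intro keys_sum_subset) simp
      from p[OF c this] have "Poly_Mapping.lookup (\<Sum>m\<in>X. Poly_Mapping.single (\<mu> m) (c (Poly_Mapping.single (\<mu> m) 1))) (\<mu> m) = 0"
        unfolding eq by simp
      also have "Poly_Mapping.lookup (\<Sum>m\<in>X. Poly_Mapping.single (\<mu> m) (c (Poly_Mapping.single (\<mu> m) 1))) (\<mu> m) =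
          (\<Sum>m'\<in>X. if m' = m then c (Poly_Mapping.single (\<mu> m') 1) else 0)"
        unfolding lookup_sum lookup_single using m(1) inj_\<mu>
        by (intro sum.cong) (auto simp: when_def inj_on_def)
      also have "\<dots> = c f" using m fin_X by simp
      finally show "c f = 0" .
    qed
    then show ?thesis using card supp by blast
  qed
  then show ?thesis unfolding growth_def by blast
qed

text \<open>Going down from \<open>P n\<close>, where the growth is at least \<open>card I\<close>,
  every strict inclusion adds one, and no ideal has growth above \<open>d\<close>.\<close>

lemma prime_chain_length_le:
  fixes P :: "nat \<Rightarrow> ((int ^ 'n) \<Rightarrow>\<^sub>0 'k::field) set"
  assumes P: "\<forall>i\<le>n. primeideal (P i) (semigroup_ring TYPE('k) S)" "\<forall>i<n. P i \<subset> P (Suc i)"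
    and I: "I \<subseteq> {1..d}" and face: "\<And>f. f \<in> P n \<Longrightarrow> Poly_Mapping.keys f \<subseteq> face I \<Longrightarrow> f = 0"
  shows "n + card I \<le> d"
proof -
  have id: "ideal (P i) (semigroup_ring TYPE('k) S)" if "i \<le> n" for i
    using P(1) that primeideal.axioms(1) by blast
  have "growth (P (n - k)) (card I + k)" if "k \<le> n" for k
    using that
  proof (induction k)
    case 0
    then show ?case using growth_face[OF I face] by simp
  next
    case (Suc k)
    have "Suc (n - Suc k) = n - k" using Suc.prems by simp
    then have "P (n - Suc k) \<subset> P (n - k)" using P(2) Suc.prems by (metis diff_less Suc_le_lessD zero_less_Suc order_le_less_trans zero_le)
    then have "growth (P (n - Suc k)) (Suc (card I + k))"
      using Suc P(1) id by (intro growth_step[of "P (n - Suc k)" "P (n - k)"]) auto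
    then show ?case by simp
  qed
  from growth_le[OF id this[of n]] show ?thesis by simp
qed

end

section \<open>Regular sequences in free semigroup rings\<close>

definition part :: "('a \<Rightarrow> bool) \<Rightarrow> ('a \<Rightarrow>\<^sub>0 'k::zero) \<Rightarrow> 'a \<Rightarrow>\<^sub>0 'k" where
  "part P f = Abs_poly_mapping (\<lambda>s. if P s then Poly_Mapping.lookup f s else 0)"

lemma lookup_part: "Poly_Mapping.lookup (part P f) s = (if P s then Poly_Mapping.lookup f s else 0)"
proof -
  have "finite {s. (if P s then Poly_Mapping.lookup f s else 0) \<noteq> 0}"
    by (rule finite_subset[of _ "Poly_Mapping.keys f"]) (auto simp: in_keys_iff)
  then show ?thesis by (simp add: part_def)
qed

lemma keys_part: "Poly_Mapping.keys (part P f) = {s \<in> Poly_Mapping.keys f. P s}"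
  by (auto simp: in_keys_iff lookup_part split: if_splits)

lemma keys_diff_part:
  fixes f :: "'a \<Rightarrow>\<^sub>0 'k::ab_group_add"
  shows "Poly_Mapping.keys (f - part P f) = {s \<in> Poly_Mapping.keys f. \<not> P s}"
  by (auto simp: in_keys_iff lookup_part lookup_minus split: if_splits)

lemma keys_empty_iff: "Poly_Mapping.keys f = {} \<longleftrightarrow> f = 0"
  by (auto simp: in_keys_iff poly_mapping_eq_iff fun_eq_iff)

text \<open>Monomials are units of the group algebra, so division by them can be done there; that
  the quotient stays in \<open>K[S]\<close> is read off from its support.\<close>

lemma single_mult_inverse:
  fixes f :: "'a::ab_group_add \<Rightarrow>\<^sub>0 'k::comm_ring_1"
  shows "Poly_Mapping.single a 1 * (Poly_Mapping.single (- a) 1 * f) = f"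
  by (simp add: mult_single flip: mult.assoc)

lemma keys_single_mult:
  fixes f :: "'a::ab_group_add \<Rightarrow>\<^sub>0 'k::comm_ring_1"
  shows "Poly_Mapping.keys (Poly_Mapping.single a 1 * f) = (\<lambda>s. s + a) ` Poly_Mapping.keys f"
proof -
  have "s \<in> (\<lambda>s. s + a) ` Poly_Mapping.keys f" if "s - a \<in> Poly_Mapping.keys f" for s
    using that by (intro image_eqI[of _ _ "s - a"]) auto
  then show ?thesis by (auto simp: in_keys_iff lookup_single_mult)
qed

context free_semigroup
begin

lemma scale_eq_mon:
  assumes "j \<in> {1..d}"
  shows "int n *s e j = mon (\<lambda>i. if i = j then n else 0)"
proof -
  have "mon (\<lambda>i. if i = j then n else 0) = (\<Sum>i = 1..d. if i = j then int n *s e i else 0)"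
    unfolding mon_def by (intro sum.cong) auto
  then show ?thesis using assms by simp
qed

lemma face_subset_S: "face I \<subseteq> S"
  using mon_in_S by (auto simp: face_def)

lemma face_mono: "I \<subseteq> J \<Longrightarrow> face I \<subseteq> face J"
  unfolding face_def by blast

lemma zero_in_face: "0 \<in> face I"
  unfolding face_def using mon_zero by (intro CollectI exI[of _ "\<lambda>_. 0"]) simp

lemma face_add:
  assumes "a \<in> face I" "b \<in> face I"
  shows "a + b \<in> face I"
proof -
  obtain m m' where "a = mon m" "b = mon m'" "\<forall>i. i \<notin> I \<longrightarrow> m i = 0" "\<forall>i. i \<notin> I \<longrightarrow> m' i = 0"
    using assms by (auto simp: face_def)
  then show ?thesis
    unfolding face_def by (intro CollectI exI[of _ "\<lambda>i. m i + m' i"]) (simp add: mon_add)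
qed

lemma ex_face: "a \<in> face I \<Longrightarrow> i \<in> {1..d} \<Longrightarrow> i \<notin> I \<Longrightarrow> ex a i = 0"
  by (auto simp: face_def ex_mon)

lemma ex_add_face: "s \<in> S \<Longrightarrow> a \<in> face I \<Longrightarrow> i \<in> {1..d} \<Longrightarrow> ex (s + a) i = ex s i + ex a i"
  by (auto simp: face_def ex_mon ex_add_mon)

lemma S_add_face: "s \<in> S \<Longrightarrow> a \<in> face I \<Longrightarrow> s + a \<in> S"
  by (auto simp: face_def S_add_mon)

lemma S_diff_scale:
  assumes "s \<in> S" "j \<in> {1..d}" "n \<le> ex s j"
  shows "s - int n *s e j \<in> S"
    and "i \<in> {1..d} \<Longrightarrow> ex (s - int n *s e j) i = ex s i - (if i = j then n else 0)"
proof -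
  define m where "m i = ex s i - (if i = j then n else 0)" for i
  have "mon (ex s) = mon (\<lambda>i. m i + (if i = j then n else 0))"
    using assms(3) by (intro mon_cong) (auto simp: m_def)
  then have "s - int n *s e j = base s + mon m"
    using base_ex[OF assms(1)] scale_eq_mon[OF assms(2), of n] by (simp add: mon_add algebra_simps)
  then show "s - int n *s e j \<in> S"
    "i \<in> {1..d} \<Longrightarrow> ex (s - int n *s e j) i = ex s i - (if i = j then n else 0)"
    using S_memI[OF base_in_H[OF assms(1)]] ex_eqI[OF base_in_H[OF assms(1)]] by (simp_all add: m_def)
qed

text \<open>Views \<open>g\<close> as a polynomial in the variable \<open>j\<close> over the
  polynomials in the variables of \<open>I\<close>: \<open>k\<close> is its degree and
  \<open>c\<close> its leading coefficient.\<close>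

lemma face_lead_decomposition:
  fixes g :: "(int ^ 'n) \<Rightarrow>\<^sub>0 'k::field"
  assumes j: "j \<in> {1..d}" "j \<notin> I" and g: "g \<noteq> 0" "Poly_Mapping.keys g \<subseteq> face (insert j I)"
  shows "\<exists>k c g'. g = Poly_Mapping.single (int k *s e j) 1 * c + g' \<and>
    Poly_Mapping.keys c \<subseteq> face I \<and> c \<noteq> 0 \<and>
    Poly_Mapping.keys g' \<subseteq> {a \<in> face (insert j I). ex a j < k}"
proof -
  define k where "k = Max ((\<lambda>a. ex a j) ` Poly_Mapping.keys g)"
  have ne: "Poly_Mapping.keys g \<noteq> {}" using g(1) by (simp add: keys_empty_iff)
  have le: "ex a j \<le> k" if "a \<in> Poly_Mapping.keys g" for a
    unfolding k_def using that by (intro Max_ge) auto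
  have "k \<in> (\<lambda>a. ex a j) ` Poly_Mapping.keys g"
    unfolding k_def using ne by (intro Max_in) auto
  then obtain a where a: "a \<in> Poly_Mapping.keys g" "ex a j = k" by blast
  define T where "T = part (\<lambda>a. ex a j = k) g"
  define c where "c = Poly_Mapping.single (- (int k *s e j)) 1 * T"
  have xc: "Poly_Mapping.single (int k *s e j) 1 * c = T"
    unfolding c_def by (rule single_mult_inverse)
  have "a \<in> Poly_Mapping.keys T" using a by (simp add: T_def keys_part)
  then have "T \<noteq> 0" by auto
  then have "c \<noteq> 0" using xc by auto
  moreover have "Poly_Mapping.keys c \<subseteq> face I"
  proof -
    have "b - int k *s e j \<in> face I" if b: "b \<in> Poly_Mapping.keys T" for b
    proof -
      have "b \<in> face (insert j I)" "ex b j = k" using b g(2) by (auto simp: T_def keys_part)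
      then obtain m where m: "b = mon m" "\<forall>i. i \<notin> insert j I \<longrightarrow> m i = 0" "m j = k"
        using j(1) by (auto simp: face_def ex_mon)
      have "mon m = mon (\<lambda>i. (if i = j then 0 else m i) + (if i = j then k else 0))"
        using m(3) by (intro mon_cong) auto
      then have "b - int k *s e j = mon (\<lambda>i. if i = j then 0 else m i)"
        using m(1) scale_eq_mon[OF j(1), of k] by (simp add: mon_add)
      moreover have "\<forall>i. i \<notin> I \<longrightarrow> (if i = j then 0 else m i) = 0" using m(2) by simp
      ultimately show ?thesis unfolding face_def by blast
    qed
    then show ?thesis unfolding c_def keys_single_mult by auto
  qed
  moreover have "Poly_Mapping.keys (g - T) \<subseteq> {a \<in> face (insert j I). ex a j < k}"
    unfolding T_def keys_diff_part using le g(2) by (auto simp: less_le)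
  ultimately show ?thesis
    using xc by (intro exI[of _ k] exI[of _ c] exI[of _ "g - T"]) simp
qed

end

section \<open>Pseudo-division by polynomial relations in separate variables\<close>

locale regular_family = free_semigroup d e lam H S
  for d :: nat and e :: "nat \<Rightarrow> int ^ 'n" and lam H S +
  fixes I :: "nat set" and g c g' :: "nat \<Rightarrow> (int ^ 'n) \<Rightarrow>\<^sub>0 'k::field" and k :: "nat \<Rightarrow> nat"
  assumes I: "I \<subseteq> {1..d}"
    and g_eq: "j \<in> {1..d} - I \<Longrightarrow> g j = Poly_Mapping.single (int (k j) *s e j) 1 * c j + g' j"
    and c_keys: "j \<in> {1..d} - I \<Longrightarrow> Poly_Mapping.keys (c j) \<subseteq> face I"
    and c_nonzero: "j \<in> {1..d} - I \<Longrightarrow> c j \<noteq> 0"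
    and g'_keys: "j \<in> {1..d} - I \<Longrightarrow> Poly_Mapping.keys (g' j) \<subseteq> {a \<in> face (insert j I). ex a j < k j}"
begin

text \<open>The support allowed for normal forms modulo the relations \<open>g i\<close> with
  \<open>i\<close> in \<open>Q\<close>: in each variable \<open>i\<close> the degree stays below
  that of \<open>g i\<close>.\<close>

definition reduced :: "nat set \<Rightarrow> (int ^ 'n) set" where
  "reduced Q = {s \<in> S. \<forall>i\<in>Q. ex s i < k i}"

text \<open>Multiplying by polynomials in variables outside \<open>Q\<close> does not raise the
  exponents in \<open>Q\<close>. Hence reduction in one variable leaves the reductions already made
  in the others intact.\<close>

lemma reduced_add_face:
  assumes "s \<in> reduced Q" "a \<in> face J" "Q \<subseteq> {1..d}" "J \<inter> Q = {}"
  shows "s + a \<in> reduced Q"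
proof -
  have s: "s \<in> S" using assms by (simp add: reduced_def)
  have "ex (s + a) i < k i" if "i \<in> Q" for i
  proof -
    have "i \<in> {1..d}" "i \<notin> J" using that assms by auto
    then show ?thesis
      using ex_add_face[OF s assms(2), of i] ex_face[OF assms(2), of i] assms(1) that
      by (simp add: reduced_def)
  qed
  then show ?thesis using S_add_face[OF s assms(2)] by (simp add: reduced_def)
qed

lemma g_keys:
  assumes j: "j \<in> {1..d} - I"
  shows "Poly_Mapping.keys (g j) \<subseteq> face (insert j I)"
proof -
  have "int (k j) *s e j \<in> face (insert j I)"
    using j scale_eq_mon[of j "k j"] unfolding face_def
    by (intro CollectI exI[of _ "\<lambda>i. if i = j then k j else 0"]) auto
  moreover have "Poly_Mapping.keys (c j) \<subseteq> face (insert j I)"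
    using c_keys[OF j] face_mono[of I "insert j I"] by blast
  ultimately have "Poly_Mapping.keys (Poly_Mapping.single (int (k j) *s e j) 1 * c j) \<subseteq> face (insert j I)"
    unfolding keys_single_mult using face_add by blast
  then show ?thesis
    unfolding g_eq[OF j] using g'_keys[OF j] by (intro keys_add_subset) auto
qed

lemma g_carrier: "Q \<subseteq> {1..d} - I \<Longrightarrow> g ` Q \<subseteq> carrier (semigroup_ring TYPE('k) S)"
  using g_keys face_subset_S by fastforce

lemma g_nonzero:
  assumes j: "j \<in> {1..d} - I"
  shows "g j \<noteq> 0"
proof
  assume "g j = 0"
  then have "Poly_Mapping.single (int (k j) *s e j) 1 * c j = - g' j"
    using g_eq[OF j] by (simp add: eq_neg_iff_add_eq_0)
  then have "Poly_Mapping.keys (Poly_Mapping.single (int (k j) *s e j) 1 * c j) = Poly_Mapping.keys (g' j)"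
    by (simp add: keys_def)
  then have sub: "(\<lambda>s. s + int (k j) *s e j) ` Poly_Mapping.keys (c j) \<subseteq> {a. ex a j < k j}"
    using g'_keys[OF j] unfolding keys_single_mult by auto
  obtain s where s: "s \<in> Poly_Mapping.keys (c j)" using c_nonzero[OF j] keys_empty_iff by blast
  then have "s \<in> S" using c_keys[OF j] face_subset_S by blast
  then have "ex (s + int (k j) *s e j) j = ex s j + k j"
    using j by (simp add: scale_eq_mon ex_add_mon)
  then show False using sub s by auto
qed

lemma keys_c_power:
  assumes j: "j \<in> {1..d} - I"
  shows "Poly_Mapping.keys (c j ^ N) \<subseteq> face I"
proof (induction N)
  case (Suc N)
  then show ?case using keys_mult_subset[OF c_keys[OF j] Suc face_add] by simp
qed (simp add: zero_in_face)

text \<open>Division with remainder in the variable \<open>j\<close>. Since the leading coefficient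
  \<open>c j\<close> is not a unit, it is collected in a power instead of being inverted. Neither
  \<open>c j\<close> nor \<open>g j\<close> involves the variables of \<open>Q\<close>, so quotient
  and remainder remain reduced there.\<close>

lemma pseudo_division:
  assumes j: "j \<in> {1..d} - I" and Q: "Q \<subseteq> {1..d} - I" "j \<notin> Q"
    and f: "Poly_Mapping.keys f \<subseteq> reduced Q"
  shows "\<exists>N q r. c j ^ N * f = q * g j + r \<and>
    Poly_Mapping.keys q \<subseteq> reduced Q \<and> Poly_Mapping.keys r \<subseteq> reduced (insert j Q)"
proof -
  let ?x = "Poly_Mapping.single (int (k j) *s e j) (1 :: 'k)"
  have jd: "j \<in> {1..d}" using j by simp
  have Qd: "Q \<subseteq> {1..d}" "I \<inter> Q = {}" "insert j I \<inter> Q = {}" using Q by auto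
  have "\<exists>N q r. c j ^ N * f = q * g j + r \<and>
      Poly_Mapping.keys q \<subseteq> reduced Q \<and> Poly_Mapping.keys r \<subseteq> reduced (insert j Q)"
    if "\<forall>s\<in>Poly_Mapping.keys f. ex s j < n" "Poly_Mapping.keys f \<subseteq> reduced Q" for n f
    using that
  proof (induction n arbitrary: f)
    case 0
    then show ?case by (intro exI[of _ 0] exI[of _ f]) auto
  next
    case (Suc n)
    show ?case
    proof (cases "Suc n \<le> k j")
      case True
      then have "Poly_Mapping.keys f \<subseteq> reduced (insert j Q)"
        using Suc.prems by (fastforce simp: reduced_def)
      then show ?thesis by (intro exI[of _ 0] exI[of _ f]) auto
    next
      case False
      then have kn: "k j \<le> n" by simp
      define top where "top = part (\<lambda>s. ex s j = n) f"
      define low where "low = f - top"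
      define t where "t = Poly_Mapping.single (- (int (k j) *s e j)) 1 * top"
      \<comment> \<open>With \<open>f = ?x * t + low\<close> and
        \<open>g j = ?x * c j + g' j\<close> the top terms cancel in
        \<open>c j * f - t * g j\<close>; what remains is \<open>f'\<close>, with exponents of
        \<open>j\<close> below \<open>n\<close>.\<close>
      define f' where "f' = c j * low - t * g' j"
      have top_eq: "top = ?x * t" unfolding t_def by (rule single_mult_inverse[symmetric])
      have "f = ?x * t + low" unfolding low_def top_eq[symmetric] by simp
      then have f'_eq: "c j * f = t * g j + f'"
        unfolding f'_def g_eq[OF j] by (simp add: algebra_simps)
      have low: "Poly_Mapping.keys low \<subseteq> {s \<in> reduced Q. ex s j < n}"
        unfolding low_def top_def keys_diff_part using Suc.prems by (force simp: less_Suc_eq)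
      have t: "Poly_Mapping.keys t \<subseteq> {s \<in> reduced Q. ex s j = n - k j}"
      proof
        fix v assume "v \<in> Poly_Mapping.keys t"
        then obtain s where s: "s \<in> Poly_Mapping.keys top" "v = s - int (k j) *s e j"
          unfolding t_def keys_single_mult by auto
        then have sr: "s \<in> reduced Q" "ex s j = n"
          using Suc.prems(2) by (auto simp: top_def keys_part)
        then have sS: "s \<in> S" "k j \<le> ex s j" using kn by (auto simp: reduced_def)
        have "ex v i < k i" if "i \<in> Q" for i
          using S_diff_scale(2)[OF sS(1) jd sS(2), of i] that Q Qd sr(1) s(2) by (auto simp: reduced_def)
        moreover have "v \<in> S" "ex v j = n - k j"
          using S_diff_scale[OF sS(1) jd sS(2)] jd s(2) sr(2) by auto
        ultimately show "v \<in> {s \<in> reduced Q. ex s j = n - k j}" by (simp add: reduced_def)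
      qed
      have "Poly_Mapping.keys (c j * low) \<subseteq> {s \<in> reduced Q. ex s j < n}"
      proof (rule keys_mult_subset[OF c_keys[OF j] low])
        fix a s assume a: "a \<in> face I" and s: "s \<in> {s \<in> reduced Q. ex s j < n}"
        then have "s + a \<in> reduced Q" "ex (s + a) j = ex s j"
          using reduced_add_face[of s Q a I] Qd ex_add_face[of s a I j] ex_face[OF a jd] j
          by (auto simp: reduced_def)
        then show "a + s \<in> {s \<in> reduced Q. ex s j < n}" using s by (simp add: add.commute)
      qed
      moreover have "Poly_Mapping.keys (t * g' j) \<subseteq> {s \<in> reduced Q. ex s j < n}"
      proof (rule keys_mult_subset[OF t g'_keys[OF j]])
        fix s a assume s: "s \<in> {s \<in> reduced Q. ex s j = n - k j}" and a: "a \<in> {a \<in> face (insert j I). ex a j < k j}"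
        then have "s + a \<in> reduced Q" "ex (s + a) j = ex s j + ex a j"
          using reduced_add_face[of s Q a "insert j I"] Qd ex_add_face[of s a "insert j I" j] jd
          by (auto simp: reduced_def)
        then show "s + a \<in> {s \<in> reduced Q. ex s j < n}" using s a kn by (simp, linarith)
      qed
      ultimately have f'_keys: "Poly_Mapping.keys f' \<subseteq> {s \<in> reduced Q. ex s j < n}"
        unfolding f'_def by (rule keys_diff_subset)
      then obtain N q r where IH: "c j ^ N * f' = q * g j + r" "Poly_Mapping.keys q \<subseteq> reduced Q"
        "Poly_Mapping.keys r \<subseteq> reduced (insert j Q)"
        using Suc.IH[of f'] by blast
      have "c j ^ Suc N * f = c j ^ N * (c j * f)" by (simp add: algebra_simps)
      also have "\<dots> = (c j ^ N * t + q) * g j + r"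
        unfolding f'_eq using IH(1) by (simp add: algebra_simps)
      finally have "c j ^ Suc N * f = (c j ^ N * t + q) * g j + r" .
      moreover have "Poly_Mapping.keys (c j ^ N * t) \<subseteq> reduced Q"
      proof (rule keys_mult_subset[OF keys_c_power[OF j] t])
        fix a s assume "a \<in> face I" "s \<in> {s \<in> reduced Q. ex s j = n - k j}"
        then show "a + s \<in> reduced Q" using reduced_add_face[of s Q a I] Qd by (simp add: add.commute)
      qed
      ultimately show ?thesis
        using IH(2,3) keys_add_subset by blast
    qed
  qed
  moreover have "\<exists>n. \<forall>s\<in>Poly_Mapping.keys f. ex s j < n"
  proof (intro exI ballI)
    fix s assume "s \<in> Poly_Mapping.keys f"
    then show "ex s j < Suc (Max ((\<lambda>s. ex s j) ` Poly_Mapping.keys f))"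
      by (simp add: less_Suc_eq_le)
  qed
  ultimately show ?thesis using f by blast
qed

abbreviation (input) G :: "nat set \<Rightarrow> ((int ^ 'n) \<Rightarrow>\<^sub>0 'k) set" where
  "G Q \<equiv> Idl\<^bsub>semigroup_ring TYPE('k) S\<^esub> (g ` Q)"

lemma G_ideal:
  assumes "Q \<subseteq> {1..d} - I"
  shows "ideal (G Q) (semigroup_ring TYPE('k) S)"
proof -
  interpret R: cring "semigroup_ring TYPE('k) S" by (rule semigroup_ring_is_cring)
  show ?thesis by (rule R.genideal_ideal[OF g_carrier[OF assms]])
qed

lemma G_insert:
  assumes "insert j Q \<subseteq> {1..d} - I"
  shows "G (insert j Q) = {r * g j + y | r y. Poly_Mapping.keys r \<subseteq> S \<and> y \<in> G Q}"
proof -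
  interpret R: cring "semigroup_ring TYPE('k) S" by (rule semigroup_ring_is_cring)
  show ?thesis
    using R.genideal_insert[of "g j" "g ` Q"] g_carrier[OF assms] by simp
qed

text \<open>Pseudo-division by the relations one after another. The multiplier is a product of
  powers of leading coefficients, hence a nonzero polynomial in the variables of
  \<open>I\<close>.\<close>

lemma exists_reduced:
  assumes "finite Q" "Q \<subseteq> {1..d} - I" "Poly_Mapping.keys f \<subseteq> S"
  shows "\<exists>u f'. u \<noteq> 0 \<and> Poly_Mapping.keys u \<subseteq> face I \<and> Poly_Mapping.keys f' \<subseteq> reduced Q \<and> u * f - f' \<in> G Q"
  using assms(1,2)
proof (induction Q rule: finite_induct)
  case empty
  have "0 \<in> G {}" using semigroup_ideal_zero[OF affine G_ideal[of "{}"]] by simp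
  then show ?case
    using assms(3) zero_in_face by (intro exI[of _ 1] exI[of _ f]) (simp add: reduced_def)
next
  case (insert j Q)
  then have j: "j \<in> {1..d} - I" and Q: "Q \<subseteq> {1..d} - I" by auto
  obtain u f' where u: "u \<noteq> 0" "Poly_Mapping.keys u \<subseteq> face I" "Poly_Mapping.keys f' \<subseteq> reduced Q"
    "u * f - f' \<in> G Q" using insert.IH[OF Q] by blast
  obtain N q r where qr: "c j ^ N * f' = q * g j + r" "Poly_Mapping.keys q \<subseteq> reduced Q"
    "Poly_Mapping.keys r \<subseteq> reduced (insert j Q)"
    using pseudo_division[OF j Q insert.hyps(2) u(3)] by blast
  have "c j ^ N \<noteq> 0"
    by (induction N) (use c_nonzero[OF j] in \<open>simp_all add: group_algebra_mult_eq_0_iff\<close>)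
  then have "c j ^ N * u \<noteq> 0" using u(1) by (simp add: group_algebra_mult_eq_0_iff)
  moreover have "Poly_Mapping.keys (c j ^ N * u) \<subseteq> face I"
    by (rule keys_mult_subset[OF keys_c_power[OF j] u(2) face_add])
  moreover have "c j ^ N * u * f - r = q * g j + c j ^ N * (u * f - f')"
    using qr(1) by (simp add: algebra_simps)
  moreover have "c j ^ N * (u * f - f') \<in> G Q"
    using keys_c_power[OF j, of N] face_subset_S[of I]
    by (intro semigroup_ideal_mult[OF affine G_ideal[OF Q] _ u(4)]) blast
  then have "q * g j + c j ^ N * (u * f - f') \<in> G (insert j Q)"
    unfolding G_insert[OF insert.prems] using qr(2) by (auto simp: reduced_def)
  ultimately show ?case using qr(3) by metis
qed

text \<open>Uniqueness of normal forms. The induction hypothesis for \<open>Q\<close> turns the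
  membership into an equation \<open>u * f = a' * g j\<close>; a nonzero multiple of
  \<open>g j\<close> has degree at least \<open>k j\<close> in the variable \<open>j\<close>,
  whereas \<open>u * f\<close> has smaller degree.\<close>

lemma reduced_in_ideal_eq_0:
  assumes "finite Q" "Q \<subseteq> {1..d} - I" "Poly_Mapping.keys f \<subseteq> reduced Q" "f \<in> G Q"
  shows "f = 0"
  using assms
proof (induction Q arbitrary: f rule: finite_induct)
  case empty
  interpret R: cring "semigroup_ring TYPE('k) S" by (rule semigroup_ring_is_cring)
  show ?case using empty.prems R.genideal_empty by simp
next
  case (insert j Q)
  have j: "j \<in> {1..d} - I" "j \<in> {1..d}" and Q: "Q \<subseteq> {1..d} - I" using insert.prems(1) by auto
  have Qd: "Q \<subseteq> {1..d}" "I \<inter> Q = {}" "insert j I \<inter> Q = {}" using Q insert.hyps by auto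
  note G_add = semigroup_ideal_add[OF affine G_ideal[OF Q]]
    and G_mult = semigroup_ideal_mult[OF affine G_ideal[OF Q]]
  have g_S: "Poly_Mapping.keys (g j) \<subseteq> S" using g_keys[OF j(1)] face_subset_S by blast
  obtain a y where a: "f = a * g j + y" "Poly_Mapping.keys a \<subseteq> S" "y \<in> G Q"
    using insert.prems(3) unfolding G_insert[OF insert.prems(1)] by blast
  obtain u a' where u: "u \<noteq> 0" "Poly_Mapping.keys u \<subseteq> face I" "Poly_Mapping.keys a' \<subseteq> reduced Q"
    "u * a - a' \<in> G Q" using exists_reduced[OF insert.hyps(1) Q a(2)] by blast
  have u_S: "Poly_Mapping.keys u \<subseteq> S" using u(2) face_subset_S by blast
  have uf_keys: "Poly_Mapping.keys (u * f) \<subseteq> reduced Q \<inter> {s. ex s j < k j}"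
  proof (rule keys_mult_subset[OF u(2) insert.prems(2)])
    fix b s assume b: "b \<in> face I" and s: "s \<in> reduced (insert j Q)"
    then have s': "s \<in> reduced Q" "s \<in> S" "ex s j < k j" by (auto simp: reduced_def)
    show "b + s \<in> reduced Q \<inter> {s. ex s j < k j}"
      using reduced_add_face[OF s'(1) b] Qd ex_add_face[OF s'(2) b j(2)] ex_face[OF b j(2)] j(1) s'(3)
      by (simp add: add.commute)
  qed
  \<comment> \<open>The coefficient \<open>u * a\<close> may be replaced by its normal form
    \<open>a'\<close> modulo \<open>G Q\<close>, after which both products are reduced for
    \<open>Q\<close>.\<close>
  have "u * f - a' * g j = g j * (u * a - a') + u * y" using a(1) by (simp add: algebra_simps)
  also have "\<dots> \<in> G Q" by (intro G_add G_mult g_S u_S u(4) a(3))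
  finally have "u * f - a' * g j \<in> G Q" .
  moreover have "Poly_Mapping.keys (a' * g j) \<subseteq> reduced Q"
    by (rule keys_mult_subset[OF u(3) g_keys[OF j(1)]]) (use reduced_add_face Qd in blast)
  then have "Poly_Mapping.keys (u * f - a' * g j) \<subseteq> reduced Q"
    using uf_keys by (intro keys_diff_subset) auto
  ultimately have "u * f - a' * g j = 0" using insert.IH[OF Q] by blast
  then have eq: "u * f = a' * g j" by simp
  have "a' = 0"
  proof (rule ccontr)
    assume "a' \<noteq> 0"
    then have ne: "Poly_Mapping.keys a' \<noteq> {}" by (simp add: keys_empty_iff)
    have a'_S: "Poly_Mapping.keys a' \<subseteq> S" using u(3) by (auto simp: reduced_def)
    define n where "n = Max ((\<lambda>s. ex s j) ` Poly_Mapping.keys a')"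
    have le: "ex s j \<le> n" if "s \<in> Poly_Mapping.keys a'" for s
      unfolding n_def using that by (intro Max_ge) auto
    have "n \<in> (\<lambda>s. ex s j) ` Poly_Mapping.keys a'"
      unfolding n_def using ne by (intro Max_in) auto
    then obtain s where s: "s \<in> Poly_Mapping.keys a'" "ex s j = n" by blast
    define top where "top = part (\<lambda>s. ex s j = n) a'"
    define T where "T = Poly_Mapping.single (int (k j) *s e j) 1 * c j"
    have "s \<in> Poly_Mapping.keys top" using s by (simp add: top_def keys_part)
    then have "top \<noteq> 0" by auto
    moreover have "T \<noteq> 0"
    proof -
      have "Poly_Mapping.single (int (k j) *s e j) (1 :: 'k) \<noteq> 0"
        by (metis insert_not_empty keys_single keys_zero one_neq_zero)
      then show ?thesis using c_nonzero[OF j(1)] by (simp add: T_def group_algebra_mult_eq_0_iff)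
    qed
    ultimately have "top * T \<noteq> 0" by (simp add: group_algebra_mult_eq_0_iff)
    have top_keys: "Poly_Mapping.keys top \<subseteq> {s \<in> S. ex s j = n}"
      using a'_S by (auto simp: top_def keys_part)
    have low_keys: "Poly_Mapping.keys (a' - top) \<subseteq> {s \<in> S. ex s j < n}"
      unfolding top_def keys_diff_part using a'_S le by (auto simp: less_le)
    have T_keys: "Poly_Mapping.keys T \<subseteq> {b \<in> face (insert j I). ex b j = k j}"
    proof
      fix b assume "b \<in> Poly_Mapping.keys T"
      then obtain b' where b': "b' \<in> Poly_Mapping.keys (c j)" "b = b' + int (k j) *s e j"
        unfolding T_def keys_single_mult by auto
      have b'f: "b' \<in> face I" using b' c_keys[OF j(1)] by blast
      have kf: "int (k j) *s e j \<in> face (insert j I)"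
        unfolding scale_eq_mon[OF j(2)] face_def by (intro CollectI exI[of _ "\<lambda>i. if i = j then k j else 0"]) auto
      have "b \<in> face (insert j I)"
        unfolding b'(2) using b'f face_mono[of I "insert j I"] kf by (intro face_add) auto
      moreover have "ex b j = k j"
        unfolding b'(2) scale_eq_mon[OF j(2)]
        using ex_add_mon[OF _ j(2), of b'] b'f face_subset_S[of I] j ex_face[OF b'f j(2)] by auto
      ultimately show "b \<in> {b \<in> face (insert j I). ex b j = k j}" by simp
    qed
    have add_ex: "ex (s + b) j = ex s j + ex b j" if "s \<in> S" "b \<in> face (insert j I)" for s b
      using ex_add_face[OF that j(2)] .
    have g_split: "g j = T + g' j" using g_eq[OF j(1)] by (simp add: T_def)
    have g_ex: "Poly_Mapping.keys (g j) \<subseteq> {b \<in> face (insert j I). ex b j \<le> k j}"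
      unfolding g_split using T_keys g'_keys[OF j(1)] by (intro keys_add_subset) auto
    \<comment> \<open>All terms of \<open>top * T\<close> have exponent \<open>n + k j\<close> in
      the variable \<open>j\<close>; every term on the right, including those of
      \<open>u * f\<close>, has a smaller one.\<close>
    have "top * T = u * f - ((a' - top) * g j + top * g' j)"
      unfolding eq g_split by (simp add: algebra_simps)
    moreover have "Poly_Mapping.keys ((a' - top) * g j) \<subseteq> {s. ex s j < n + k j}"
      by (rule keys_mult_subset[OF low_keys g_ex]) (auto simp: add_ex)
    moreover have "Poly_Mapping.keys (top * g' j) \<subseteq> {s. ex s j < n + k j}"
      by (rule keys_mult_subset[OF top_keys g'_keys[OF j(1)]]) (auto simp: add_ex)
    moreover have "Poly_Mapping.keys (u * f) \<subseteq> {s. ex s j < n + k j}" using uf_keys by auto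
    ultimately have "Poly_Mapping.keys (top * T) \<subseteq> {s. ex s j < n + k j}"
      by (simp only: keys_diff_subset keys_add_subset)
    moreover have "Poly_Mapping.keys (top * T) \<subseteq> {s. ex s j = n + k j}"
      by (rule keys_mult_subset[OF top_keys T_keys]) (auto simp: add_ex)
    ultimately have "Poly_Mapping.keys (top * T) = {}" by fastforce
    then show False using \<open>top * T \<noteq> 0\<close> by (simp add: keys_empty_iff)
  qed
  then have "u * f = 0" using eq by simp
  then show "f = 0" using u(1) by (simp add: group_algebra_mult_eq_0_iff)
qed

text \<open>At the price of a multiplier, \<open>r\<close> is replaced by its normal form
  \<open>r'\<close>. The product \<open>r' * g j\<close> is still reduced for \<open>Q\<close>, as
  \<open>g j\<close> does not involve those variables, so it is zero, and \<open>r'\<close> vanishes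
  because the group algebra is a domain.\<close>

lemma regular:
  assumes j: "j \<in> {1..d} - I" and Q: "Q \<subseteq> {1..d} - I" "j \<notin> Q"
    and r: "Poly_Mapping.keys r \<subseteq> S" "g j * r \<in> G Q"
  shows "\<exists>u. u \<noteq> 0 \<and> Poly_Mapping.keys u \<subseteq> face I \<and> u * r \<in> G Q"
proof -
  have fin: "finite Q" using Q(1) by (rule finite_subset) simp
  note G_diff = semigroup_ideal_diff[OF affine G_ideal[OF Q(1)]]
    and G_mult = semigroup_ideal_mult[OF affine G_ideal[OF Q(1)]]
  obtain u r' where u: "u \<noteq> 0" "Poly_Mapping.keys u \<subseteq> face I" "Poly_Mapping.keys r' \<subseteq> reduced Q"
    "u * r - r' \<in> G Q" using exists_reduced[OF fin Q(1) r(1)] by blast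
  have u_S: "Poly_Mapping.keys u \<subseteq> S" using u(2) face_subset_S by blast
  have g_S: "Poly_Mapping.keys (g j) \<subseteq> S" using g_keys[OF j] face_subset_S by blast
  have "r' * g j = u * (g j * r) - g j * (u * r - r')" by (simp add: algebra_simps)
  also have "\<dots> \<in> G Q" by (intro G_diff G_mult u_S g_S r(2) u(4))
  finally have "r' * g j \<in> G Q" .
  moreover have "Poly_Mapping.keys (r' * g j) \<subseteq> reduced Q"
    by (rule keys_mult_subset[OF u(3) g_keys[OF j]], rule reduced_add_face) (use Q j in auto)
  ultimately have "r' * g j = 0" using reduced_in_ideal_eq_0[OF fin Q(1)] by blast
  then have "r' = 0" using g_nonzero[OF j] by (simp add: group_algebra_mult_eq_0_iff)
  then show ?thesis using u by auto
qed

end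

section \<open>Cohen-Macaulayness of the free semigroup ring\<close>

context free_semigroup
begin

text \<open>The empty set of variables qualifies because a prime contains no nonzero constant, and
  there are finitely many candidates.\<close>

lemma exists_maximal_face:
  fixes p :: "((int ^ 'n) \<Rightarrow>\<^sub>0 'k::field) set"
  assumes p: "primeideal p (semigroup_ring TYPE('k) S)"
  obtains I where "I \<subseteq> {1..d}" "\<And>f. f \<in> p \<Longrightarrow> Poly_Mapping.keys f \<subseteq> face I \<Longrightarrow> f = 0"
    "\<And>j. j \<in> {1..d} - I \<Longrightarrow> \<exists>g\<in>p. Poly_Mapping.keys g \<subseteq> face (insert j I) \<and> g \<noteq> 0"
proof -
  have idp: "ideal p (semigroup_ring TYPE('k) S)" using p by (rule primeideal.axioms(1))
  define A where "A = {I. I \<subseteq> {1..d} \<and> (\<forall>f\<in>p. Poly_Mapping.keys f \<subseteq> face I \<longrightarrow> f = 0)}"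
  have "finite A" by (rule finite_subset[of _ "Pow {1..d}"]) (auto simp: A_def)
  moreover have "{} \<in> A"
  proof -
    have "f = 0" if f: "f \<in> p" "Poly_Mapping.keys f \<subseteq> face {}" for f
    proof (rule ccontr)
      assume "f \<noteq> 0"
      have "face {} \<subseteq> {0}" by (auto simp: face_def mon_def)
      then have keys: "Poly_Mapping.keys f \<subseteq> {0}" using f(2) by blast
      define x where "x = Poly_Mapping.lookup f 0"
      have fx: "f = Poly_Mapping.single 0 x"
        using keys by (intro poly_mapping_eqI) (auto simp: x_def lookup_single when_def in_keys_iff subset_iff)
      then have "x \<noteq> 0" using \<open>f \<noteq> 0\<close> by auto
      then have "Poly_Mapping.single 0 (1 / x) * f = 1" by (simp add: fx mult_single)
      moreover have "Poly_Mapping.single 0 (1 / x) * f \<in> p"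
        using S_zero by (intro semigroup_ideal_mult[OF affine idp _ f(1)]) simp
      ultimately show False using semigroup_ideal_one_notin[OF p] by simp
    qed
    then show ?thesis by (simp add: A_def)
  qed
  ultimately obtain I where I: "I \<in> A" "\<And>J. J \<in> A \<Longrightarrow> I \<subseteq> J \<Longrightarrow> I = J"
    using finite_has_maximal[of A] by blast
  show thesis
  proof (rule that)
    show "I \<subseteq> {1..d}" "\<And>f. f \<in> p \<Longrightarrow> Poly_Mapping.keys f \<subseteq> face I \<Longrightarrow> f = 0"
      using I(1) by (auto simp: A_def)
    fix j assume j: "j \<in> {1..d} - I"
    then have "insert j I \<notin> A" using I(2)[of "insert j I"] by blast
    then show "\<exists>g\<in>p. Poly_Mapping.keys g \<subseteq> face (insert j I) \<and> g \<noteq> 0"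
      using j I(1) by (auto simp: A_def)
  qed
qed

theorem semigroup_ring_cohen_macaulay: "cohen_macaulay (semigroup_ring TYPE('k::field) S)"
  unfolding cohen_macaulay_def
proof (intro conjI allI impI)
  show "cring (semigroup_ring TYPE('k) S)" by (rule semigroup_ring_is_cring)
  show noeth: "noetherian_ring (semigroup_ring TYPE('k) S)" by (rule semigroup_ring_noetherian)
  fix p assume p: "primeideal p (semigroup_ring TYPE('k) S)"
  obtain I where Imax: "I \<subseteq> {1..d}" "\<And>f. f \<in> p \<Longrightarrow> Poly_Mapping.keys f \<subseteq> face I \<Longrightarrow> f = 0"
    "\<And>j. j \<in> {1..d} - I \<Longrightarrow> \<exists>g\<in>p. Poly_Mapping.keys g \<subseteq> face (insert j I) \<and> g \<noteq> 0"
    using exists_maximal_face[OF p] by metis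
  define \<Phi> where "\<Phi> j g k c g' \<longleftrightarrow> g \<in> p \<and> g = Poly_Mapping.single (int k *s e j) 1 * c + g' \<and>
      Poly_Mapping.keys c \<subseteq> face I \<and> c \<noteq> 0 \<and>
      Poly_Mapping.keys g' \<subseteq> {a \<in> face (insert j I). ex a j < k}" for j g k c g'
  have "\<exists>g k c g'. \<Phi> j g k c g'" if j: "j \<in> {1..d} - I" for j
  proof -
    obtain g where "g \<in> p" "g \<noteq> 0" "Poly_Mapping.keys g \<subseteq> face (insert j I)" using Imax(3)[OF j] by blast
    then show ?thesis unfolding \<Phi>_def using face_lead_decomposition[of j I g] j by blast
  qed
  then obtain g k c g' where g: "\<And>j. j \<in> {1..d} - I \<Longrightarrow> \<Phi> j (g j) (k j) (c j) (g' j)" by metis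
  interpret regular_family d e lam H S I g c g' k
    by unfold_locales (use Imax(1) g in \<open>simp_all add: \<Phi>_def\<close>)
  \<comment> \<open>One relation for each variable outside \<open>I\<close>, so the sequence has
    length \<open>d - card I\<close>, the bound for chains ending inside \<open>p\<close>.\<close>
  define js where "js = sorted_list_of_set ({1..d} - I)"
  have js: "set js = {1..d} - I" "distinct js" "length js = d - card I"
    using Imax(1) by (auto simp: js_def card_Diff_subset finite_subset)
  interpret p: primeideal p "semigroup_ring TYPE('k) S" by (rule p)
  show "cohen_macaulay_local (localization (semigroup_ring TYPE('k) S) p)"
  proof (rule p.cohen_macaulay_localizationI[OF noeth])
    have "g j \<in> p" if "j \<in> {1..d} - I" for j using g[OF that] unfolding \<Phi>_def by (rule conjunct1)
    then show "set (map g js) \<subseteq> p" using js(1) by auto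
  next
    fix i r assume i: "i < length (map g js)" and r: "r \<in> carrier (semigroup_ring TYPE('k) S)"
      and mem: "map g js ! i \<otimes>\<^bsub>semigroup_ring TYPE('k) S\<^esub> r \<in> Idl\<^bsub>semigroup_ring TYPE('k) S\<^esub> set (take i (map g js))"
    let ?Q = "set (take i js)"
    have eq: "set (take i (map g js)) = g ` ?Q" by (simp add: take_map)
    have "?Q \<subseteq> {1..d} - I" using set_take_subset[of i js] js(1) by simp
    moreover have "js ! i \<in> {1..d} - I" using i js(1) nth_mem[of i js] by simp
    moreover have "js ! i \<notin> ?Q"
      using i js(2) by (auto simp: in_set_conv_nth nth_eq_iff_index_eq)
    ultimately obtain u where u: "u \<noteq> 0" "Poly_Mapping.keys u \<subseteq> face I" "u * r \<in> G ?Q"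
      using regular[of "js ! i" ?Q r] i r mem unfolding eq by auto
    \<comment> \<open>The multiplier is a nonzero polynomial in the variables of \<open>I\<close>,
      which are independent modulo \<open>p\<close>; so it becomes a unit in the
      localization.\<close>
    have "u \<notin> p" using Imax(2) u by blast
    moreover have "Poly_Mapping.keys u \<subseteq> S" using u(2) face_subset_S by blast
    ultimately show "\<exists>u\<in>carrier (semigroup_ring TYPE('k) S) - p.
        u \<otimes>\<^bsub>semigroup_ring TYPE('k) S\<^esub> r \<in> Idl\<^bsub>semigroup_ring TYPE('k) S\<^esub> set (take i (map g js))"
      using u(3) unfolding eq by (intro bexI[of _ u]) auto
  next
    fix P n assume P: "\<forall>i\<le>n. primeideal (P i) (semigroup_ring TYPE('k) S)" "\<forall>i<n. P i \<subset> P (Suc i)" "P n \<subseteq> p"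
    have "n + card I \<le> d" by (rule prime_chain_length_le[OF P(1,2) Imax(1)]) (use Imax(2) P(3) in blast)
    then show "n \<le> length (map g js)" using js(3) by simp
  qed
qed

end

section \<open>Simplicial affine semigroups\<close>

lemma rat_cone_iff:
  assumes "simplicial_gens B d e"
  shows "v \<in> rat_cone (rat_vec ` B) \<longleftrightarrow>
    (\<exists>c. (\<forall>i\<in>{1..d}. 0 \<le> c i) \<and> v = (\<Sum>i = 1..d. c i *s rat_vec (e i)))"
proof -
  let ?f = "\<lambda>i. rat_vec (e i)"
  have inj: "inj_on ?f {1..d}"
    using assms unfolding simplicial_gens_def inj_on_def rat_vec_eq_iff by blast
  have cone: "rat_cone (rat_vec ` B) = rat_cone (?f ` {1..d})"
    using assms by (simp add: simplicial_gens_def image_image)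
  show ?thesis
    unfolding cone
  proof
    assume "v \<in> rat_cone (?f ` {1..d})"
    then obtain F c where F: "finite F" "F \<subseteq> ?f ` {1..d}" "\<forall>y\<in>F. 0 \<le> c y" "v = (\<Sum>y\<in>F. c y *s y)"
      unfolding rat_cone_def by blast
    have "v = (\<Sum>y\<in>?f ` {1..d}. (if y \<in> F then c y else 0) *s y)"
      unfolding F(4) using F(1,2) by (intro sum.mono_neutral_cong_left) auto
    also have "\<dots> = (\<Sum>i = 1..d. (if ?f i \<in> F then c (?f i) else 0) *s ?f i)"
      unfolding sum.reindex[OF inj] by simp
    finally show "\<exists>c. (\<forall>i\<in>{1..d}. 0 \<le> c i) \<and> v = (\<Sum>i = 1..d. c i *s ?f i)"
      using F(3) by (intro exI[of _ "\<lambda>i. if ?f i \<in> F then c (?f i) else 0"]) auto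
  next
    assume "\<exists>c. (\<forall>i\<in>{1..d}. 0 \<le> c i) \<and> v = (\<Sum>i = 1..d. c i *s ?f i)"
    then obtain c where c: "\<forall>i\<in>{1..d}. 0 \<le> c i" "v = (\<Sum>i = 1..d. c i *s ?f i)" by blast
    define c' where "c' = (\<lambda>y. c (inv_into {1..d} ?f y))"
    have c': "c' (?f i) = c i" if "i \<in> {1..d}" for i
      using inv_into_f_f[OF inj that] by (simp add: c'_def)
    have "v = (\<Sum>y\<in>?f ` {1..d}. c' y *s y)"
      unfolding c(2) sum.reindex[OF inj] using c' by (intro sum.cong) auto
    then show "v \<in> rat_cone (?f ` {1..d})"
      unfolding rat_cone_def using c(1) c' by (intro CollectI exI[of _ "?f ` {1..d}"] exI[of _ c']) auto
  qed
qed

lemma rat_cone_mono: "X \<subseteq> Y \<Longrightarrow> rat_cone X \<subseteq> rat_cone Y"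
  unfolding rat_cone_def by blast

lemma rat_cone_base: "v \<in> X \<Longrightarrow> v \<in> rat_cone X"
  unfolding rat_cone_def by (intro CollectI exI[of _ "{v}"] exI[of _ "\<lambda>_. 1"]) auto

lemma rat_cone_add_scale:
  assumes S: "simplicial_gens B d e" and v: "v \<in> rat_cone (rat_vec ` B)" and w: "w \<in> rat_cone (rat_vec ` B)"
    and r: "0 \<le> r"
  shows "r *s v + w \<in> rat_cone (rat_vec ` B)"
proof -
  obtain a b where a: "\<forall>i\<in>{1..d}. 0 \<le> a i" "v = (\<Sum>i = 1..d. a i *s rat_vec (e i))"
    and b: "\<forall>i\<in>{1..d}. 0 \<le> b i" "w = (\<Sum>i = 1..d. b i *s rat_vec (e i))"
    using v w unfolding rat_cone_iff[OF S] by blast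
  have "r *s v + w = (\<Sum>i = 1..d. (r * a i + b i) *s rat_vec (e i))"
    unfolding a b by (simp add: vec.scale_sum_right vector_smult_assoc vector_sadd_rdistrib sum.distrib)
  then show ?thesis
    unfolding rat_cone_iff[OF S] using a b r by (intro exI[of _ "\<lambda>i. r * a i + b i"]) simp
qed

lemma rat_cone_zero: "0 \<in> rat_cone X"
  unfolding rat_cone_def by (intro CollectI exI[of _ "{}"]) simp

text \<open>A set between \<open>B\<close> and its cone spans the same cone. Thus the same
  generators serve for a competitor \<open>B'\<close>, and the results about \<open>B\<close> can be
  applied to it.\<close>

lemma simplicial_gens_extend:
  assumes S: "simplicial_gens B d e" and B': "B \<subseteq> B'" "rat_vec ` B' \<subseteq> rat_cone (rat_vec ` B)"
  shows "simplicial_gens B' d e"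
proof -
  have "v \<in> rat_cone (rat_vec ` B)" if v: "v \<in> rat_cone (rat_vec ` B')" for v
  proof -
    obtain F c where F: "finite F" "F \<subseteq> rat_vec ` B'" "\<forall>x\<in>F. 0 \<le> c x" "v = (\<Sum>x\<in>F. c x *s x)"
      using v unfolding rat_cone_def by blast
    have "(\<Sum>x\<in>F. c x *s x) \<in> rat_cone (rat_vec ` B)"
      using F(1-3)
    proof (induction F rule: finite_induct)
      case (insert x F)
      then show ?case using rat_cone_add_scale[OF S, of x "\<Sum>x\<in>F. c x *s x" "c x"] B'(2) by auto
    qed (simp add: rat_cone_zero)
    then show ?thesis using F(4) by simp
  qed
  moreover have "rat_cone (rat_vec ` B) \<subseteq> rat_cone (rat_vec ` B')"
    using B'(1) by (intro rat_cone_mono) auto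
  ultimately show ?thesis using S B'(1) unfolding simplicial_gens_def by blast
qed

section \<open>Coordinates with respect to the generators\<close>

locale simplicial_semigroup =
  fixes B :: "(int ^ 'n) set" and d :: nat and e :: "nat \<Rightarrow> int ^ 'n"
  assumes affine: "affine_semigroup B" and simplicial: "simplicial_gens B d e"
begin

text \<open>Extending the basis \<open>e\<^sub>1, \<dots>, e\<^sub>d\<close> makes the coordinates additive on all of \<open>\<int>\<^sup>n\<close>.\<close>

definition basis :: "(rat ^ 'n) set" where
  "basis = vec.extend_basis (rat_vec ` e ` {1..d})"

definition lam :: "nat \<Rightarrow> int ^ 'n \<Rightarrow> rat" where
  "lam i x = vec.representation basis (rat_vec x) (rat_vec (e i))"

lemma
  shows basis_independent: "vec.independent basis" and basis_span: "v \<in> vec.span basis"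
    and e_in_basis: "i \<in> {1..d} \<Longrightarrow> rat_vec (e i) \<in> basis"
proof -
  have indep: "vec.independent (rat_vec ` e ` {1..d})"
    using simplicial unfolding simplicial_gens_def by blast
  show "vec.independent basis" unfolding basis_def by (rule vec.independent_extend_basis[OF indep])
  show "v \<in> vec.span basis" unfolding basis_def vec.span_extend_basis[OF indep] ..
  show "i \<in> {1..d} \<Longrightarrow> rat_vec (e i) \<in> basis"
    unfolding basis_def using vec.extend_basis_superset[OF indep] by blast
qed

lemma lam_add: "lam i (x + y) = lam i x + lam i y"
  using fun_cong[OF vec.representation_add[OF basis_independent basis_span basis_span]]
  by (simp add: lam_def)

lemma lam_eqI:
  assumes "rat_vec x = (\<Sum>j = 1..d. c j *s rat_vec (e j))" "i \<in> {1..d}"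
  shows "lam i x = c i"
proof -
  have inj: "inj_on (\<lambda>i. rat_vec (e i)) {1..d}"
    using simplicial unfolding simplicial_gens_def inj_on_def rat_vec_eq_iff by blast
  have base: "vec.representation basis (rat_vec (e j)) (rat_vec (e i)) = (if j = i then 1 else 0)"
    if "j \<in> {1..d}" for j
    using vec.representation_basis[OF basis_independent e_in_basis[OF that]]
      inj_onD[OF inj, of j i] that assms(2) by auto
  have "lam i x = (\<Sum>j = 1..d. vec.representation basis (c j *s rat_vec (e j)) (rat_vec (e i)))"
    unfolding lam_def assms(1)
    using fun_cong[OF vec.representation_sum[OF basis_independent basis_span]] by blast
  also have "\<dots> = (\<Sum>j = 1..d. c j * vec.representation basis (rat_vec (e j)) (rat_vec (e i)))"
    using fun_cong[OF vec.representation_scale[OF basis_independent basis_span]] by simp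
  also have "\<dots> = (\<Sum>j = 1..d. if j = i then c j else 0)" using base by (intro sum.cong) auto
  also have "\<dots> = c i" using assms(2) by simp
  finally show ?thesis .
qed

lemma lam_diff: "lam i (x - y) = lam i x - lam i y"
  using lam_add[of i "x - y" y] by simp

lemma lam_zero: "lam i 0 = 0"
  using lam_add[of i 0 0] by simp

definition comb :: "(nat \<Rightarrow> int) \<Rightarrow> int ^ 'n" where
  "comb z = (\<Sum>i = 1..d. z i *s e i)"

lemma lam_comb: "i \<in> {1..d} \<Longrightarrow> lam i (comb z) = of_int (z i)"
  by (rule lam_eqI) (simp add: comb_def rat_vec_sum)

lemma comb_add: "comb (\<lambda>i. z i + z' i) = comb z + comb z'"
  by (simp add: comb_def vector_sadd_rdistrib sum.distrib)

lemma comb_diff: "comb (\<lambda>i. z i - z' i) = comb z - comb z'"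
  by (simp add: comb_def vector_sub_rdistrib sum_subtractf)

lemma comb_cong: "(\<And>i. i \<in> {1..d} \<Longrightarrow> z i = z' i) \<Longrightarrow> comb z = comb z'"
  unfolding comb_def by (intro sum.cong) auto

definition ncomb :: "(nat \<Rightarrow> nat) \<Rightarrow> int ^ 'n" where
  "ncomb m = comb (\<lambda>i. int (m i))"

lemma lam_ncomb: "i \<in> {1..d} \<Longrightarrow> lam i (ncomb m) = of_nat (m i)"
  by (simp add: ncomb_def lam_comb)

lemma ncomb_zero: "ncomb (\<lambda>_. 0) = 0"
  by (simp add: ncomb_def comb_def)

lemma ncomb_add: "ncomb (\<lambda>i. m i + m' i) = ncomb m + ncomb m'"
  by (simp add: ncomb_def comb_add)

lemma ncomb_cong: "(\<And>i. i \<in> {1..d} \<Longrightarrow> m i = m' i) \<Longrightarrow> ncomb m = ncomb m'"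
  unfolding ncomb_def by (intro comb_cong) simp

lemma e_eq_ncomb:
  assumes "j \<in> {1..d}"
  shows "e j = ncomb (\<lambda>i. if i = j then 1 else 0)"
proof -
  have "ncomb (\<lambda>i. if i = j then 1 else 0) = (\<Sum>i = 1..d. if i = j then e i else 0)"
    unfolding ncomb_def comb_def by (intro sum.cong) auto
  then show ?thesis using assms by simp
qed

lemma lam_e: "i \<in> {1..d} \<Longrightarrow> j \<in> {1..d} \<Longrightarrow> lam i (e j) = (if i = j then 1 else 0)"
  by (simp add: e_eq_ncomb lam_ncomb)

lemma e_in_B: "j \<in> {1..d} \<Longrightarrow> e j \<in> B"
  using simplicial by (auto simp: simplicial_gens_def)

lemma monoid_closure_e: "monoid_closure (e ` {1..d}) = range ncomb"
proof (intro equalityI subsetI)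
  fix x assume "x \<in> monoid_closure (e ` {1..d})"
  then show "x \<in> range ncomb"
  proof (induction rule: monoid_closure.induct)
    case zero
    show ?case using ncomb_zero by (metis rangeI)
  next
    case (base x)
    then show ?case using e_eq_ncomb by blast
  next
    case (add x y)
    then obtain m m' where "x = ncomb m" "y = ncomb m'" by blast
    then show ?case using ncomb_add[of m m'] by (metis rangeI)
  qed
next
  fix x assume "x \<in> range ncomb"
  then obtain m where m: "x = ncomb m" by blast
  show "x \<in> monoid_closure (e ` {1..d})"
    unfolding m ncomb_def comb_def by (intro monoid_closure_sum monoid_closure_scale monoid_closure.base imageI)
qed

lemma ncomb_in_B: "ncomb m \<in> B"
proof -
  obtain X where X: "B = monoid_closure X" using affine by (auto simp: affine_semigroup_def)
  have "monoid_closure (e ` {1..d}) \<subseteq> B"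
    unfolding X by (rule monoid_closure_subset) (use e_in_B X in auto)
  then show ?thesis using monoid_closure_e by blast
qed

lemma B_add: "x \<in> B \<Longrightarrow> y \<in> B \<Longrightarrow> x + y \<in> B"
  by (rule affine_semigroup_add[OF affine])

lemma rat_vec_B: "x \<in> B \<Longrightarrow> rat_vec x = (\<Sum>i = 1..d. lam i x *s rat_vec (e i))"
  and lam_eq_coord: "x \<in> B \<Longrightarrow> i \<in> {1..d} \<Longrightarrow> lam i x = coord d e i x"
  and lam_nonneg: "x \<in> B \<Longrightarrow> i \<in> {1..d} \<Longrightarrow> 0 \<le> lam i x"
proof -
  assume x: "x \<in> B"
  show *: "lam i x = coord d e i x" if "i \<in> {1..d}" for i
    using lam_eqI[OF simplicial_repr(1)[OF simplicial x] that] .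
  show "rat_vec x = (\<Sum>i = 1..d. lam i x *s rat_vec (e i))"
    using simplicial_repr(1)[OF simplicial x] * by simp
  show "0 \<le> lam i x" if "i \<in> {1..d}" for i
    using simplicial_repr(2)[OF simplicial x] * that by simp
qed

subsection \<open>Cohen--Macaulayness forces intersections of translates\<close>

lemma single_power: "Poly_Mapping.single s (1 :: 'k::field) ^ k = Poly_Mapping.single (int k *s s) 1"
proof (induction k)
  case (Suc k)
  have "int (Suc k) *s s = s + int k *s s" by (simp add: vec_eq_iff distrib_right)
  then show ?case using Suc by (simp add: mult_single)
qed simp

text \<open>The prime of the facet where coordinate \<open>i\<close> vanishes. If neither
  \<open>f\<close> nor \<open>g\<close> is in it, both have a nonzero part on that facet, and the
  product of these parts is nonzero.\<close>

lemma lam_primeideal: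
  assumes i: "i \<in> {1..d}"
  shows "primeideal {f. Poly_Mapping.keys f \<subseteq> {s \<in> B. 0 < lam i s}} (semigroup_ring TYPE('k::field) B)"
    (is "primeideal ?q ?R")
proof (rule primeidealI)
  show "ideal ?q ?R"
  proof (rule semigroup_idealI[OF affine])
    fix f g :: "(int ^ 'n) \<Rightarrow>\<^sub>0 'k"
    show "f + g \<in> ?q" if "f \<in> ?q" "g \<in> ?q" using that keys_add_subset[of f _ g] by simp
    show "g * f \<in> ?q" if "Poly_Mapping.keys g \<subseteq> B" "f \<in> ?q"
    proof -
      have "Poly_Mapping.keys (g * f) \<subseteq> {s \<in> B. 0 < lam i s}"
        by (rule keys_mult_subset[of _ B _ "{s \<in> B. 0 < lam i s}"])
          (use that B_add lam_nonneg[OF _ i] in \<open>auto simp: lam_add add_nonneg_pos\<close>)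
      then show ?thesis by simp
    qed
  qed auto
  show "cring ?R" by (rule semigroup_ring_cring[OF affine])
  have "(1 :: (int ^ 'n) \<Rightarrow>\<^sub>0 'k) \<in> carrier ?R" "(1 :: (int ^ 'n) \<Rightarrow>\<^sub>0 'k) \<notin> ?q"
    using affine_semigroup_zero[OF affine] by (auto simp: lam_zero)
  then show "carrier ?R \<noteq> ?q" by blast
  fix f g :: "(int ^ 'n) \<Rightarrow>\<^sub>0 'k"
  assume f: "f \<in> carrier ?R" and g: "g \<in> carrier ?R" and fg: "f \<otimes>\<^bsub>?R\<^esub> g \<in> ?q"
  show "f \<in> ?q \<or> g \<in> ?q"
  proof (rule ccontr)
    assume not: "\<not> (f \<in> ?q \<or> g \<in> ?q)"
    let ?P = "\<lambda>s. lam i s = 0"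
    have low: "part ?P h \<noteq> 0" "Poly_Mapping.keys (part ?P h) \<subseteq> {s \<in> B. lam i s = 0}"
      "Poly_Mapping.keys (h - part ?P h) \<subseteq> {s \<in> B. 0 < lam i s}"
      if h: "Poly_Mapping.keys h \<subseteq> B" "h \<notin> ?q" for h :: "(int ^ 'n) \<Rightarrow>\<^sub>0 'k"
    proof -
      obtain s where "s \<in> Poly_Mapping.keys h" "\<not> 0 < lam i s" using h by auto
      then have "s \<in> Poly_Mapping.keys (part ?P h)"
        using lam_nonneg[OF _ i, of s] h(1) by (auto simp: keys_part)
      then show "part ?P h \<noteq> 0" by auto
      show "Poly_Mapping.keys (part ?P h) \<subseteq> {s \<in> B. lam i s = 0}" using h by (auto simp: keys_part)
      show "Poly_Mapping.keys (h - part ?P h) \<subseteq> {s \<in> B. 0 < lam i s}"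
        unfolding keys_diff_part using h lam_nonneg[OF _ i] by (fastforce simp: less_le)
    qed
    define f0 g0 where "f0 = part ?P f" and "g0 = part ?P g"
    have f0: "f0 \<noteq> 0" "Poly_Mapping.keys f0 \<subseteq> {s \<in> B. lam i s = 0}"
        "Poly_Mapping.keys (f - f0) \<subseteq> {s \<in> B. 0 < lam i s}"
      and g0: "g0 \<noteq> 0" "Poly_Mapping.keys g0 \<subseteq> {s \<in> B. lam i s = 0}"
        "Poly_Mapping.keys (g - g0) \<subseteq> {s \<in> B. 0 < lam i s}"
      unfolding f0_def g0_def using low[of f] low[of g] f g not by auto
    have g_keys: "Poly_Mapping.keys g \<subseteq> B" using g by simp
    \<comment> \<open>Every term on the right has positive coordinate \<open>i\<close>, every term
      on the left has coordinate zero, so both sides vanish.\<close>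
    have "f0 * g0 = f * g - (f0 * (g - g0) + (f - f0) * g)" by (simp add: algebra_simps)
    moreover have "Poly_Mapping.keys (f0 * (g - g0)) \<subseteq> {s \<in> B. 0 < lam i s}"
      by (rule keys_mult_subset[OF f0(2) g0(3)]) (use B_add in \<open>auto simp: lam_add\<close>)
    moreover have "Poly_Mapping.keys ((f - f0) * g) \<subseteq> {s \<in> B. 0 < lam i s}"
      by (rule keys_mult_subset[OF f0(3) g_keys])
        (use B_add lam_nonneg[OF _ i] in \<open>auto simp: lam_add add_pos_nonneg\<close>)
    moreover have "Poly_Mapping.keys (f * g) \<subseteq> {s \<in> B. 0 < lam i s}" using fg by simp
    ultimately have "Poly_Mapping.keys (f0 * g0) \<subseteq> {s \<in> B. 0 < lam i s}"
      by (simp only: keys_diff_subset keys_add_subset)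
    moreover have "Poly_Mapping.keys (f0 * g0) \<subseteq> {s \<in> B. lam i s = 0}"
      by (rule keys_mult_subset[OF f0(2) g0(2)]) (use B_add in \<open>auto simp: lam_add\<close>)
    ultimately have "Poly_Mapping.keys (f0 * g0) = {}" by fastforce
    then show False using f0(1) g0(1) by (simp add: keys_empty_iff group_algebra_mult_eq_0_iff)
  qed
qed

lemma zero_primeideal: "primeideal {0} (semigroup_ring TYPE('k::field) B)"
proof (rule primeidealI)
  show "ideal {0} (semigroup_ring TYPE('k) B)" by (rule semigroup_idealI[OF affine]) auto
  show "cring (semigroup_ring TYPE('k) B)" by (rule semigroup_ring_cring[OF affine])
  have "(1 :: (int ^ 'n) \<Rightarrow>\<^sub>0 'k) \<in> carrier (semigroup_ring TYPE('k) B)"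
    using affine_semigroup_zero[OF affine] by simp
  then show "carrier (semigroup_ring TYPE('k) B) \<noteq> {0}" by (metis singletonD one_neq_zero)
qed (simp add: group_algebra_mult_eq_0_iff)

lemma prime_power_mem:
  assumes "primeideal p (semigroup_ring TYPE('k::field) B)" "Poly_Mapping.keys f \<subseteq> B" "f ^ k \<in> p"
  shows "f \<in> p"
  using assms(3)
proof (induction k)
  case 0
  then show ?case using semigroup_ideal_one_notin[OF assms(1)] by simp
next
  case (Suc k)
  have "Poly_Mapping.keys (f ^ k) \<subseteq> B"
  proof (induction k)
    case (Suc k)
    then show ?case using keys_mult_subset[OF assms(2) Suc B_add] by simp
  qed (simp add: affine_semigroup_zero[OF affine])
  then show ?case using Suc semigroup_prime[OF assms(1,2), of "f ^ k"] by auto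
qed

text \<open>Provides a generator with index in the support of \<open>m\<close>; applied to
  \<open>u\<close> and \<open>v\<close> with disjoint supports it yields two different
  generators.\<close>

lemma prime_contains_generator:
  assumes p: "primeideal p (semigroup_ring TYPE('k::field) B)"
    and m: "Poly_Mapping.single (ncomb m) 1 \<in> p"
  shows "\<exists>i\<in>{1..d}. 0 < m i \<and> Poly_Mapping.single (e i) 1 \<in> p"
proof -
  have "\<exists>i\<in>D. 0 < m i \<and> Poly_Mapping.single (e i) 1 \<in> p"
    if "finite D" "D \<subseteq> {1..d}" "Poly_Mapping.single (\<Sum>i\<in>D. int (m i) *s e i) 1 \<in> p" for D
    using that
  proof (induction D rule: finite_induct)
    case empty
    then show ?case using semigroup_ideal_one_notin[OF p] by simp
  next
    case (insert j D)
    have "Poly_Mapping.single (\<Sum>i\<in>insert j D. int (m i) *s e i) (1 :: 'k) =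
        Poly_Mapping.single (e j) 1 ^ m j * Poly_Mapping.single (\<Sum>i\<in>D. int (m i) *s e i) 1"
      using insert.hyps by (simp add: single_power mult_single)
    then have mem: "Poly_Mapping.single (e j) 1 ^ m j * Poly_Mapping.single (\<Sum>i\<in>D. int (m i) *s e i) 1 \<in> p"
      using insert.prems(2) by simp
    have j: "j \<in> {1..d}" using insert.prems(1) by simp
    obtain X where X: "B = monoid_closure X" using affine by (auto simp: affine_semigroup_def)
    have D: "(\<Sum>i\<in>D. int (m i) *s e i) \<in> B"
      unfolding X using insert.prems(1) e_in_B
      by (intro monoid_closure_sum monoid_closure_scale) (auto simp flip: X)
    have jB: "int (m j) *s e j \<in> B"
      using monoid_closure_scale[of "e j" X "m j"] e_in_B[OF j] by (simp flip: X)
    have "Poly_Mapping.single (e j) 1 ^ m j \<in> p \<or> Poly_Mapping.single (\<Sum>i\<in>D. int (m i) *s e i) 1 \<in> p"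
      using D jB by (intro semigroup_prime[OF p _ _ mem]) (simp_all add: single_power)
    then show ?case
    proof
      assume *: "Poly_Mapping.single (e j) 1 ^ m j \<in> p"
      then have "Poly_Mapping.single (e j) 1 \<in> p"
        using e_in_B[OF j] by (intro prime_power_mem[OF p _ *]) simp
      moreover have "0 < m j"
        using * semigroup_ideal_one_notin[OF p] by (cases "m j = 0") auto
      ultimately show ?thesis by blast
    next
      assume "Poly_Mapping.single (\<Sum>i\<in>D. int (m i) *s e i) 1 \<in> p"
      then show ?thesis using insert.IH insert.prems(1) by blast
    qed
  qed
  from this[of "{1..d}"] show ?thesis using m by (simp add: ncomb_def comb_def)
qed

text \<open>Some multiple of such an exponent \<open>s\<close> lies in \<open>A\<close> and has
  positive coefficient at \<open>e i\<close>. So a power of t^s is divisible by the monomial of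
  \<open>e i\<close>, and primality removes the power.\<close>

lemma lam_prime_subset:
  assumes p: "primeideal p (semigroup_ring TYPE('k::field) B)"
    and i: "i \<in> {1..d}" "Poly_Mapping.single (e i) 1 \<in> p"
    and f: "Poly_Mapping.keys f \<subseteq> {s \<in> B. 0 < lam i s}"
  shows "f \<in> p"
proof -
  have idp: "ideal p (semigroup_ring TYPE('k) B)" using p by (rule primeideal.axioms(1))
  have mem: "Poly_Mapping.single s 1 \<in> p" if s: "s \<in> B" "0 < lam i s" for s
  proof -
    obtain k m where k: "0 < k" "int k *s s = ncomb m"
      using multiple_in_gens[OF simplicial s(1)] unfolding monoid_closure_e by blast
    have "rat_vec (int k *s s) = (\<Sum>j = 1..d. (of_nat k * lam j s) *s rat_vec (e j))"
      using rat_vec_B[OF s(1)] by (simp add: vec.scale_sum_right vector_smult_assoc)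
    from lam_eqI[OF this i(1)] have "of_nat (m i) = of_nat k * lam i s"
      using lam_ncomb[OF i(1), of m] k(2) by simp
    then have "0 < m i" using k(1) s(2) by (metis of_nat_0_less_iff mult_pos_pos)
    then have "ncomb m = ncomb (\<lambda>j. m j - (if j = i then 1 else 0)) + e i"
      unfolding e_eq_ncomb[OF i(1)] ncomb_add[symmetric] by (intro ncomb_cong) auto
    then have "Poly_Mapping.single s (1 :: 'k) ^ k =
        Poly_Mapping.single (ncomb (\<lambda>j. m j - (if j = i then 1 else 0))) 1 * Poly_Mapping.single (e i) 1"
      by (simp add: single_power mult_single k(2))
    also have "\<dots> \<in> p" using ncomb_in_B by (intro semigroup_ideal_mult[OF affine idp _ i(2)]) simp
    finally have "Poly_Mapping.single s (1 :: 'k) ^ k \<in> p" .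
    from prime_power_mem[OF p _ this] show ?thesis using s(1) by simp
  qed
  have "(\<Sum>s\<in>F. Poly_Mapping.single s (Poly_Mapping.lookup f s)) \<in> p"
    if "finite F" "F \<subseteq> {s \<in> B. 0 < lam i s}" for F
    using that
  proof (induction F rule: finite_induct)
    case empty
    show ?case using semigroup_ideal_zero[OF affine idp] by simp
  next
    case (insert s F)
    have "Poly_Mapping.single 0 (Poly_Mapping.lookup f s) * Poly_Mapping.single s 1 \<in> p"
      using insert.prems mem affine_semigroup_zero[OF affine]
      by (intro semigroup_ideal_mult[OF affine idp]) auto
    then have "Poly_Mapping.single s (Poly_Mapping.lookup f s) \<in> p" by (simp add: mult_single)
    then show ?case using insert semigroup_ideal_add[OF affine idp] by simp
  qed
  from this[OF finite_keys f] show ?thesis by (simp only: sum_single_lookup)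
qed

text \<open>Otherwise some associated prime \<open>p\<close> of \<open>t\<^sup>u\<close> contains both monomials \<open>t\<^sup>u\<close> and \<open>t\<^sup>v\<close>. The
  localization at \<open>p\<close> has depth one but dimension at least two, because a coordinate prime lies
  strictly between \<open>0\<close> and \<open>p\<close>.\<close>

lemma cohen_macaulay_intersection:
  assumes CM: "cohen_macaulay (semigroup_ring TYPE('k::field) B)"
    and disj: "\<And>i. u i = 0 \<or> v i = 0"
    and u: "z + ncomb u \<in> B" and v: "z + ncomb v \<in> B"
  shows "z \<in> B"
proof (rule ccontr)
  assume z: "z \<notin> B"
  let ?R = "semigroup_ring TYPE('k) B"
  let ?t = "\<lambda>s. Poly_Mapping.single s (1 :: 'k)"
  let ?u = "ncomb u" and ?v = "ncomb v"
  interpret R: cring ?R by (rule semigroup_ring_cring[OF affine])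
  have x: "?t ?u \<in> carrier ?R" and y: "?t (z + ?u) \<in> carrier ?R"
    and tv: "?t ?v \<in> carrier ?R" and zv: "?t (z + ?v) \<in> carrier ?R"
    using ncomb_in_B u v by simp_all
  have Idl_iff: "f \<in> Idl\<^bsub>?R\<^esub> {?t ?u} \<longleftrightarrow> (\<exists>r. Poly_Mapping.keys r \<subseteq> B \<and> f = r * ?t ?u)" for f
    using R.mem_genideal_singleton[OF x] by auto
  \<comment> \<open>In the group algebra the quotient of the two monomials is t^z, and
    \<open>z\<close> is outside \<open>B\<close>.\<close>
  have notin: "?t (z + ?u) \<notin> Idl\<^bsub>?R\<^esub> {?t ?u}"
  proof
    assume "?t (z + ?u) \<in> Idl\<^bsub>?R\<^esub> {?t ?u}"
    then obtain r where r: "Poly_Mapping.keys r \<subseteq> B" "?t (z + ?u) = ?t ?u * r"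
      unfolding Idl_iff by (auto simp: mult.commute)
    then have "z + ?u \<in> Poly_Mapping.keys (?t ?u * r)" by (metis keys_single one_neq_zero singletonI)
    then show False using r(1) z unfolding keys_single_mult by auto
  qed
  define Q where "Q f = {r \<in> carrier ?R. r \<otimes>\<^bsub>?R\<^esub> f \<in> Idl\<^bsub>?R\<^esub> {?t ?u}}" for f
  have noeth: "noetherian_ring ?R" using CM by (simp only: cohen_macaulay_def)
  have "ideal (Idl\<^bsub>?R\<^esub> {?t ?u}) ?R" using x by (intro R.genideal_ideal) blast
  from R.exists_prime_colon[OF noeth this y notin, folded Q_def]
  obtain w where w: "w \<in> carrier ?R" and p: "primeideal (Q w) ?R" and sub: "Q (?t (z + ?u)) \<subseteq> Q w"
    by blast
  have "?t ?u \<in> Q w"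
  proof (rule subsetD[OF sub], unfold Q_def, intro CollectI conjI x)
    show "?t ?u \<otimes>\<^bsub>?R\<^esub> ?t (z + ?u) \<in> Idl\<^bsub>?R\<^esub> {?t ?u}"
      unfolding Idl_iff using y by (intro exI[of _ "?t (z + ?u)"]) (simp add: mult.commute)
  qed
  from prime_contains_generator[OF p this] obtain i where i: "i \<in> {1..d}" "0 < u i" "?t (e i) \<in> Q w"
    by blast
  \<comment> \<open>The product of t^v and t^(z+u) equals t^(z+v) times t^u, and t^(z+v) belongs to
    the ring by the assumption on \<open>v\<close>.\<close>
  have "?t ?v \<in> Q w"
  proof (rule subsetD[OF sub], unfold Q_def, intro CollectI conjI tv)
    show "?t ?v \<otimes>\<^bsub>?R\<^esub> ?t (z + ?u) \<in> Idl\<^bsub>?R\<^esub> {?t ?u}"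
      unfolding Idl_iff using zv by (intro exI[of _ "?t (z + ?v)"]) (simp add: mult_single algebra_simps)
  qed
  from prime_contains_generator[OF p this] obtain j where j: "j \<in> {1..d}" "0 < v j" "?t (e j) \<in> Q w"
    by blast
  have ij: "i \<noteq> j" using disj[of i] i(2) j(2) by auto
  define q where "q = {f :: (int ^ 'n) \<Rightarrow>\<^sub>0 'k. Poly_Mapping.keys f \<subseteq> {s \<in> B. 0 < lam i s}}"
  have "?t (e i) \<in> q" using e_in_B[OF i(1)] lam_e[OF i(1) i(1)] by (simp add: q_def)
  moreover have "?t (e i) \<noteq> 0" by (metis insert_not_empty keys_single keys_zero one_neq_zero)
  ultimately have "{0} \<subset> q" by (auto simp: q_def)
  moreover have "q \<subset> Q w"
  proof -
    have "q \<subseteq> Q w" using lam_prime_subset[OF p i(1,3)] unfolding q_def by blast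
    moreover have "?t (e j) \<notin> q" using lam_e[OF i(1) j(1)] ij by (simp add: q_def)
    ultimately show ?thesis using j(3) by blast
  qed
  moreover have "primeideal q ?R" unfolding q_def by (rule lam_primeideal[OF i(1)])
  moreover have "r = \<zero>\<^bsub>?R\<^esub>" if "r \<in> carrier ?R" "?t ?u \<otimes>\<^bsub>?R\<^esub> r = \<zero>\<^bsub>?R\<^esub>" for r
  proof -
    have "?t ?u \<noteq> 0" by (metis insert_not_empty keys_single keys_zero one_neq_zero)
    then show ?thesis using that by (simp add: group_algebra_mult_eq_0_iff)
  qed
  ultimately have "\<not> cohen_macaulay_local (localization ?R (Q w))"
    using primeideal.not_cohen_macaulay_localizationI[OF p x _ w Q_def zero_primeideal, of q] by blast
  then show False using CM p by (simp add: cohen_macaulay_def)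
qed

end

context simplicial_semigroup
begin

subsection \<open>The semigroup \<open>tilde B\<close>\<close>

definition lattice :: "(int ^ 'n) set" where
  "lattice = range comb"

lemma lattice_add: "x \<in> lattice \<Longrightarrow> y \<in> lattice \<Longrightarrow> x + y \<in> lattice"
  by (auto simp: lattice_def simp flip: comb_add)

lemma lattice_diff: "x \<in> lattice \<Longrightarrow> y \<in> lattice \<Longrightarrow> x - y \<in> lattice"
  by (auto simp: lattice_def simp flip: comb_diff)

lemma comb_in_lattice: "comb z \<in> lattice" and ncomb_in_lattice: "ncomb m \<in> lattice"
  by (simp_all add: lattice_def ncomb_def)

lemma zero_in_lattice: "0 \<in> lattice"
  using ncomb_in_lattice[of "\<lambda>_. 0"] by (simp add: ncomb_zero)

lemma lattice_nonneg:
  assumes "x \<in> lattice" "\<And>i. i \<in> {1..d} \<Longrightarrow> 0 \<le> lam i x"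
  shows "\<exists>m. x = ncomb m"
proof -
  obtain z where z: "x = comb z" using assms(1) by (auto simp: lattice_def)
  have "x = ncomb (\<lambda>i. nat (z i))"
    unfolding z ncomb_def using assms(2) by (intro comb_cong) (simp add: z lam_comb)
  then show ?thesis by blast
qed

lemma group_closure_e: "group_closure (monoid_closure (e ` {1..d})) = lattice"
proof (intro equalityI subsetI)
  fix x assume "x \<in> group_closure (monoid_closure (e ` {1..d}))"
  then show "x \<in> lattice" using group_closure_gens_repr[of x e d] by (auto simp: lattice_def comb_def)
next
  fix x assume "x \<in> lattice"
  then obtain z where "x = comb z" by (auto simp: lattice_def)
  also have "\<dots> = ncomb (\<lambda>i. nat (z i)) - ncomb (\<lambda>i. nat (- z i))"
    unfolding ncomb_def comb_diff[symmetric] by (intro comb_cong) simp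
  also have "\<dots> \<in> group_closure (monoid_closure (e ` {1..d}))"
    unfolding monoid_closure_e by (intro group_closure.diff group_closure.base) auto
  finally show "x \<in> group_closure (monoid_closure (e ` {1..d}))" .
qed

lemma minimal_subset: "x \<in> minimal_elems B d e \<Longrightarrow> x \<in> B"
  by (simp add: minimal_elems_def)

lemma minimal_classes_iff:
  "\<Gamma> \<in> minimal_classes B d e \<longleftrightarrow>
    (\<exists>y\<in>minimal_elems B d e. \<Gamma> = {x \<in> minimal_elems B d e. y - x \<in> lattice})"
proof -
  have "{(x, y). x \<in> minimal_elems B d e \<and> y \<in> minimal_elems B d e \<and> x - y \<in> lattice} `` {y} =
      {x \<in> minimal_elems B d e. y - x \<in> lattice}" if "y \<in> minimal_elems B d e" for y
    using that by auto
  then show ?thesis unfolding minimal_classes_def group_closure_e quotient_def by auto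
qed

context
  fixes \<Gamma> assumes \<Gamma>: "\<Gamma> \<in> minimal_classes B d e"
begin

lemma class_minimal: "x \<in> \<Gamma> \<Longrightarrow> x \<in> minimal_elems B d e"
  using \<Gamma> by (auto simp: minimal_classes_iff)

lemma class_subset: "x \<in> \<Gamma> \<Longrightarrow> x \<in> B"
  using class_minimal minimal_subset by blast

lemma class_nonempty: "\<Gamma> \<noteq> {}"
  using \<Gamma> zero_in_lattice by (auto simp: minimal_classes_iff)

lemma class_finite: "finite \<Gamma>"
  using finite_subset[OF _ finite_minimal_elems[OF affine simplicial], of \<Gamma>] class_minimal by blast

lemma class_diff: "x \<in> \<Gamma> \<Longrightarrow> y \<in> \<Gamma> \<Longrightarrow> x - y \<in> lattice"
proof -
  assume "x \<in> \<Gamma>" "y \<in> \<Gamma>"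
  then obtain w where "w - x \<in> lattice" "w - y \<in> lattice" using \<Gamma> by (auto simp: minimal_classes_iff)
  from lattice_diff[OF this(2,1)] show ?thesis by simp
qed

lemma class_memI:
  assumes "x \<in> \<Gamma>" "w \<in> minimal_elems B d e" "x - w \<in> lattice"
  shows "w \<in> \<Gamma>"
proof -
  obtain y where y: "\<Gamma> = {x \<in> minimal_elems B d e. y - x \<in> lattice}" using \<Gamma> by (auto simp: minimal_classes_iff)
  then have "y - x \<in> lattice" using assms(1) by blast
  from lattice_add[OF this assms(3)] show ?thesis using y assms(2) by simp
qed

lemma lam_class_min:
  assumes "i \<in> {1..d}"
  shows "lam i (class_min d e \<Gamma>) = Min (lam i ` \<Gamma>)"
proof -
  have "lam i ` \<Gamma> = coord d e i ` \<Gamma>" using lam_eq_coord[OF class_subset assms] by (intro image_cong) auto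
  then show ?thesis using lam_eqI[OF rat_vec_class_min[OF affine simplicial \<Gamma>] assms] by simp
qed

lemma lam_class_min_le: "i \<in> {1..d} \<Longrightarrow> x \<in> \<Gamma> \<Longrightarrow> lam i (class_min d e \<Gamma>) \<le> lam i x"
  using class_finite by (simp add: lam_class_min)

lemma lam_class_min_attained:
  assumes "i \<in> {1..d}"
  shows "\<exists>x\<in>\<Gamma>. lam i x = lam i (class_min d e \<Gamma>)"
proof -
  have "Min (lam i ` \<Gamma>) \<in> lam i ` \<Gamma>" using class_finite class_nonempty by (intro Min_in) auto
  then show ?thesis using lam_class_min[OF assms] by auto
qed

text \<open>In coordinate \<open>i\<close> the minimum is attained by some \<open>y\<close> of the
  class, and \<open>x - y\<close> has integer coordinates. The choice of \<open>y\<close> depends on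
  \<open>i\<close>, but integrality of each coordinate is enough.\<close>

lemma diff_class_min:
  assumes "x \<in> \<Gamma>"
  shows "x - class_min d e \<Gamma> \<in> lattice"
proof -
  let ?h = "class_min d e \<Gamma>"
  have "\<exists>z. lam i x - lam i ?h = of_int z" if i: "i \<in> {1..d}" for i
  proof -
    obtain y where y: "y \<in> \<Gamma>" "lam i y = lam i ?h" using lam_class_min_attained[OF i] by blast
    obtain z where z: "x - y = comb z" using class_diff[OF assms y(1)] by (auto simp: lattice_def)
    have "lam i x - lam i ?h = of_int (z i)" using lam_comb[OF i, of z] lam_diff[of i x y] z y(2) by simp
    then show ?thesis by blast
  qed
  then obtain z where z: "\<And>i. i \<in> {1..d} \<Longrightarrow> lam i x - lam i ?h = of_int (z i)" by metis
  have "rat_vec ?h = (\<Sum>i = 1..d. lam i ?h *s rat_vec (e i))"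
    using rat_vec_class_min[OF affine simplicial \<Gamma>] lam_eqI[OF rat_vec_class_min[OF affine simplicial \<Gamma>]] by simp
  then have "rat_vec (x - ?h) = (\<Sum>i = 1..d. (lam i x - lam i ?h) *s rat_vec (e i))"
    using rat_vec_B[OF class_subset[OF assms]] by (simp add: vector_sub_rdistrib sum_subtractf)
  also have "\<dots> = rat_vec (comb z)" by (simp add: comb_def rat_vec_sum z)
  finally have "x - ?h = comb z" by (simp only: rat_vec_eq_iff)
  then show ?thesis by (simp add: comb_in_lattice)
qed

lemma class_min_repr:
  assumes "x \<in> \<Gamma>"
  shows "\<exists>m. x = class_min d e \<Gamma> + ncomb m"
proof -
  obtain m where "x - class_min d e \<Gamma> = ncomb m"
    using lattice_nonneg[OF diff_class_min[OF assms]] lam_class_min_le assms by (auto simp: lam_diff)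
  then show ?thesis by (intro exI[of _ m]) (simp add: algebra_simps)
qed

end

lemma class_exists: "w \<in> minimal_elems B d e \<Longrightarrow> \<exists>\<Gamma>\<in>minimal_classes B d e. w \<in> \<Gamma>"
  using zero_in_lattice
  by (intro bexI[of _ "{x \<in> minimal_elems B d e. w - x \<in> lattice}"]) (auto simp: minimal_classes_iff)

lemma class_unique:
  assumes "\<Gamma> \<in> minimal_classes B d e" "\<Delta> \<in> minimal_classes B d e" "x \<in> \<Gamma>" "y \<in> \<Delta>" "x - y \<in> lattice"
  shows "\<Gamma> = \<Delta>"
proof -
  have sub: "\<Delta>' \<subseteq> \<Gamma>'"
    if "\<Gamma>' \<in> minimal_classes B d e" "\<Delta>' \<in> minimal_classes B d e" "x' \<in> \<Gamma>'" "y' \<in> \<Delta>'" "x' - y' \<in> lattice"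
    for \<Gamma>' \<Delta>' x' y'
  proof
    fix w assume w: "w \<in> \<Delta>'"
    have "x' - w \<in> lattice" using lattice_add[OF that(5) class_diff[OF that(2,4) w]] by simp
    then show "w \<in> \<Gamma>'" by (rule class_memI[OF that(1,3) class_minimal[OF that(2) w]])
  qed
  have "y - x \<in> lattice" using lattice_diff[OF zero_in_lattice assms(5)] by simp
  then show ?thesis using sub[OF assms] sub[OF assms(2,1,4,3)] by blast
qed

text \<open>Subtracting a nonzero element of \<open>A\<close> lowers the sum of the coordinates by
  at least one, and inside \<open>B\<close> this sum is nonnegative; its floor is the induction
  measure.\<close>

lemma exists_minimal_below:
  assumes "b \<in> B"
  shows "\<exists>x\<in>minimal_elems B d e. \<exists>m. b = x + ncomb m"
  using assms
proof (induction "nat \<lfloor>\<Sum>i = 1..d. lam i b\<rfloor>" arbitrary: b rule: less_induct)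
  case less
  show ?case
  proof (cases "b \<in> minimal_elems B d e")
    case True
    then show ?thesis by (intro bexI[of _ b] exI[of _ "\<lambda>_. 0"]) (auto simp: ncomb_zero)
  next
    case False
    then obtain a where a: "a \<in> monoid_closure (e ` {1..d})" "a \<noteq> 0" "b - a \<in> B"
      using less.prems unfolding minimal_elems_def by blast
    then obtain m where m: "ncomb m \<noteq> 0" "b - ncomb m \<in> B" unfolding monoid_closure_e by blast
    let ?a = "ncomb m"
    have "\<exists>j\<in>{1..d}. m j \<noteq> 0"
    proof (rule ccontr)
      assume "\<not> (\<exists>j\<in>{1..d}. m j \<noteq> 0)"
      then have "?a = ncomb (\<lambda>_. 0)" by (intro ncomb_cong) auto
      then show False using m(1) by (simp add: ncomb_zero)
    qed
    then obtain j where j: "j \<in> {1..d}" "m j \<noteq> 0" by blast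
    have "(1::nat) \<le> m j" using j(2) by simp
    also have "\<dots> \<le> (\<Sum>i = 1..d. m i)" using j(1) by (intro member_le_sum) auto
    finally have "of_nat 1 \<le> (of_nat (\<Sum>i = 1..d. m i) :: rat)" by (simp only: of_nat_le_iff)
    then have "(1::rat) \<le> of_nat (\<Sum>i = 1..d. m i)" by simp
    moreover have "(\<Sum>i = 1..d. lam i (b - ?a)) = (\<Sum>i = 1..d. lam i b) - of_nat (\<Sum>i = 1..d. m i)"
      by (simp add: lam_diff lam_ncomb sum_subtractf)
    moreover have "0 \<le> (\<Sum>i = 1..d. lam i (b - ?a))" using lam_nonneg[OF m(2)] by (intro sum_nonneg)
    ultimately have "nat \<lfloor>\<Sum>i = 1..d. lam i (b - ?a)\<rfloor> < nat \<lfloor>\<Sum>i = 1..d. lam i b\<rfloor>" by linarith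
    from less.hyps[OF this m(2)] obtain x m' where x: "x \<in> minimal_elems B d e" "b - ?a = x + ncomb m'"
      by blast
    then have "b = x + ncomb (\<lambda>i. m' i + m i)" by (simp add: ncomb_add algebra_simps)
    then show ?thesis using x(1) by blast
  qed
qed

lemma B_repr:
  assumes "b \<in> B"
  shows "\<exists>\<Gamma>\<in>minimal_classes B d e. \<exists>x\<in>\<Gamma>. \<exists>m m'. b = x + ncomb m \<and>
    b = class_min d e \<Gamma> + ncomb m'"
proof -
  obtain x m where x: "x \<in> minimal_elems B d e" "b = x + ncomb m"
    using exists_minimal_below[OF assms] by blast
  obtain \<Gamma> where \<Gamma>: "\<Gamma> \<in> minimal_classes B d e" "x \<in> \<Gamma>" using class_exists[OF x(1)] by blast
  obtain n where "x = class_min d e \<Gamma> + ncomb n" using class_min_repr[OF \<Gamma>] by blast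
  then have "b = class_min d e \<Gamma> + ncomb (\<lambda>i. n i + m i)" using x(2) by (simp add: ncomb_add algebra_simps)
  then show ?thesis using x(2) \<Gamma> by blast
qed

text \<open>Arbitrary representatives determine the class \<open>\<Theta>\<close> and show that the
  difference is in \<open>lattice\<close>. For its sign in coordinate \<open>i\<close>, choose
  \<open>x'\<close> and \<open>y'\<close> attaining the two minima there: the minimal element below
  \<open>x' + y'\<close> is again in \<open>\<Theta>\<close>, so its coordinate is at least that of
  the minimum of \<open>\<Theta>\<close>.\<close>

lemma class_min_add:
  assumes \<Gamma>: "\<Gamma> \<in> minimal_classes B d e" and \<Delta>: "\<Delta> \<in> minimal_classes B d e"
  shows "\<exists>\<Theta>\<in>minimal_classes B d e. \<exists>m. class_min d e \<Gamma> + class_min d e \<Delta> = class_min d e \<Theta> + ncomb m"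
proof -
  obtain x y where x: "x \<in> \<Gamma>" and y: "y \<in> \<Delta>" using class_nonempty[OF \<Gamma>] class_nonempty[OF \<Delta>] by blast
  have xy: "x + y \<in> B" using class_subset[OF \<Gamma> x] class_subset[OF \<Delta> y] by (rule B_add)
  obtain \<Theta> w m where \<Theta>: "\<Theta> \<in> minimal_classes B d e" and w: "w \<in> \<Theta>" "x + y = w + ncomb m"
    using B_repr[OF xy] by blast
  let ?g = "class_min d e \<Gamma>" and ?h = "class_min d e \<Delta>" and ?k = "class_min d e \<Theta>"
  have eq: "?g + ?h - ?k = ((w - ?k) - (x - ?g)) - (y - ?h) + ncomb m"
    using w(2) by (simp add: algebra_simps)
  have lat: "?g + ?h - ?k \<in> lattice"
    unfolding eq using diff_class_min[OF \<Gamma> x] diff_class_min[OF \<Delta> y] diff_class_min[OF \<Theta> w(1)]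
    by (intro lattice_add[OF lattice_diff[OF lattice_diff]] ncomb_in_lattice)
  have "0 \<le> lam i (?g + ?h - ?k)" if i: "i \<in> {1..d}" for i
  proof -
    obtain x' where x': "x' \<in> \<Gamma>" "lam i x' = lam i ?g" using lam_class_min_attained[OF \<Gamma> i] by blast
    obtain y' where y': "y' \<in> \<Delta>" "lam i y' = lam i ?h" using lam_class_min_attained[OF \<Delta> i] by blast
    have "x' + y' \<in> B" using class_subset[OF \<Gamma> x'(1)] class_subset[OF \<Delta> y'(1)] by (rule B_add)
    then obtain w' m' where w': "w' \<in> minimal_elems B d e" "x' + y' = w' + ncomb m'"
      using exists_minimal_below by blast
    have "w - w' = (x - x') + (y - y') - (ncomb m - ncomb m')"
      using w(2) w'(2) by (simp add: algebra_simps)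
    also have "\<dots> \<in> lattice"
      by (intro lattice_diff[OF lattice_add lattice_diff] ncomb_in_lattice class_diff[OF \<Gamma> x x'(1)] class_diff[OF \<Delta> y y'(1)])
    finally have "w' \<in> \<Theta>" by (rule class_memI[OF \<Theta> w(1) w'(1)])
    from lam_class_min_le[OF \<Theta> i this] have "lam i ?k \<le> lam i w'" .
    also have "\<dots> \<le> lam i w' + lam i (ncomb m')" using lam_ncomb[OF i, of m'] by simp
    also have "\<dots> = lam i x' + lam i y'" using w'(2) by (simp flip: lam_add)
    finally show ?thesis using x'(2) y'(2) by (simp add: lam_diff lam_add)
  qed
  from lattice_nonneg[OF lat this] obtain n where "?g + ?h - ?k = ncomb n" by blast
  then have "?g + ?h = ?k + ncomb n" by (simp add: algebra_simps)
  then show ?thesis using \<Theta> by blast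
qed

text \<open>A single class minimum suffices, because the sum of two is another one plus an element
  of \<open>A\<close>. Zero and the generators \<open>e i\<close> lie in \<open>B\<close> and are
  covered by \<open>B_repr\<close>.\<close>

lemma tilde_eq:
  "tilde B d e = {h + ncomb m | h m. h \<in> class_min d e ` minimal_classes B d e}" (is "_ = ?T")
proof (intro equalityI subsetI)
  fix x assume "x \<in> tilde B d e"
  then show "x \<in> ?T"
    unfolding tilde_def
  proof (induction rule: monoid_closure.induct)
    case zero
    show ?case using B_repr[OF affine_semigroup_zero[OF affine]] by blast
  next
    case (base x)
    show ?case
    proof (cases "x \<in> e ` {1..d}")
      case True
      then have "x \<in> B" using e_in_B by blast
      then show ?thesis using B_repr by blast
    next
      case False
      then have "x \<in> class_min d e ` minimal_classes B d e" using base by blast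
      moreover have "x = x + ncomb (\<lambda>_. 0)" by (simp add: ncomb_zero)
      ultimately show ?thesis by blast
    qed
  next
    case (add x y)
    then obtain \<Gamma> \<Delta> m n where \<Gamma>: "\<Gamma> \<in> minimal_classes B d e" "x = class_min d e \<Gamma> + ncomb m"
      and \<Delta>: "\<Delta> \<in> minimal_classes B d e" "y = class_min d e \<Delta> + ncomb n" by blast
    obtain \<Theta> k where \<Theta>: "\<Theta> \<in> minimal_classes B d e"
      "class_min d e \<Gamma> + class_min d e \<Delta> = class_min d e \<Theta> + ncomb k"
      using class_min_add[OF \<Gamma>(1) \<Delta>(1)] by blast
    have "x + y = (class_min d e \<Gamma> + class_min d e \<Delta>) + (ncomb m + ncomb n)"
      using \<Gamma>(2) \<Delta>(2) by (simp add: algebra_simps)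
    also have "\<dots> = class_min d e \<Theta> + ncomb (\<lambda>i. k i + (m i + n i))"
      unfolding \<Theta>(2) by (simp add: ncomb_add algebra_simps)
    finally show ?case using \<Theta>(1) by blast
  qed
next
  fix x assume "x \<in> ?T"
  then obtain h m where x: "x = h + ncomb m" "h \<in> class_min d e ` minimal_classes B d e" by blast
  have "ncomb m \<in> monoid_closure (e ` {1..d})" unfolding monoid_closure_e by blast
  also have "\<dots> \<subseteq> tilde B d e"
    unfolding tilde_def by (rule monoid_closure_subset) (auto intro: monoid_closure.base)
  finally have "ncomb m \<in> tilde B d e" .
  moreover have "h \<in> tilde B d e" unfolding tilde_def using x(2) by (intro monoid_closure.base) blast
  ultimately show "x \<in> tilde B d e" unfolding x(1) tilde_def by (intro monoid_closure.add)
qed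

lemma subset_tilde: "B \<subseteq> tilde B d e"
proof
  fix b assume "b \<in> B"
  from B_repr[OF this] show "b \<in> tilde B d e" unfolding tilde_eq by blast
qed

lemma tilde_subset_cone: "rat_vec ` tilde B d e \<subseteq> rat_cone (rat_vec ` B)"
proof -
  have "rat_vec x \<in> rat_cone (rat_vec ` B)" if "x \<in> tilde B d e" for x
    using that unfolding tilde_def
  proof (induction rule: monoid_closure.induct)
    case zero
    show ?case by (simp add: rat_cone_zero)
  next
    case (base x)
    then show ?case
    proof
      assume "x \<in> e ` {1..d}"
      then show ?thesis using e_in_B by (intro rat_cone_base) blast
    next
      assume "x \<in> class_min d e ` minimal_classes B d e"
      then obtain \<Gamma> where \<Gamma>: "\<Gamma> \<in> minimal_classes B d e" "x = class_min d e \<Gamma>" by blast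
      have "0 \<le> Min (coord d e i ` \<Gamma>)" if "i \<in> {1..d}" for i
        using class_finite[OF \<Gamma>(1)] class_nonempty[OF \<Gamma>(1)] class_subset[OF \<Gamma>(1)]
          simplicial_repr(2)[OF simplicial _ that] by (subst Min_ge_iff) auto
      then show ?thesis
        unfolding rat_cone_iff[OF simplicial] \<Gamma>(2)
        using rat_vec_class_min[OF affine simplicial \<Gamma>(1)]
        by (intro exI[of _ "\<lambda>i. Min (coord d e i ` \<Gamma>)"] conjI ballI)
    qed
  next
    case (add x y)
    then show ?case using rat_cone_add_scale[OF simplicial, of "rat_vec x" "rat_vec y" 1] by simp
  qed
  then show ?thesis by blast
qed

text \<open>If two translates meet, their base points are congruent modulo \<open>lattice\<close>;
  then so are the elements of the two classes, which therefore coincide.\<close>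

lemma tilde_free: "free_semigroup d e lam (class_min d e ` minimal_classes B d e) (tilde B d e)"
proof
  show "lam i (x + y) = lam i x + lam i y" for i x y by (rule lam_add)
  show "lam i (e j) = (if i = j then 1 else 0)" if "i \<in> {1..d}" "j \<in> {1..d}" for i j
    using lam_e[OF that] .
  have "finite (minimal_classes B d e)"
    unfolding minimal_classes_def using finite_minimal_elems[OF affine simplicial]
    by (rule finite_quotient) auto
  then show "finite (class_min d e ` minimal_classes B d e)" by simp
  show "0 \<le> lam i h" if h: "h \<in> class_min d e ` minimal_classes B d e" and i: "i \<in> {1..d}" for h i
  proof -
    obtain \<Gamma> where \<Gamma>: "\<Gamma> \<in> minimal_classes B d e" "h = class_min d e \<Gamma>" using h by blast
    obtain x where "x \<in> \<Gamma>" "lam i x = lam i h" using lam_class_min_attained[OF \<Gamma>(1) i] \<Gamma>(2) by blast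
    then show ?thesis using lam_nonneg[OF class_subset[OF \<Gamma>(1)] i] by metis
  qed
  show "tilde B d e = {h + (\<Sum>i = 1..d. int (m i) *s e i) | h m. h \<in> class_min d e ` minimal_classes B d e}"
    unfolding tilde_eq ncomb_def comb_def ..
  show "affine_semigroup (tilde B d e)" by (rule tilde_affine_semigroup[OF affine simplicial])
  fix h h' m m'
  assume h: "h \<in> class_min d e ` minimal_classes B d e" and h': "h' \<in> class_min d e ` minimal_classes B d e"
    and eq: "h + (\<Sum>i = 1..d. int (m i) *s e i) = h' + (\<Sum>i = 1..d. int (m' i) *s e i)"
  obtain \<Gamma> \<Delta> where \<Gamma>: "\<Gamma> \<in> minimal_classes B d e" "h = class_min d e \<Gamma>"
    and \<Delta>: "\<Delta> \<in> minimal_classes B d e" "h' = class_min d e \<Delta>" using h h' by blast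
  obtain x y where x: "x \<in> \<Gamma>" and y: "y \<in> \<Delta>" using class_nonempty[OF \<Gamma>(1)] class_nonempty[OF \<Delta>(1)] by blast
  have "h + ncomb m = h' + ncomb m'" using eq by (simp add: ncomb_def comb_def)
  then have "x - y = (x - h) - (y - h') + (ncomb m' - ncomb m)"
    by (simp add: algebra_simps)
  also have "\<dots> \<in> lattice"
    using diff_class_min[OF \<Gamma>(1) x] diff_class_min[OF \<Delta>(1) y] \<Gamma>(2) \<Delta>(2)
    by (intro lattice_add[OF lattice_diff lattice_diff] ncomb_in_lattice) auto
  finally have "\<Gamma> = \<Delta>" by (rule class_unique[OF \<Gamma>(1) \<Delta>(1) x y])
  then show "h = h'" using \<Gamma>(2) \<Delta>(2) by simp
qed

text \<open>The minimum vector of a class is reached by repeatedly taking coordinatewise minima of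
  elements of the class, none of which leaves \<open>B'\<close>.\<close>

lemma tilde_minimal:
  assumes B': "affine_semigroup B'" "B \<subseteq> B'" "rat_vec ` B' \<subseteq> rat_cone (rat_vec ` B)"
    and CM: "cohen_macaulay (semigroup_ring TYPE('k::field) B')"
  shows "tilde B d e \<subseteq> B'"
proof -
  interpret B': simplicial_semigroup B' d e
    by unfold_locales (use B'(1) simplicial_gens_extend[OF simplicial B'(2,3)] in auto)
  have "class_min d e \<Gamma> \<in> B'" if \<Gamma>: "\<Gamma> \<in> minimal_classes B d e" for \<Gamma>
  proof -
    define T where "T = {m. class_min d e \<Gamma> + ncomb m \<in> B'}"
    have T_min: "(\<lambda>i. min (a i) (b i)) \<in> T" if ab: "a \<in> T" "b \<in> T" for a b
    proof -
      let ?c = "\<lambda>i. min (a i) (b i)"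
      have split: "class_min d e \<Gamma> + ncomb ?c + ncomb (\<lambda>i. f i - ?c i) = class_min d e \<Gamma> + ncomb f"
        if "\<And>i. ?c i \<le> f i" for f
      proof -
        have "ncomb f = ncomb (\<lambda>i. ?c i + (f i - ?c i))"
          using that by (intro ncomb_cong) simp
        then show ?thesis by (simp only: ncomb_add add.assoc)
      qed
      \<comment> \<open>At every index one of \<open>a\<close> and \<open>b\<close> equals the
        minimum \<open>?c\<close>, so \<open>a - ?c\<close> and \<open>b - ?c\<close> have disjoint
        supports, as the intersection property requires.\<close>
      have "class_min d e \<Gamma> + ncomb ?c \<in> B'"
      proof (rule B'.cohen_macaulay_intersection[OF CM, where u = "\<lambda>i. a i - ?c i" and v = "\<lambda>i. b i - ?c i"])
        show "class_min d e \<Gamma> + ncomb ?c + ncomb (\<lambda>i. a i - ?c i) \<in> B'"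
          "class_min d e \<Gamma> + ncomb ?c + ncomb (\<lambda>i. b i - ?c i) \<in> B'"
          using split[of a] split[of b] ab by (simp_all only: T_def mem_Collect_eq min.cobounded1 min.cobounded2)
      qed auto
      then show ?thesis by (simp add: T_def)
    qed
    have class_T: "\<exists>m\<in>T. x = class_min d e \<Gamma> + ncomb m" if "x \<in> \<Gamma>" for x
      using class_min_repr[OF \<Gamma> that] class_subset[OF \<Gamma> that] B'(2) by (auto simp: T_def)
    have "\<exists>m\<in>T. \<forall>i\<in>D. m i = 0" if "finite D" "D \<subseteq> {1..d}" for D
      using that
    proof (induction D rule: finite_induct)
      case empty
      then show ?case using class_T class_nonempty[OF \<Gamma>] by blast
    next
      case (insert j D)
      then obtain m where m: "m \<in> T" "\<forall>i\<in>D. m i = 0" by blast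
      have j: "j \<in> {1..d}" using insert.prems by simp
      obtain x where x: "x \<in> \<Gamma>" "lam j x = lam j (class_min d e \<Gamma>)" using lam_class_min_attained[OF \<Gamma> j] by blast
      obtain n where n: "n \<in> T" "x = class_min d e \<Gamma> + ncomb n" using class_T[OF x(1)] by blast
      \<comment> \<open>\<open>x\<close> attains the minimum in coordinate \<open>j\<close>, so its
        exponent there is zero; taking the minimum with \<open>m\<close> keeps the zeros already
        obtained on \<open>D\<close>.\<close>
      have "n j = 0" using x(2) n(2) lam_ncomb[OF j, of n] by (simp add: lam_add)
      then show ?case using m T_min[OF m(1) n(1)] by (intro bexI[of _ "\<lambda>i. min (m i) (n i)"]) auto
    qed
    from this[of "{1..d}"] obtain m where m: "m \<in> T" "\<forall>i\<in>{1..d}. m i = 0" by blast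
    have "ncomb m = ncomb (\<lambda>_. 0)" using m(2) by (intro ncomb_cong) auto
    then show ?thesis using m(1) by (simp add: T_def ncomb_zero)
  qed
  then show ?thesis
    unfolding tilde_eq using B'.ncomb_in_B B'.B_add by blast
qed

end

theorem theorem3p5:
  fixes B :: "(int ^ 'n) set" and d :: nat and e :: "nat \<Rightarrow> int ^ 'n"
  assumes "affine_semigroup B"
    and "simplicial_gens B d e"
  shows "B \<subseteq> tilde B d e \<and>
    rat_vec ` tilde B d e \<subseteq> rat_cone (rat_vec ` B) \<and>
    cohen_macaulay (semigroup_ring TYPE('k::field) (tilde B d e)) \<and>
    (\<forall>B'. affine_semigroup B' \<and> B \<subseteq> B' \<and> rat_vec ` B' \<subseteq> rat_cone (rat_vec ` B) \<and>
           cohen_macaulay (semigroup_ring TYPE('k) B') \<longrightarrow> tilde B d e \<subseteq> B')"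
proof -
  interpret simplicial_semigroup B d e by unfold_locales (fact assms)+
  show ?thesis
    using subset_tilde tilde_subset_cone tilde_minimal
      free_semigroup.semigroup_ring_cohen_macaulay[OF tilde_free] by blast
qed

end
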